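(* Let $(\mathcal{M},\otimes,\mathbf{1},\sigma)$ be a symmetric monoidal category with equalizers which are preserved by $X\otimes(-)$ and $(-)\otimes X$, for any $X\in\mathcal{M}$. Then the category $\mathsf{Hopf}_{\mathrm{coc}}(\mathcal{M})$ is finitely complete. In particular, this happens when $(\mathcal{M},\otimes,\mathbf{1},\sigma)$ is an abelian symmetric monoidal category.
   Context: $\mathsf{Hopf}_{\mathrm{coc}}(\mathcal{M})$ is the category of cocommutative Hopf monoids in $\mathcal{M}$, i.e. Hopf monoids $(A,m_A,u_A,\Delta_A,\varepsilon_A,S_A)$ with $\sigma_{A,A}\Delta_A=\Delta_A$, and Hopf monoid morphisms. An abelian symmetric monoidal category is a symmetric monoidal category whose underlying category is abelian and such that $M\otimes(-)$ and $(-)\otimes M$ are additive and exact for every object $M$. *)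

theory Defs
  imports "HOL-Algebra.Group"
begin

section \<open>Categories, functors and finite limits\<close>

text \<open>A category is given by its hom-sets. They need not be disjoint (so that a structured
  category can reuse the arrows of the underlying one); an arrow \<open>f\<close> therefore has no
  intrinsic domain and codomain, and notions such as equalizers mention the objects explicitly.
  A category presented by domain and codomain functions is the special case where the hom-sets
  are disjoint. Composition is written in the order \<open>g \<cdot> f\<close>, ``first \<open>f\<close>, then \<open>g\<close>''.\<close>

record ('o, 'm) category =
  Obj :: "'o set"
  Hom :: "'o \<Rightarrow> 'o \<Rightarrow> 'm set"
  cmp :: "'m \<Rightarrow> 'm \<Rightarrow> 'm" (infixr "\<cdot>\<index>" 65)
  idt :: "'o \<Rightarrow> 'm"

locale category =
  fixes C :: "('o, 'm, 'z) category_scheme" (structure)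
  assumes Hom_Obj: "f \<in> Hom C A B \<Longrightarrow> A \<in> Obj C \<and> B \<in> Obj C"
    and idt_Hom: "A \<in> Obj C \<Longrightarrow> idt C A \<in> Hom C A A"
    and cmp_Hom: "\<lbrakk>f \<in> Hom C A B; g \<in> Hom C B D\<rbrakk> \<Longrightarrow> g \<cdot> f \<in> Hom C A D"
    and cmp_idt_left: "f \<in> Hom C A B \<Longrightarrow> idt C B \<cdot> f = f"
    and cmp_idt_right: "f \<in> Hom C A B \<Longrightarrow> f \<cdot> idt C A = f"
    and cmp_assoc: "\<lbrakk>f \<in> Hom C A B; g \<in> Hom C B D; h \<in> Hom C D E\<rbrakk>
                      \<Longrightarrow> (h \<cdot> g) \<cdot> f = h \<cdot> (g \<cdot> f)"

locale cat_functor = dom: category J + cod: category C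
  for J :: "('i, 'k, 'y) category_scheme" and C :: "('o, 'm, 'z) category_scheme"
    and Fo :: "'i \<Rightarrow> 'o" and Fm :: "'k \<Rightarrow> 'm" +
  assumes map_Obj: "i \<in> Obj J \<Longrightarrow> Fo i \<in> Obj C"
    and map_Hom: "u \<in> Hom J i j \<Longrightarrow> Fm u \<in> Hom C (Fo i) (Fo j)"
    and map_idt: "i \<in> Obj J \<Longrightarrow> Fm (idt J i) = idt C (Fo i)"
    and map_cmp: "\<lbrakk>u \<in> Hom J i j; v \<in> Hom J j k\<rbrakk> \<Longrightarrow> Fm (v \<cdot>\<^bsub>J\<^esub> u) = Fm v \<cdot>\<^bsub>C\<^esub> Fm u"

definition is_cone ::
  "('i, 'k, 'y) category_scheme \<Rightarrow> ('o, 'm, 'z) category_scheme \<Rightarrow> ('i \<Rightarrow> 'o) \<Rightarrow> ('k \<Rightarrow> 'm)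
    \<Rightarrow> 'o \<Rightarrow> ('i \<Rightarrow> 'm) \<Rightarrow> bool" where
  "is_cone J C Fo Fm L p \<longleftrightarrow>
     L \<in> Obj C \<and> (\<forall>i\<in>Obj J. p i \<in> Hom C L (Fo i)) \<and>
     (\<forall>i\<in>Obj J. \<forall>j\<in>Obj J. \<forall>u\<in>Hom J i j. Fm u \<cdot>\<^bsub>C\<^esub> p i = p j)"

definition is_limit ::
  "('i, 'k, 'y) category_scheme \<Rightarrow> ('o, 'm, 'z) category_scheme \<Rightarrow> ('i \<Rightarrow> 'o) \<Rightarrow> ('k \<Rightarrow> 'm)
    \<Rightarrow> 'o \<Rightarrow> ('i \<Rightarrow> 'm) \<Rightarrow> bool" where
  "is_limit J C Fo Fm L p \<longleftrightarrow>
     is_cone J C Fo Fm L p \<and>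
     (\<forall>X q. is_cone J C Fo Fm X q \<longrightarrow>
        (\<exists>!h. h \<in> Hom C X L \<and> (\<forall>i\<in>Obj J. p i \<cdot>\<^bsub>C\<^esub> h = q i)))"

definition finite_category :: "('i, 'k, 'y) category_scheme \<Rightarrow> bool" where
  "finite_category J \<longleftrightarrow>
     category J \<and> finite (Obj J) \<and> (\<forall>i\<in>Obj J. \<forall>j\<in>Obj J. finite (Hom J i j))"

text \<open>Every finite category is isomorphic to one whose objects and arrows are natural numbers,
  so it suffices to let the shapes \<open>J\<close> range over the latter.\<close>

definition finitely_complete :: "('o, 'm, 'z) category_scheme \<Rightarrow> bool" where
  "finitely_complete C \<longleftrightarrow>
     category C \<and>
     (\<forall>(J :: (nat, nat) category) Fo Fm. finite_category J \<and> cat_functor J C Fo Fm \<longrightarrow>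
        (\<exists>L p. is_limit J C Fo Fm L p))"

text \<open>\<open>is_equalizer C A B f g E e\<close>: the arrow \<open>e : E \<rightarrow> A\<close> is an equalizer of
  \<open>f, g : A \<rightarrow> B\<close>. \<open>is_coequalizer C A B f g Q q\<close>: the arrow \<open>q : B \<rightarrow> Q\<close> is a
  coequalizer of \<open>f, g : A \<rightarrow> B\<close>.\<close>

definition is_equalizer ::
  "('o, 'm, 'z) category_scheme \<Rightarrow> 'o \<Rightarrow> 'o \<Rightarrow> 'm \<Rightarrow> 'm \<Rightarrow> 'o \<Rightarrow> 'm \<Rightarrow> bool" where
  "is_equalizer C A B f g E e \<longleftrightarrow>
     f \<in> Hom C A B \<and> g \<in> Hom C A B \<and> e \<in> Hom C E A \<and> f \<cdot>\<^bsub>C\<^esub> e = g \<cdot>\<^bsub>C\<^esub> e \<and>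
     (\<forall>X h. h \<in> Hom C X A \<and> f \<cdot>\<^bsub>C\<^esub> h = g \<cdot>\<^bsub>C\<^esub> h \<longrightarrow>
        (\<exists>!k. k \<in> Hom C X E \<and> e \<cdot>\<^bsub>C\<^esub> k = h))"

definition is_coequalizer ::
  "('o, 'm, 'z) category_scheme \<Rightarrow> 'o \<Rightarrow> 'o \<Rightarrow> 'm \<Rightarrow> 'm \<Rightarrow> 'o \<Rightarrow> 'm \<Rightarrow> bool" where
  "is_coequalizer C A B f g Q q \<longleftrightarrow>
     f \<in> Hom C A B \<and> g \<in> Hom C A B \<and> q \<in> Hom C B Q \<and> q \<cdot>\<^bsub>C\<^esub> f = q \<cdot>\<^bsub>C\<^esub> g \<and>
     (\<forall>X h. h \<in> Hom C B X \<and> h \<cdot>\<^bsub>C\<^esub> f = h \<cdot>\<^bsub>C\<^esub> g \<longrightarrow>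
        (\<exists>!k. k \<in> Hom C Q X \<and> k \<cdot>\<^bsub>C\<^esub> q = h))"

definition has_equalizers :: "('o, 'm, 'z) category_scheme \<Rightarrow> bool" where
  "has_equalizers C \<longleftrightarrow>
     (\<forall>A\<in>Obj C. \<forall>B\<in>Obj C. \<forall>f\<in>Hom C A B. \<forall>g\<in>Hom C A B. \<exists>E e. is_equalizer C A B f g E e)"

definition preserves_equalizers ::
  "('o, 'm, 'z) category_scheme \<Rightarrow> ('p, 'n, 'y) category_scheme \<Rightarrow> ('o \<Rightarrow> 'p) \<Rightarrow> ('m \<Rightarrow> 'n) \<Rightarrow> bool"
  where
  "preserves_equalizers C D Fo Fm \<longleftrightarrow>
     (\<forall>A B f g E e. is_equalizer C A B f g E e \<longrightarrow>
        is_equalizer D (Fo A) (Fo B) (Fm f) (Fm g) (Fo E) (Fm e))"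

definition is_mono :: "('o, 'm, 'z) category_scheme \<Rightarrow> 'o \<Rightarrow> 'o \<Rightarrow> 'm \<Rightarrow> bool" where
  "is_mono C A B f \<longleftrightarrow> f \<in> Hom C A B \<and>
     (\<forall>X. \<forall>g\<in>Hom C X A. \<forall>h\<in>Hom C X A. f \<cdot>\<^bsub>C\<^esub> g = f \<cdot>\<^bsub>C\<^esub> h \<longrightarrow> g = h)"

definition is_epi :: "('o, 'm, 'z) category_scheme \<Rightarrow> 'o \<Rightarrow> 'o \<Rightarrow> 'm \<Rightarrow> bool" where
  "is_epi C A B f \<longleftrightarrow> f \<in> Hom C A B \<and>
     (\<forall>X. \<forall>g\<in>Hom C B X. \<forall>h\<in>Hom C B X. g \<cdot>\<^bsub>C\<^esub> f = h \<cdot>\<^bsub>C\<^esub> f \<longrightarrow> g = h)"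

definition are_inverse :: "('o, 'm, 'z) category_scheme \<Rightarrow> 'o \<Rightarrow> 'o \<Rightarrow> 'm \<Rightarrow> 'm \<Rightarrow> bool" where
  "are_inverse C A B f g \<longleftrightarrow> f \<in> Hom C A B \<and> g \<in> Hom C B A \<and>
     g \<cdot>\<^bsub>C\<^esub> f = idt C A \<and> f \<cdot>\<^bsub>C\<^esub> g = idt C B"

definition is_iso :: "('o, 'm, 'z) category_scheme \<Rightarrow> 'o \<Rightarrow> 'o \<Rightarrow> 'm \<Rightarrow> bool" where
  "is_iso C A B f \<longleftrightarrow> (\<exists>g. are_inverse C A B f g)"

definition inverse_of :: "('o, 'm, 'z) category_scheme \<Rightarrow> 'o \<Rightarrow> 'o \<Rightarrow> 'm \<Rightarrow> 'm" where
  "inverse_of C A B f = (THE g. are_inverse C A B f g)"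


section \<open>Symmetric monoidal categories\<close>

text \<open>The constraints are
  \<open>assc A B D : (A \<otimes> B) \<otimes> D \<rightarrow> A \<otimes> (B \<otimes> D)\<close>,
  \<open>lunit A : \<one> \<otimes> A \<rightarrow> A\<close>, \<open>runit A : A \<otimes> \<one> \<rightarrow> A\<close> and
  \<open>braid A B : A \<otimes> B \<rightarrow> B \<otimes> A\<close>; no strictness is assumed.\<close>

record ('o, 'm) sm_category = "('o, 'm) category" +
  tenO :: "'o \<Rightarrow> 'o \<Rightarrow> 'o" (infixl "\<otimes>\<^sub>o\<index>" 70)
  tenM :: "'m \<Rightarrow> 'm \<Rightarrow> 'm" (infixl "\<otimes>\<^sub>m\<index>" 70)
  unitO :: 'o ("\<one>\<^sub>o\<index>")
  assc :: "'o \<Rightarrow> 'o \<Rightarrow> 'o \<Rightarrow> 'm"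
  lunit :: "'o \<Rightarrow> 'm"
  runit :: "'o \<Rightarrow> 'm"
  braid :: "'o \<Rightarrow> 'o \<Rightarrow> 'm"

locale symmetric_monoidal_category = category M
  for M :: "('o, 'm, 'z) sm_category_scheme" (structure) +
  assumes unit_Obj: "\<one>\<^sub>o \<in> Obj M"
    and ten_Obj: "\<lbrakk>A \<in> Obj M; B \<in> Obj M\<rbrakk> \<Longrightarrow> A \<otimes>\<^sub>o B \<in> Obj M"
    and ten_Hom: "\<lbrakk>f \<in> Hom M A B; g \<in> Hom M D E\<rbrakk> \<Longrightarrow> f \<otimes>\<^sub>m g \<in> Hom M (A \<otimes>\<^sub>o D) (B \<otimes>\<^sub>o E)"
    and ten_idt: "\<lbrakk>A \<in> Obj M; B \<in> Obj M\<rbrakk> \<Longrightarrow> idt M A \<otimes>\<^sub>m idt M B = idt M (A \<otimes>\<^sub>o B)"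
    and ten_cmp: "\<lbrakk>f \<in> Hom M A B; g \<in> Hom M B D; f' \<in> Hom M A' B'; g' \<in> Hom M B' D'\<rbrakk>
      \<Longrightarrow> (g \<cdot> f) \<otimes>\<^sub>m (g' \<cdot> f') = (g \<otimes>\<^sub>m g') \<cdot> (f \<otimes>\<^sub>m f')"
    and assc_iso: "\<lbrakk>A \<in> Obj M; B \<in> Obj M; D \<in> Obj M\<rbrakk>
      \<Longrightarrow> is_iso M ((A \<otimes>\<^sub>o B) \<otimes>\<^sub>o D) (A \<otimes>\<^sub>o (B \<otimes>\<^sub>o D)) (assc M A B D)"
    and lunit_iso: "A \<in> Obj M \<Longrightarrow> is_iso M (\<one>\<^sub>o \<otimes>\<^sub>o A) A (lunit M A)"
    and runit_iso: "A \<in> Obj M \<Longrightarrow> is_iso M (A \<otimes>\<^sub>o \<one>\<^sub>o) A (runit M A)"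
    and braid_Hom: "\<lbrakk>A \<in> Obj M; B \<in> Obj M\<rbrakk> \<Longrightarrow> braid M A B \<in> Hom M (A \<otimes>\<^sub>o B) (B \<otimes>\<^sub>o A)"
    and assc_natural: "\<lbrakk>f \<in> Hom M A A'; g \<in> Hom M B B'; h \<in> Hom M D D'\<rbrakk>
      \<Longrightarrow> assc M A' B' D' \<cdot> ((f \<otimes>\<^sub>m g) \<otimes>\<^sub>m h) = (f \<otimes>\<^sub>m (g \<otimes>\<^sub>m h)) \<cdot> assc M A B D"
    and lunit_natural: "f \<in> Hom M A A' \<Longrightarrow> lunit M A' \<cdot> (idt M \<one>\<^sub>o \<otimes>\<^sub>m f) = f \<cdot> lunit M A"
    and runit_natural: "f \<in> Hom M A A' \<Longrightarrow> runit M A' \<cdot> (f \<otimes>\<^sub>m idt M \<one>\<^sub>o) = f \<cdot> runit M A"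
    and braid_natural: "\<lbrakk>f \<in> Hom M A A'; g \<in> Hom M B B'\<rbrakk>
      \<Longrightarrow> braid M A' B' \<cdot> (f \<otimes>\<^sub>m g) = (g \<otimes>\<^sub>m f) \<cdot> braid M A B"
    and pentagon: "\<lbrakk>A \<in> Obj M; B \<in> Obj M; D \<in> Obj M; E \<in> Obj M\<rbrakk>
      \<Longrightarrow> assc M A B (D \<otimes>\<^sub>o E) \<cdot> assc M (A \<otimes>\<^sub>o B) D E
        = (idt M A \<otimes>\<^sub>m assc M B D E) \<cdot> assc M A (B \<otimes>\<^sub>o D) E \<cdot> (assc M A B D \<otimes>\<^sub>m idt M E)"
    and triangle: "\<lbrakk>A \<in> Obj M; B \<in> Obj M\<rbrakk>
      \<Longrightarrow> (idt M A \<otimes>\<^sub>m lunit M B) \<cdot> assc M A \<one>\<^sub>o B = runit M A \<otimes>\<^sub>m idt M B"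
    and hexagon: "\<lbrakk>A \<in> Obj M; B \<in> Obj M; D \<in> Obj M\<rbrakk>
      \<Longrightarrow> assc M B D A \<cdot> braid M A (B \<otimes>\<^sub>o D) \<cdot> assc M A B D
        = (idt M B \<otimes>\<^sub>m braid M A D) \<cdot> assc M B A D \<cdot> (braid M A B \<otimes>\<^sub>m idt M D)"
    and symmetry: "\<lbrakk>A \<in> Obj M; B \<in> Obj M\<rbrakk> \<Longrightarrow> braid M B A \<cdot> braid M A B = idt M (A \<otimes>\<^sub>o B)"


section \<open>Cocommutative Hopf monoids\<close>

context
  fixes M :: "('o, 'm, 'z) sm_category_scheme" (structure)
begin

definition asscinv :: "'o \<Rightarrow> 'o \<Rightarrow> 'o \<Rightarrow> 'm" where
  "asscinv A B D = inverse_of M ((A \<otimes>\<^sub>o B) \<otimes>\<^sub>o D) (A \<otimes>\<^sub>o (B \<otimes>\<^sub>o D)) (assc M A B D)"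

text \<open>The canonical arrow \<open>(A \<otimes> B) \<otimes> (D \<otimes> E) \<rightarrow> (A \<otimes> D) \<otimes> (B \<otimes> E)\<close> which
  swaps the two middle factors; up to associativity it is \<open>id \<otimes> braid B D \<otimes> id\<close>.\<close>

definition middle_swap :: "'o \<Rightarrow> 'o \<Rightarrow> 'o \<Rightarrow> 'o \<Rightarrow> 'm" where
  "middle_swap A B D E =
     asscinv A D (B \<otimes>\<^sub>o E) \<cdot>
     (idt M A \<otimes>\<^sub>m (assc M D B E \<cdot> (braid M B D \<otimes>\<^sub>m idt M E) \<cdot> asscinv B D E)) \<cdot>
     assc M A B (D \<otimes>\<^sub>o E)"

definition is_monoid :: "'o \<Rightarrow> 'm \<Rightarrow> 'm \<Rightarrow> bool" where
  "is_monoid A m u \<longleftrightarrow>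
     A \<in> Obj M \<and> m \<in> Hom M (A \<otimes>\<^sub>o A) A \<and> u \<in> Hom M \<one>\<^sub>o A \<and>
     m \<cdot> (m \<otimes>\<^sub>m idt M A) = m \<cdot> (idt M A \<otimes>\<^sub>m m) \<cdot> assc M A A A \<and>
     m \<cdot> (u \<otimes>\<^sub>m idt M A) = lunit M A \<and>
     m \<cdot> (idt M A \<otimes>\<^sub>m u) = runit M A"

definition is_comonoid :: "'o \<Rightarrow> 'm \<Rightarrow> 'm \<Rightarrow> bool" where
  "is_comonoid A d e \<longleftrightarrow>
     A \<in> Obj M \<and> d \<in> Hom M A (A \<otimes>\<^sub>o A) \<and> e \<in> Hom M A \<one>\<^sub>o \<and>
     assc M A A A \<cdot> (d \<otimes>\<^sub>m idt M A) \<cdot> d = (idt M A \<otimes>\<^sub>m d) \<cdot> d \<and>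
     lunit M A \<cdot> (e \<otimes>\<^sub>m idt M A) \<cdot> d = idt M A \<and>
     runit M A \<cdot> (idt M A \<otimes>\<^sub>m e) \<cdot> d = idt M A"

text \<open>The last four conditions say that \<open>d\<close> and \<open>e\<close> are monoid morphisms, where
  \<open>A \<otimes> A\<close> carries the tensor product monoid structure and \<open>\<one>\<close> the trivial one.\<close>

definition is_bimonoid :: "'o \<Rightarrow> 'm \<Rightarrow> 'm \<Rightarrow> 'm \<Rightarrow> 'm \<Rightarrow> bool" where
  "is_bimonoid A m u d e \<longleftrightarrow>
     is_monoid A m u \<and> is_comonoid A d e \<and>
     d \<cdot> m = (m \<otimes>\<^sub>m m) \<cdot> middle_swap A A A A \<cdot> (d \<otimes>\<^sub>m d) \<and>
     lunit M \<one>\<^sub>o \<cdot> (e \<otimes>\<^sub>m e) = e \<cdot> m \<and>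
     d \<cdot> u \<cdot> lunit M \<one>\<^sub>o = u \<otimes>\<^sub>m u \<and>
     e \<cdot> u = idt M \<one>\<^sub>o"

end

record ('o, 'm) hopf =
  car :: 'o
  mult :: 'm
  unt :: 'm
  comult :: 'm
  counit :: 'm
  antipode :: 'm

context
  fixes M :: "('o, 'm, 'z) sm_category_scheme" (structure)
begin

definition is_hopf_monoid :: "('o, 'm) hopf \<Rightarrow> bool" where
  "is_hopf_monoid A \<longleftrightarrow>
     is_bimonoid M (car A) (mult A) (unt A) (comult A) (counit A) \<and>
     antipode A \<in> Hom M (car A) (car A) \<and>
     mult A \<cdot> (antipode A \<otimes>\<^sub>m idt M (car A)) \<cdot> comult A = unt A \<cdot> counit A \<and>
     mult A \<cdot> (idt M (car A) \<otimes>\<^sub>m antipode A) \<cdot> comult A = unt A \<cdot> counit A"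

definition is_cocommutative :: "('o, 'm) hopf \<Rightarrow> bool" where
  "is_cocommutative A \<longleftrightarrow> braid M (car A) (car A) \<cdot> comult A = comult A"

text \<open>As usual, morphisms of Hopf monoids are morphisms of the underlying bimonoids; these commute
  with the antipodes automatically.\<close>

definition is_hopf_morphism :: "('o, 'm) hopf \<Rightarrow> ('o, 'm) hopf \<Rightarrow> 'm \<Rightarrow> bool" where
  "is_hopf_morphism A B f \<longleftrightarrow>
     f \<in> Hom M (car A) (car B) \<and>
     f \<cdot> mult A = mult B \<cdot> (f \<otimes>\<^sub>m f) \<and>
     f \<cdot> unt A = unt B \<and>
     comult B \<cdot> f = (f \<otimes>\<^sub>m f) \<cdot> comult A \<and>
     counit B \<cdot> f = counit A"

definition Hopf_coc :: "(('o, 'm) hopf, 'm) category" where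
  "Hopf_coc =
     \<lparr>Obj = {A. is_hopf_monoid A \<and> is_cocommutative A},
      Hom = (\<lambda>A B. {f. is_hopf_monoid A \<and> is_cocommutative A \<and>
                       is_hopf_monoid B \<and> is_cocommutative B \<and> is_hopf_morphism A B f}),
      cmp = cmp M,
      idt = (\<lambda>A. idt M (car A))\<rparr>"

end


section \<open>Abelian symmetric monoidal categories\<close>

text \<open>In a preadditive category, \<open>H A B\<close> is the group structure on the hom-set from \<open>A\<close> to
  \<open>B\<close>. It is written multiplicatively by the library, so \<open>\<otimes>\<^bsub>H A B\<^esub>\<close> is the
  addition of arrows and \<open>\<one>\<^bsub>H A B\<^esub>\<close> the zero arrow.\<close>

locale preadditive_category = category C
  for C :: "('o, 'm, 'z) category_scheme" (structure) and H :: "'o \<Rightarrow> 'o \<Rightarrow> 'm monoid" +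
  assumes hom_carrier: "\<lbrakk>A \<in> Obj C; B \<in> Obj C\<rbrakk> \<Longrightarrow> carrier (H A B) = Hom C A B"
    and hom_comm_group: "\<lbrakk>A \<in> Obj C; B \<in> Obj C\<rbrakk> \<Longrightarrow> comm_group (H A B)"
    and cmp_additive_right: "\<lbrakk>A \<in> Obj C; g \<in> Hom C B D\<rbrakk>
      \<Longrightarrow> (\<lambda>f. g \<cdot> f) \<in> hom (H A B) (H A D)"
    and cmp_additive_left: "\<lbrakk>D \<in> Obj C; f \<in> Hom C A B\<rbrakk>
      \<Longrightarrow> (\<lambda>g. g \<cdot> f) \<in> hom (H B D) (H A D)"

definition is_zero_object :: "('o, 'm, 'z) category_scheme \<Rightarrow> 'o \<Rightarrow> bool" where
  "is_zero_object C Z \<longleftrightarrow>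
     Z \<in> Obj C \<and> (\<forall>A\<in>Obj C. (\<exists>!f. f \<in> Hom C Z A) \<and> (\<exists>!f. f \<in> Hom C A Z))"

definition is_biproduct ::
  "('o, 'm, 'z) category_scheme \<Rightarrow> ('o \<Rightarrow> 'o \<Rightarrow> 'm monoid) \<Rightarrow> 'o \<Rightarrow> 'o \<Rightarrow> 'o
    \<Rightarrow> 'm \<Rightarrow> 'm \<Rightarrow> 'm \<Rightarrow> 'm \<Rightarrow> bool" where
  "is_biproduct C H A B P i1 i2 p1 p2 \<longleftrightarrow>
     i1 \<in> Hom C A P \<and> i2 \<in> Hom C B P \<and> p1 \<in> Hom C P A \<and> p2 \<in> Hom C P B \<and>
     p1 \<cdot>\<^bsub>C\<^esub> i1 = idt C A \<and> p2 \<cdot>\<^bsub>C\<^esub> i2 = idt C B \<and>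
     (i1 \<cdot>\<^bsub>C\<^esub> p1) \<otimes>\<^bsub>H P P\<^esub> (i2 \<cdot>\<^bsub>C\<^esub> p2) = idt C P"

definition is_kernel ::
  "('o, 'm, 'z) category_scheme \<Rightarrow> ('o \<Rightarrow> 'o \<Rightarrow> 'm monoid) \<Rightarrow> 'o \<Rightarrow> 'o \<Rightarrow> 'm \<Rightarrow> 'o \<Rightarrow> 'm \<Rightarrow> bool"
  where
  "is_kernel C H A B f K k \<longleftrightarrow> is_equalizer C A B f \<one>\<^bsub>H A B\<^esub> K k"

definition is_cokernel ::
  "('o, 'm, 'z) category_scheme \<Rightarrow> ('o \<Rightarrow> 'o \<Rightarrow> 'm monoid) \<Rightarrow> 'o \<Rightarrow> 'o \<Rightarrow> 'm \<Rightarrow> 'o \<Rightarrow> 'm \<Rightarrow> bool"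
  where
  "is_cokernel C H A B f Q q \<longleftrightarrow> is_coequalizer C A B f \<one>\<^bsub>H A B\<^esub> Q q"

locale abelian_category = preadditive_category C H
  for C :: "('o, 'm, 'z) category_scheme" (structure) and H :: "'o \<Rightarrow> 'o \<Rightarrow> 'm monoid" +
  assumes zero_object: "\<exists>Z. is_zero_object C Z"
    and biproducts: "\<lbrakk>A \<in> Obj C; B \<in> Obj C\<rbrakk>
      \<Longrightarrow> \<exists>P i1 i2 p1 p2. is_biproduct C H A B P i1 i2 p1 p2"
    and kernels: "f \<in> Hom C A B \<Longrightarrow> \<exists>K k. is_kernel C H A B f K k"
    and cokernels: "f \<in> Hom C A B \<Longrightarrow> \<exists>Q q. is_cokernel C H A B f Q q"
    and mono_is_kernel: "is_mono C A B f \<Longrightarrow> \<exists>D g. is_kernel C H B D g A f"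
    and epi_is_cokernel: "is_epi C A B f \<Longrightarrow> \<exists>D g. is_cokernel C H D A g B f"

text \<open>\<open>0 \<rightarrow> A \<rightarrow> B \<rightarrow> D \<rightarrow> 0\<close> with arrows \<open>f\<close> and \<open>g\<close> is short exact.\<close>

definition is_short_exact ::
  "('o, 'm, 'z) category_scheme \<Rightarrow> ('o \<Rightarrow> 'o \<Rightarrow> 'm monoid)
    \<Rightarrow> 'o \<Rightarrow> 'o \<Rightarrow> 'o \<Rightarrow> 'm \<Rightarrow> 'm \<Rightarrow> bool" where
  "is_short_exact C H A B D f g \<longleftrightarrow> is_kernel C H B D g A f \<and> is_cokernel C H A B f D g"

definition is_additive ::
  "('o, 'm, 'z) category_scheme \<Rightarrow> ('o \<Rightarrow> 'o \<Rightarrow> 'm monoid) \<Rightarrow> ('o \<Rightarrow> 'o) \<Rightarrow> ('m \<Rightarrow> 'm) \<Rightarrow> bool"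
  where
  "is_additive C H Fo Fm \<longleftrightarrow>
     (\<forall>A\<in>Obj C. \<forall>B\<in>Obj C. Fm \<in> hom (H A B) (H (Fo A) (Fo B)))"

definition is_exact ::
  "('o, 'm, 'z) category_scheme \<Rightarrow> ('o \<Rightarrow> 'o \<Rightarrow> 'm monoid) \<Rightarrow> ('o \<Rightarrow> 'o) \<Rightarrow> ('m \<Rightarrow> 'm) \<Rightarrow> bool"
  where
  "is_exact C H Fo Fm \<longleftrightarrow>
     (\<forall>A B D f g. is_short_exact C H A B D f g \<longrightarrow>
        is_short_exact C H (Fo A) (Fo B) (Fo D) (Fm f) (Fm g))"

definition abelian_symmetric_monoidal_category :: "('o, 'm, 'z) sm_category_scheme \<Rightarrow> bool" where
  "abelian_symmetric_monoidal_category M \<longleftrightarrow>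
     symmetric_monoidal_category M \<and>
     (\<exists>H. abelian_category M H \<and>
        (\<forall>X\<in>Obj M.
           is_additive M H (\<lambda>A. X \<otimes>\<^sub>o\<^bsub>M\<^esub> A) (\<lambda>f. idt M X \<otimes>\<^sub>m\<^bsub>M\<^esub> f) \<and>
           is_exact M H (\<lambda>A. X \<otimes>\<^sub>o\<^bsub>M\<^esub> A) (\<lambda>f. idt M X \<otimes>\<^sub>m\<^bsub>M\<^esub> f) \<and>
           is_additive M H (\<lambda>A. A \<otimes>\<^sub>o\<^bsub>M\<^esub> X) (\<lambda>f. f \<otimes>\<^sub>m\<^bsub>M\<^esub> idt M X) \<and>
           is_exact M H (\<lambda>A. A \<otimes>\<^sub>o\<^bsub>M\<^esub> X) (\<lambda>f. f \<otimes>\<^sub>m\<^bsub>M\<^esub> idt M X)))"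

end

theory Submission
  imports Defs
begin

text \<open>Cocommutative comonoids in \<open>M\<close> form a category whose finite products are given by the tensor
  product. The equalizer of \<open>f, g : X \<rightarrow> Y\<close> in it is the equalizer in \<open>M\<close> of
  \<open>(f \<otimes> id) \<Delta>\<close> and \<open>(g \<otimes> id) \<Delta>\<close>, since tensoring preserves equalizers; hence this category
  has finite limits. Cocommutative Hopf monoids are its internal groups: multiplication, unit and
  antipode are comonoid morphisms, and Hopf monoid morphisms commute with them. So the limit \<open>L\<close> of
  the underlying comonoids of a diagram inherits \<open>m\<close>, \<open>u\<close> and \<open>S\<close> from its universal property, and
  the axioms can be checked after composing with the projections, which are jointly monic. In the
  abelian case the equalizer of \<open>f\<close> and \<open>g\<close> is the kernel of \<open>f - g\<close>, and an exact additive functor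
  preserves kernels because \<open>f - g\<close> factors as the cokernel of its kernel followed by a mono.\<close>

section \<open>Typed arrows and coherence\<close>

text \<open>Two things stand between the internal-group picture and a proof. First, \<open>M\<close>
  is not strict, and beyond naturality and symmetry only the pentagon, one triangle and one hexagon
  are given. That the structure maps are comonoid morphisms concerns rearrangements of four to six
  tensor factors, so the identities required are derived by hand. Second, the antipode of a Hopf
  monoid is a bare arrow of \<open>M\<close>, whereas the limit only lifts comonoid morphisms, and
  its projections are jointly monic only against these. That the antipode is such a morphism, and
  that Hopf morphisms respect it, comes from the shear map x \<otimes> y \<mapsto> x1 \<otimes> x2
  y: it is a comonoid morphism, the antipode inverts it, and the inverse sends x \<otimes> 1 to x1
  \<otimes> S(x2). Elements such as x1 \<otimes> x2 are Sweedler shorthand for composites with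
  \<open>cm\<close>.\<close>

context category
begin

lemma are_inverse_unique:
  assumes "are_inverse C A B f g" "are_inverse C A B f h"
  shows "g = h"
proof -
  have "g = g \<cdot> (f \<cdot> h)"
    using assms unfolding are_inverse_def by (metis cmp_idt_right)
  also have "\<dots> = (g \<cdot> f) \<cdot> h"
    using assms cmp_assoc by (metis are_inverse_def)
  also have "\<dots> = h"
    using assms unfolding are_inverse_def by (metis cmp_idt_left)
  finally show ?thesis .
qed

lemma are_inverse_inverse_of:
  assumes "is_iso C A B f"
  shows "are_inverse C A B f (inverse_of C A B f)"
  using assms unfolding is_iso_def inverse_of_def
  by (metis are_inverse_unique theI)

end

text \<open>Arrows carrying their domain and codomain, with an extra value for the result of an
  ill-typed operation: composition is then associative without side conditions.\<close>

datatype ('o, 'm) tarrow = NoArrow | Arrow (dm: 'o) (und: 'm) (cd: 'o)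

context symmetric_monoidal_category
begin

primrec arr :: "('o, 'm) tarrow \<Rightarrow> bool" where
  "arr NoArrow \<longleftrightarrow> False"
| "arr (Arrow A f B) \<longleftrightarrow> f \<in> Hom M A B"

definition tcmp :: "('o, 'm) tarrow \<Rightarrow> ('o, 'm) tarrow \<Rightarrow> ('o, 'm) tarrow" (infixr "\<bullet>" 65) where
  "t \<bullet> s = (if arr t \<and> arr s \<and> dm t = cd s then Arrow (dm s) (und t \<cdot> und s) (cd t) else NoArrow)"

definition tten :: "('o, 'm) tarrow \<Rightarrow> ('o, 'm) tarrow \<Rightarrow> ('o, 'm) tarrow" (infixl "\<boxtimes>" 70) where
  "t \<boxtimes> s = (if arr t \<and> arr s
            then Arrow (dm t \<otimes>\<^sub>o dm s) (und t \<otimes>\<^sub>m und s) (cd t \<otimes>\<^sub>o cd s) else NoArrow)"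

definition ide :: "'o \<Rightarrow> ('o, 'm) tarrow" where
  "ide A = Arrow A (idt M A) A"

definition asc :: "'o \<Rightarrow> 'o \<Rightarrow> 'o \<Rightarrow> ('o, 'm) tarrow" where
  "asc A B D = Arrow ((A \<otimes>\<^sub>o B) \<otimes>\<^sub>o D) (assc M A B D) (A \<otimes>\<^sub>o (B \<otimes>\<^sub>o D))"

definition csa :: "'o \<Rightarrow> 'o \<Rightarrow> 'o \<Rightarrow> ('o, 'm) tarrow" where
  "csa A B D = Arrow (A \<otimes>\<^sub>o (B \<otimes>\<^sub>o D)) (asscinv M A B D) ((A \<otimes>\<^sub>o B) \<otimes>\<^sub>o D)"

definition lun :: "'o \<Rightarrow> ('o, 'm) tarrow" where
  "lun A = Arrow (\<one>\<^sub>o \<otimes>\<^sub>o A) (lunit M A) A"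

definition nul :: "'o \<Rightarrow> ('o, 'm) tarrow" where
  "nul A = Arrow A (inverse_of M (\<one>\<^sub>o \<otimes>\<^sub>o A) A (lunit M A)) (\<one>\<^sub>o \<otimes>\<^sub>o A)"

definition run :: "'o \<Rightarrow> ('o, 'm) tarrow" where
  "run A = Arrow (A \<otimes>\<^sub>o \<one>\<^sub>o) (runit M A) A"

definition nur :: "'o \<Rightarrow> ('o, 'm) tarrow" where
  "nur A = Arrow A (inverse_of M (A \<otimes>\<^sub>o \<one>\<^sub>o) A (runit M A)) (A \<otimes>\<^sub>o \<one>\<^sub>o)"

definition brd :: "'o \<Rightarrow> 'o \<Rightarrow> ('o, 'm) tarrow" where
  "brd A B = Arrow (A \<otimes>\<^sub>o B) (braid M A B) (B \<otimes>\<^sub>o A)"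

lemma arr_und: "arr t \<Longrightarrow> und t \<in> Hom M (dm t) (cd t)"
  by (cases t) auto

lemma arr_Obj [simp]:
  assumes "arr t"
  shows "dm t \<in> Obj M" "cd t \<in> Obj M"
  using Hom_Obj[OF arr_und[OF assms]] by auto

lemma arr_eqI: "\<lbrakk>arr t; arr s; dm t = dm s; cd t = cd s; und t = und s\<rbrakk> \<Longrightarrow> t = s"
  by (cases t; cases s) auto

declare unit_Obj [simp] ten_Obj [simp]

lemma arr_tcmp [simp]: "arr (t \<bullet> s) \<longleftrightarrow> arr t \<and> arr s \<and> dm t = cd s"
  by (auto simp: tcmp_def intro: cmp_Hom dest!: arr_und)

lemma arr_tten [simp]: "arr (t \<boxtimes> s) \<longleftrightarrow> arr t \<and> arr s"
  by (auto simp: tten_def intro: ten_Hom dest!: arr_und)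

lemma tcmp_simps [simp]:
  "\<lbrakk>arr t; arr s; dm t = cd s\<rbrakk> \<Longrightarrow> dm (t \<bullet> s) = dm s"
  "\<lbrakk>arr t; arr s; dm t = cd s\<rbrakk> \<Longrightarrow> cd (t \<bullet> s) = cd t"
  "\<lbrakk>arr t; arr s; dm t = cd s\<rbrakk> \<Longrightarrow> und (t \<bullet> s) = und t \<cdot> und s"
  by (simp_all add: tcmp_def)

lemma tten_simps [simp]:
  "\<lbrakk>arr t; arr s\<rbrakk> \<Longrightarrow> dm (t \<boxtimes> s) = dm t \<otimes>\<^sub>o dm s"
  "\<lbrakk>arr t; arr s\<rbrakk> \<Longrightarrow> cd (t \<boxtimes> s) = cd t \<otimes>\<^sub>o cd s"
  "\<lbrakk>arr t; arr s\<rbrakk> \<Longrightarrow> und (t \<boxtimes> s) = und t \<otimes>\<^sub>m und s"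
  by (simp_all add: tten_def)

lemma assc_inverse:
  assumes "A \<in> Obj M" "B \<in> Obj M" "D \<in> Obj M"
  shows "are_inverse M ((A \<otimes>\<^sub>o B) \<otimes>\<^sub>o D) (A \<otimes>\<^sub>o (B \<otimes>\<^sub>o D)) (assc M A B D) (asscinv M A B D)"
  unfolding asscinv_def by (intro are_inverse_inverse_of assc_iso assms)

lemma lunit_inverse:
  assumes "A \<in> Obj M"
  shows "are_inverse M (\<one>\<^sub>o \<otimes>\<^sub>o A) A (lunit M A) (und (nul A))"
  unfolding nul_def using are_inverse_inverse_of lunit_iso assms by simp

lemma runit_inverse:
  assumes "A \<in> Obj M"
  shows "are_inverse M (A \<otimes>\<^sub>o \<one>\<^sub>o) A (runit M A) (und (nur A))"
  unfolding nur_def using are_inverse_inverse_of runit_iso assms by simp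

lemma ide_simps [simp]: "dm (ide A) = A" "cd (ide A) = A" "arr (ide A) \<longleftrightarrow> A \<in> Obj M" "und (ide A) = idt M A"
  using idt_Hom Hom_Obj by (auto simp: ide_def)

lemma asc_simps [simp]:
  "dm (asc A B D) = (A \<otimes>\<^sub>o B) \<otimes>\<^sub>o D" "cd (asc A B D) = A \<otimes>\<^sub>o (B \<otimes>\<^sub>o D)"
  "\<lbrakk>A \<in> Obj M; B \<in> Obj M; D \<in> Obj M\<rbrakk> \<Longrightarrow> arr (asc A B D)"
  using assc_inverse by (auto simp: asc_def are_inverse_def)

lemma csa_simps [simp]:
  "dm (csa A B D) = A \<otimes>\<^sub>o (B \<otimes>\<^sub>o D)" "cd (csa A B D) = (A \<otimes>\<^sub>o B) \<otimes>\<^sub>o D"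
  "\<lbrakk>A \<in> Obj M; B \<in> Obj M; D \<in> Obj M\<rbrakk> \<Longrightarrow> arr (csa A B D)"
  using assc_inverse by (auto simp: csa_def are_inverse_def)

lemma lun_simps [simp]:
  "dm (lun A) = \<one>\<^sub>o \<otimes>\<^sub>o A" "cd (lun A) = A" "A \<in> Obj M \<Longrightarrow> arr (lun A)"
  using lunit_inverse by (auto simp: lun_def are_inverse_def)

lemma nul_simps [simp]:
  "dm (nul A) = A" "cd (nul A) = \<one>\<^sub>o \<otimes>\<^sub>o A" "A \<in> Obj M \<Longrightarrow> arr (nul A)"
  using lunit_inverse by (auto simp: nul_def are_inverse_def)

lemma run_simps [simp]:
  "dm (run A) = A \<otimes>\<^sub>o \<one>\<^sub>o" "cd (run A) = A" "A \<in> Obj M \<Longrightarrow> arr (run A)"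
  using runit_inverse by (auto simp: run_def are_inverse_def)

lemma nur_simps [simp]:
  "dm (nur A) = A" "cd (nur A) = A \<otimes>\<^sub>o \<one>\<^sub>o" "A \<in> Obj M \<Longrightarrow> arr (nur A)"
  using runit_inverse by (auto simp: nur_def are_inverse_def)

lemma brd_simps [simp]:
  "dm (brd A B) = A \<otimes>\<^sub>o B" "cd (brd A B) = B \<otimes>\<^sub>o A" "\<lbrakk>A \<in> Obj M; B \<in> Obj M\<rbrakk> \<Longrightarrow> arr (brd A B)"
  using braid_Hom by (auto simp: brd_def)

lemma tcmp_assoc [simp]: "(h \<bullet> g) \<bullet> f = h \<bullet> (g \<bullet> f)"
proof (cases "arr h \<and> arr g \<and> arr f \<and> dm h = cd g \<and> dm g = cd f")
  case True
  then have "(und h \<cdot> und g) \<cdot> und f = und h \<cdot> (und g \<cdot> und f)"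
    using cmp_assoc arr_und by metis
  with True show ?thesis
    by (intro arr_eqI) simp_all
next
  case False
  then have "\<not> arr ((h \<bullet> g) \<bullet> f)" "\<not> arr (h \<bullet> (g \<bullet> f))"
    by auto
  then show ?thesis
    by (metis arr_tcmp tcmp_def)
qed

lemma ide_tcmp [simp]: "\<lbrakk>arr f; cd f = A\<rbrakk> \<Longrightarrow> ide A \<bullet> f = f"
  and tcmp_ide [simp]: "\<lbrakk>arr f; dm f = A\<rbrakk> \<Longrightarrow> f \<bullet> ide A = f"
  using cmp_idt_left[OF arr_und] cmp_idt_right[OF arr_und] by (auto intro!: arr_eqI)

lemma ten_ide [simp]: "\<lbrakk>A \<in> Obj M; B \<in> Obj M\<rbrakk> \<Longrightarrow> ide A \<boxtimes> ide B = ide (A \<otimes>\<^sub>o B)"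
  by (rule arr_eqI) (simp_all add: ten_idt)

text \<open>The second form carries a tail \<open>x\<close>, since in a right-nested composite the
  two tensors need not be the last two factors.\<close>

lemma tten_tcmp:
  assumes "arr g" "arr f" "dm g = cd f" "arr g'" "arr f'" "dm g' = cd f'"
  shows "(g \<boxtimes> g') \<bullet> (f \<boxtimes> f') = (g \<bullet> f) \<boxtimes> (g' \<bullet> f')"
    and "(g \<boxtimes> g') \<bullet> ((f \<boxtimes> f') \<bullet> x) = ((g \<bullet> f) \<boxtimes> (g' \<bullet> f')) \<bullet> x"
proof -
  have "(und g \<cdot> und f) \<otimes>\<^sub>m (und g' \<cdot> und f') = (und g \<otimes>\<^sub>m und g') \<cdot> (und f \<otimes>\<^sub>m und f')"
    using assms ten_cmp arr_und by metis
  with assms show *: "(g \<boxtimes> g') \<bullet> (f \<boxtimes> f') = (g \<bullet> f) \<boxtimes> (g' \<bullet> f')"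
    by (intro arr_eqI) simp_all
  show "(g \<boxtimes> g') \<bullet> ((f \<boxtimes> f') \<bullet> x) = ((g \<bullet> f) \<boxtimes> (g' \<bullet> f')) \<bullet> x"
    unfolding *[symmetric] by simp
qed

text \<open>Right-nesting hides \<open>f \<bullet> g\<close> inside
  \<open>f \<bullet> (g \<bullet> x)\<close>. Applied with \<open>THEN\<close>, this rule turns an
  equation for a composite into one that also rewrites within longer composites.\<close>

lemma tcmp_tail: "f \<bullet> g = k \<Longrightarrow> f \<bullet> (g \<bullet> x) = k \<bullet> x"
  by (metis tcmp_assoc)

lemma tcmp_tail3: "f \<bullet> (g \<bullet> h) = k \<Longrightarrow> f \<bullet> (g \<bullet> (h \<bullet> x)) = k \<bullet> x"
  by (metis tcmp_assoc)

text \<open>Here \<open>i\<close> is usually an invertible constraint and \<open>r\<close> its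
  inverse; the choice of \<open>i\<close> decides into which bracketing an identity is moved before
  the axioms are applied.\<close>

lemma tcmp_cancel_left:
  assumes "r \<bullet> i = ide A" "arr t" "arr s" "cd t = A" "cd s = A" "i \<bullet> t = i \<bullet> s"
  shows "t = s"
  by (metis assms ide_tcmp tcmp_assoc)

lemma tcmp_cancel_right:
  assumes "i \<bullet> r = ide A" "arr t" "arr s" "dm t = A" "dm s = A" "t \<bullet> i = s \<bullet> i"
  shows "t = s"
  by (metis assms tcmp_ide tcmp_assoc)

lemma whisker:
  assumes "arr g" "arr f" "dm g = cd f" "A \<in> Obj M"
  shows "ide A \<boxtimes> (g \<bullet> f) = (ide A \<boxtimes> g) \<bullet> (ide A \<boxtimes> f)"
    and "(g \<bullet> f) \<boxtimes> ide A = (g \<boxtimes> ide A) \<bullet> (f \<boxtimes> ide A)"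
  using assms by (simp_all add: tten_tcmp)

lemma asc_csa [simp]:
  assumes "A \<in> Obj M" "B \<in> Obj M" "D \<in> Obj M"
  shows "asc A B D \<bullet> csa A B D = ide (A \<otimes>\<^sub>o (B \<otimes>\<^sub>o D))"
    and "csa A B D \<bullet> asc A B D = ide ((A \<otimes>\<^sub>o B) \<otimes>\<^sub>o D)"
  using assc_inverse[OF assms] assms
  by (auto intro!: arr_eqI) (simp_all add: asc_def csa_def are_inverse_def)

lemma lun_nul [simp]:
  assumes "A \<in> Obj M"
  shows "lun A \<bullet> nul A = ide A" and "nul A \<bullet> lun A = ide (\<one>\<^sub>o \<otimes>\<^sub>o A)"
  using lunit_inverse[OF assms] assms
  by (auto intro!: arr_eqI) (simp_all add: lun_def are_inverse_def)

lemma run_nur [simp]: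
  assumes "A \<in> Obj M"
  shows "run A \<bullet> nur A = ide A" and "nur A \<bullet> run A = ide (A \<otimes>\<^sub>o \<one>\<^sub>o)"
  using runit_inverse[OF assms] assms
  by (auto intro!: arr_eqI) (simp_all add: run_def are_inverse_def)

lemma brd_brd [simp]:
  assumes "A \<in> Obj M" "B \<in> Obj M"
  shows "brd A B \<bullet> brd B A = ide (B \<otimes>\<^sub>o A)"
  using symmetry[OF assms(2,1)] assms by (auto intro!: arr_eqI) (simp add: brd_def)

lemma inverse_tails [simp]:
  "\<lbrakk>A \<in> Obj M; B \<in> Obj M; D \<in> Obj M; arr x; cd x = A \<otimes>\<^sub>o (B \<otimes>\<^sub>o D)\<rbrakk>
    \<Longrightarrow> asc A B D \<bullet> (csa A B D \<bullet> x) = x"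
  "\<lbrakk>A \<in> Obj M; B \<in> Obj M; D \<in> Obj M; arr x; cd x = (A \<otimes>\<^sub>o B) \<otimes>\<^sub>o D\<rbrakk>
    \<Longrightarrow> csa A B D \<bullet> (asc A B D \<bullet> x) = x"
  "\<lbrakk>A \<in> Obj M; arr x; cd x = A\<rbrakk> \<Longrightarrow> lun A \<bullet> (nul A \<bullet> x) = x"
  "\<lbrakk>A \<in> Obj M; arr x; cd x = \<one>\<^sub>o \<otimes>\<^sub>o A\<rbrakk> \<Longrightarrow> nul A \<bullet> (lun A \<bullet> x) = x"
  "\<lbrakk>A \<in> Obj M; arr x; cd x = A\<rbrakk> \<Longrightarrow> run A \<bullet> (nur A \<bullet> x) = x"
  "\<lbrakk>A \<in> Obj M; arr x; cd x = A \<otimes>\<^sub>o \<one>\<^sub>o\<rbrakk> \<Longrightarrow> nur A \<bullet> (run A \<bullet> x) = x"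
  "\<lbrakk>A \<in> Obj M; B \<in> Obj M; arr x; cd x = B \<otimes>\<^sub>o A\<rbrakk> \<Longrightarrow> brd A B \<bullet> (brd B A \<bullet> x) = x"
  by (simp_all flip: tcmp_assoc)

lemma asc_nat:
  assumes "arr f" "arr g" "arr h" "cd f = A" "cd g = B" "cd h = D"
  shows "asc A B D \<bullet> ((f \<boxtimes> g) \<boxtimes> h) = (f \<boxtimes> (g \<boxtimes> h)) \<bullet> asc (dm f) (dm g) (dm h)"
  using assc_natural[OF arr_und arr_und arr_und] assms
  by (auto intro!: arr_eqI) (simp add: asc_def)

lemma csa_nat:
  assumes "arr f" "arr g" "arr h" "cd f = A" "cd g = B" "cd h = D"
  shows "csa A B D \<bullet> (f \<boxtimes> (g \<boxtimes> h)) = ((f \<boxtimes> g) \<boxtimes> h) \<bullet> csa (dm f) (dm g) (dm h)"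
proof -
  have [simp]: "A \<in> Obj M" "B \<in> Obj M" "D \<in> Obj M"
    using assms by auto
  show ?thesis
    by (rule tcmp_cancel_left[OF asc_csa(2)[of A B D]]) (use assms asc_nat[OF assms, THEN tcmp_tail] in simp_all)
qed

lemma lun_nat: "\<lbrakk>arr f; cd f = A\<rbrakk> \<Longrightarrow> lun A \<bullet> (ide \<one>\<^sub>o \<boxtimes> f) = f \<bullet> lun (dm f)"
  using lunit_natural[OF arr_und] by (auto intro!: arr_eqI) (simp add: lun_def)

lemma run_nat: "\<lbrakk>arr f; cd f = A\<rbrakk> \<Longrightarrow> run A \<bullet> (f \<boxtimes> ide \<one>\<^sub>o) = f \<bullet> run (dm f)"
  using runit_natural[OF arr_und] by (auto intro!: arr_eqI) (simp add: run_def)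

lemma brd_nat:
  "\<lbrakk>arr f; arr g; cd f = A; cd g = B\<rbrakk> \<Longrightarrow> brd A B \<bullet> (f \<boxtimes> g) = (g \<boxtimes> f) \<bullet> brd (dm f) (dm g)"
  using braid_natural[OF arr_und arr_und] by (auto intro!: arr_eqI) (simp add: brd_def)

text \<open>The rule \<open>ten_ide\<close> merges \<open>ide A \<boxtimes> ide B\<close> into a
  single identity, after which \<open>asc_nat\<close> no longer matches; this is its instance in
  merged form.\<close>

lemma asc_nat_ide:
  assumes "arr h" "cd h = D" "A \<in> Obj M" "B \<in> Obj M"
  shows "asc A B D \<bullet> (ide (A \<otimes>\<^sub>o B) \<boxtimes> h) = (ide A \<boxtimes> (ide B \<boxtimes> h)) \<bullet> asc A B (dm h)"
  using asc_nat[of "ide A" "ide B" h A B D] assms by simp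

lemma csa_nat_ide:
  assumes "arr f" "cd f = A" "B \<in> Obj M" "D \<in> Obj M"
  shows "csa A B D \<bullet> (f \<boxtimes> ide (B \<otimes>\<^sub>o D)) = ((f \<boxtimes> ide B) \<boxtimes> ide D) \<bullet> csa (dm f) B D"
  using csa_nat[of f "ide B" "ide D" A B D] assms by simp

lemmas nat_simps =
  asc_nat asc_nat[THEN tcmp_tail] csa_nat csa_nat[THEN tcmp_tail]
  lun_nat lun_nat[THEN tcmp_tail] run_nat run_nat[THEN tcmp_tail]
  brd_nat brd_nat[THEN tcmp_tail] asc_nat_ide asc_nat_ide[THEN tcmp_tail]
  csa_nat_ide csa_nat_ide[THEN tcmp_tail]

section \<open>Coherence axioms and their consequences for the unit\<close>

lemma asc_pentagon:
  assumes "A \<in> Obj M" "B \<in> Obj M" "D \<in> Obj M" "E \<in> Obj M"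
  shows "asc A B (D \<otimes>\<^sub>o E) \<bullet> asc (A \<otimes>\<^sub>o B) D E
    = (ide A \<boxtimes> asc B D E) \<bullet> asc A (B \<otimes>\<^sub>o D) E \<bullet> (asc A B D \<boxtimes> ide E)"
  using pentagon[OF assms] assms by (auto intro!: arr_eqI) (simp add: asc_def)

lemma asc_triangle:
  assumes "A \<in> Obj M" "B \<in> Obj M"
  shows "(ide A \<boxtimes> lun B) \<bullet> asc A \<one>\<^sub>o B = run A \<boxtimes> ide B"
  using triangle[OF assms] assms by (auto intro!: arr_eqI) (simp add: asc_def lun_def run_def)

lemma brd_hexagon:
  assumes "A \<in> Obj M" "B \<in> Obj M" "D \<in> Obj M"
  shows "asc B D A \<bullet> brd A (B \<otimes>\<^sub>o D) \<bullet> asc A B D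
    = (ide B \<boxtimes> brd A D) \<bullet> asc B A D \<bullet> (brd A B \<boxtimes> ide D)"
  using hexagon[OF assms] assms by (auto intro!: arr_eqI) (simp add: asc_def brd_def)

text \<open>Naturality of \<open>lun\<close> exhibits every arrow as a conjugate of its tensor with
  the unit. Identities may therefore be checked after such a tensoring, where the triangle axiom
  becomes applicable.\<close>

lemma unit_ten_faithful:
  assumes "ide \<one>\<^sub>o \<boxtimes> f = ide \<one>\<^sub>o \<boxtimes> g" "arr f" "arr g" "dm f = dm g" "cd f = cd g"
  shows "f = g"
proof -
  have *: "h = lun (cd h) \<bullet> (ide \<one>\<^sub>o \<boxtimes> h) \<bullet> nul (dm h)" if "arr h" for h
    using that by (simp add: nat_simps)
  show ?thesis
    using assms *[of f] *[of g] by simp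
qed

lemma ten_unit_faithful:
  assumes "f \<boxtimes> ide \<one>\<^sub>o = g \<boxtimes> ide \<one>\<^sub>o" "arr f" "arr g" "dm f = dm g" "cd f = cd g"
  shows "f = g"
proof -
  have *: "h = run (cd h) \<bullet> (h \<boxtimes> ide \<one>\<^sub>o) \<bullet> nur (dm h)" if "arr h" for h
    using that by (simp add: nat_simps)
  show ?thesis
    using assms *[of f] *[of g] by simp
qed

text \<open>The triangle with the unit on the far left. After tensoring with the unit it follows
  from a pentagon with two units, the triangle axiom and naturality of \<open>asc\<close>.\<close>

lemma lun_ten_asc:
  assumes "A \<in> Obj M" "B \<in> Obj M"
  shows "lun (A \<otimes>\<^sub>o B) \<bullet> asc \<one>\<^sub>o A B = lun A \<boxtimes> ide B"
proof (rule unit_ten_faithful)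
  \<comment> \<open>\<open>?k\<close> is the long side of the pentagon for
    \<open>\<one>\<^sub>o\<close>, \<open>\<one>\<^sub>o\<close>, \<open>A\<close>, \<open>B\<close>
    without its last arrow \<open>ide \<one>\<^sub>o \<boxtimes> asc \<one>\<^sub>o A B\<close>;
    \<open>?k'\<close> is its inverse.\<close>
  let ?k = "asc \<one>\<^sub>o (\<one>\<^sub>o \<otimes>\<^sub>o A) B \<bullet> (asc \<one>\<^sub>o \<one>\<^sub>o A \<boxtimes> ide B)"
  let ?k' = "(csa \<one>\<^sub>o \<one>\<^sub>o A \<boxtimes> ide B) \<bullet> csa \<one>\<^sub>o (\<one>\<^sub>o \<otimes>\<^sub>o A) B"
  show "ide \<one>\<^sub>o \<boxtimes> (lun (A \<otimes>\<^sub>o B) \<bullet> asc \<one>\<^sub>o A B) = ide \<one>\<^sub>o \<boxtimes> (lun A \<boxtimes> ide B)"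
  proof (rule tcmp_cancel_right[where i = ?k and r = ?k'])
    have "(ide \<one>\<^sub>o \<boxtimes> (lun (A \<otimes>\<^sub>o B) \<bullet> asc \<one>\<^sub>o A B)) \<bullet> ?k
        = (ide \<one>\<^sub>o \<boxtimes> lun (A \<otimes>\<^sub>o B)) \<bullet> (ide \<one>\<^sub>o \<boxtimes> asc \<one>\<^sub>o A B) \<bullet> ?k"
      using assms by (simp add: tten_tcmp)
    also have "\<dots> = ((ide \<one>\<^sub>o \<boxtimes> lun (A \<otimes>\<^sub>o B)) \<bullet> asc \<one>\<^sub>o \<one>\<^sub>o (A \<otimes>\<^sub>o B)) \<bullet> asc (\<one>\<^sub>o \<otimes>\<^sub>o \<one>\<^sub>o) A B"
      using assms by (simp add: asc_pentagon)
    \<comment> \<open>The triangle axiom replaces the left unit arrow of the product by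
      \<open>run \<one>\<^sub>o\<close>, which slides through \<open>asc\<close>; the next step
      applies the same axiom backwards with \<open>A\<close> alone.\<close>
    also have "\<dots> = asc \<one>\<^sub>o A B \<bullet> ((run \<one>\<^sub>o \<boxtimes> ide A) \<boxtimes> ide B)"
      using assms by (simp add: asc_triangle nat_simps del: tcmp_assoc)
    also have "\<dots> = (ide \<one>\<^sub>o \<boxtimes> (lun A \<boxtimes> ide B)) \<bullet> ?k"
      using assms by (simp add: asc_triangle[symmetric] whisker nat_simps)
    finally show "(ide \<one>\<^sub>o \<boxtimes> (lun (A \<otimes>\<^sub>o B) \<bullet> asc \<one>\<^sub>o A B)) \<bullet> ?k
        = (ide \<one>\<^sub>o \<boxtimes> (lun A \<boxtimes> ide B)) \<bullet> ?k" .
  qed (use assms in \<open>simp_all add: tten_tcmp\<close>)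
qed (use assms in simp_all)

text \<open>Tensored with the unit, the left side is given by \<open>lun_ten_asc\<close> and the
  right side by the triangle axiom. They agree because naturality of \<open>lun\<close> at
  \<open>lun \<one>\<^sub>o\<close> itself identifies
  \<open>ide \<one>\<^sub>o \<boxtimes> lun \<one>\<^sub>o\<close> with
  \<open>lun (\<one>\<^sub>o \<otimes>\<^sub>o \<one>\<^sub>o)\<close>.\<close>

lemma lun_unit: "lun \<one>\<^sub>o = run \<one>\<^sub>o"
proof -
  have *: "ide \<one>\<^sub>o \<boxtimes> lun \<one>\<^sub>o = lun (\<one>\<^sub>o \<otimes>\<^sub>o \<one>\<^sub>o)"
    by (rule tcmp_cancel_left[OF lun_nul(2)[of "\<one>\<^sub>o"]]) (simp_all add: nat_simps)
  show ?thesis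
    using lun_ten_asc[of "\<one>\<^sub>o" "\<one>\<^sub>o"] asc_triangle[of "\<one>\<^sub>o" "\<one>\<^sub>o"]
    by - (rule ten_unit_faithful, simp_all add: *)
qed

text \<open>This is the hexagon whose second and third objects are units. Once the associators are
  absorbed into unit arrows, \<open>brd A \<one>\<^sub>o\<close> is the outermost factor on both
  sides and cancels.\<close>

lemma lun_brd:
  assumes A: "A \<in> Obj M"
  shows "lun A \<bullet> brd A \<one>\<^sub>o = run A"
proof (rule ten_unit_faithful)
  have "brd A \<one>\<^sub>o \<bullet> (run A \<boxtimes> ide \<one>\<^sub>o)
      = lun (\<one>\<^sub>o \<otimes>\<^sub>o A) \<bullet> asc \<one>\<^sub>o \<one>\<^sub>o A \<bullet> brd A (\<one>\<^sub>o \<otimes>\<^sub>o \<one>\<^sub>o) \<bullet> asc A \<one>\<^sub>o \<one>\<^sub>o"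
    using A by (simp add: lun_ten_asc[THEN tcmp_tail] nat_simps flip: asc_triangle)
  also have "\<dots> = lun (\<one>\<^sub>o \<otimes>\<^sub>o A) \<bullet> (ide \<one>\<^sub>o \<boxtimes> brd A \<one>\<^sub>o) \<bullet> asc \<one>\<^sub>o A \<one>\<^sub>o \<bullet> (brd A \<one>\<^sub>o \<boxtimes> ide \<one>\<^sub>o)"
    using A by (simp add: brd_hexagon)
  also have "\<dots> = brd A \<one>\<^sub>o \<bullet> ((lun A \<bullet> brd A \<one>\<^sub>o) \<boxtimes> ide \<one>\<^sub>o)"
    using A by (simp add: nat_simps lun_ten_asc[THEN tcmp_tail] tten_tcmp)
  finally have "brd A \<one>\<^sub>o \<bullet> ((lun A \<bullet> brd A \<one>\<^sub>o) \<boxtimes> ide \<one>\<^sub>o) = brd A \<one>\<^sub>o \<bullet> (run A \<boxtimes> ide \<one>\<^sub>o)"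
    by simp
  then show "(lun A \<bullet> brd A \<one>\<^sub>o) \<boxtimes> ide \<one>\<^sub>o = run A \<boxtimes> ide \<one>\<^sub>o"
    by (rule tcmp_cancel_left[OF brd_brd[of "\<one>\<^sub>o" A], rotated -1]) (use A in simp_all)
qed (use A in simp_all)

lemma brd_unit: "brd \<one>\<^sub>o \<one>\<^sub>o = ide (\<one>\<^sub>o \<otimes>\<^sub>o \<one>\<^sub>o)"
  by (rule tcmp_cancel_left[OF lun_nul(2)[of "\<one>\<^sub>o"]]) (simp_all add: lun_brd flip: lun_unit)

text \<open>Exchange of the first two factors of \<open>A \<otimes> (B \<otimes> T)\<close>. Carrying a tail \<open>T\<close> along reduces every
  coherence computation to adjacent exchanges in right-nested products.\<close>

definition swp :: "'o \<Rightarrow> 'o \<Rightarrow> 'o \<Rightarrow> ('o, 'm) tarrow" where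
  "swp A B T = asc B A T \<bullet> (brd A B \<boxtimes> ide T) \<bullet> csa A B T"

text \<open>Built so that the underlying arrow is literally \<open>middle_swap\<close>; the bimonoid
  axiom then translates by unfolding.\<close>

definition mid :: "'o \<Rightarrow> 'o \<Rightarrow> 'o \<Rightarrow> 'o \<Rightarrow> ('o, 'm) tarrow" where
  "mid A B D E = csa A D (B \<otimes>\<^sub>o E) \<bullet> (ide A \<boxtimes> swp B D E) \<bullet> asc A B (D \<otimes>\<^sub>o E)"

lemma swp_simps [simp]:
  assumes "A \<in> Obj M" "B \<in> Obj M" "T \<in> Obj M"
  shows "arr (swp A B T)" "dm (swp A B T) = A \<otimes>\<^sub>o (B \<otimes>\<^sub>o T)" "cd (swp A B T) = B \<otimes>\<^sub>o (A \<otimes>\<^sub>o T)"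
  using assms by (simp_all add: swp_def)

lemma mid_simps [simp]:
  assumes "A \<in> Obj M" "B \<in> Obj M" "D \<in> Obj M" "E \<in> Obj M"
  shows "arr (mid A B D E)" "dm (mid A B D E) = (A \<otimes>\<^sub>o B) \<otimes>\<^sub>o (D \<otimes>\<^sub>o E)"
    "cd (mid A B D E) = (A \<otimes>\<^sub>o D) \<otimes>\<^sub>o (B \<otimes>\<^sub>o E)"
  using assms by (simp_all add: mid_def)

lemma swp_nat:
  assumes "arr f" "arr g" "arr h" "cd f = A" "cd g = B" "cd h = D"
  shows "swp A B D \<bullet> (f \<boxtimes> (g \<boxtimes> h)) = (g \<boxtimes> (f \<boxtimes> h)) \<bullet> swp (dm f) (dm g) (dm h)"
proof -
  have "(brd A B \<boxtimes> ide D) \<bullet> ((f \<boxtimes> g) \<boxtimes> h) = ((g \<boxtimes> f) \<boxtimes> h) \<bullet> (brd (dm f) (dm g) \<boxtimes> ide (dm h))"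
    using assms(1-3) unfolding assms(4-6)[symmetric] by (simp add: tten_tcmp nat_simps)
  from this[THEN tcmp_tail] show ?thesis
    using assms(1-3) unfolding assms(4-6)[symmetric] by (simp add: swp_def nat_simps)
qed

lemma swp_nat_ide:
  assumes "arr f" "cd f = A" "B \<in> Obj M" "D \<in> Obj M"
  shows "swp A B D \<bullet> (f \<boxtimes> ide (B \<otimes>\<^sub>o D)) = (ide B \<boxtimes> (f \<boxtimes> ide D)) \<bullet> swp (dm f) B D"
  using swp_nat[of f "ide B" "ide D" A B D] assms by simp

lemma swp_swp [simp]:
  assumes "A \<in> Obj M" "B \<in> Obj M" "T \<in> Obj M"
  shows "swp A B T \<bullet> swp B A T = ide (B \<otimes>\<^sub>o (A \<otimes>\<^sub>o T))"
  using assms by (simp add: swp_def tten_tcmp)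

lemma swp_swp_tail [simp]:
  "\<lbrakk>A \<in> Obj M; B \<in> Obj M; T \<in> Obj M; arr x; cd x = B \<otimes>\<^sub>o (A \<otimes>\<^sub>o T)\<rbrakk>
    \<Longrightarrow> swp A B T \<bullet> (swp B A T \<bullet> x) = x"
  by (simp flip: tcmp_assoc)

text \<open>The working form of \<open>mid\<close>: in right-nested products it is one exchange
  behind \<open>A\<close>.\<close>

lemma asc_mid:
  assumes "A \<in> Obj M" "B \<in> Obj M" "D \<in> Obj M" "E \<in> Obj M"
  shows "asc A D (B \<otimes>\<^sub>o E) \<bullet> mid A B D E = (ide A \<boxtimes> swp B D E) \<bullet> asc A B (D \<otimes>\<^sub>o E)"
  using assms by (simp add: mid_def)

lemma mid_nat:
  assumes "arr f" "arr g" "arr h" "arr k" "cd f = A" "cd g = B" "cd h = D" "cd k = E"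
  shows "mid A B D E \<bullet> ((f \<boxtimes> g) \<boxtimes> (h \<boxtimes> k))
    = ((f \<boxtimes> h) \<boxtimes> (g \<boxtimes> k)) \<bullet> mid (dm f) (dm g) (dm h) (dm k)"
proof -
  have "(ide A \<boxtimes> swp B D E) \<bullet> (f \<boxtimes> (g \<boxtimes> (h \<boxtimes> k)))
      = (f \<boxtimes> (h \<boxtimes> (g \<boxtimes> k))) \<bullet> (ide (dm f) \<boxtimes> swp (dm g) (dm h) (dm k))"
    using assms(1-4) unfolding assms(5-8)[symmetric] by (simp add: tten_tcmp swp_nat)
  from this[THEN tcmp_tail] show ?thesis
    using assms(1-4) unfolding assms(5-8)[symmetric] by (simp add: mid_def nat_simps)
qed

lemma mid_mid [simp]:
  assumes "A \<in> Obj M" "B \<in> Obj M" "D \<in> Obj M" "E \<in> Obj M"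
  shows "mid A B D E \<bullet> mid A D B E = ide ((A \<otimes>\<^sub>o D) \<otimes>\<^sub>o (B \<otimes>\<^sub>o E))"
  using assms by (simp add: mid_def tten_tcmp(2))

text \<open>The hexagon with a tail: \<open>A\<close> passes \<open>B\<close>, then
  \<open>D\<close>. The arrow cancelled on the right brings the source into the bracketing in which
  the hexagon tensored with \<open>T\<close> can be inserted; pentagons do the rest.\<close>

lemma swp_ten:
  assumes "A \<in> Obj M" "B \<in> Obj M" "D \<in> Obj M" "T \<in> Obj M"
  shows "asc B D (A \<otimes>\<^sub>o T) \<bullet> swp A (B \<otimes>\<^sub>o D) T
    = (ide B \<boxtimes> swp A D T) \<bullet> swp A B (D \<otimes>\<^sub>o T) \<bullet> (ide A \<boxtimes> asc B D T)"
proof (rule tcmp_cancel_right[where i = "asc A (B \<otimes>\<^sub>o D) T \<bullet> (asc A B D \<boxtimes> ide T)"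
      and r = "(csa A B D \<boxtimes> ide T) \<bullet> csa A (B \<otimes>\<^sub>o D) T"])
  have "(asc B D (A \<otimes>\<^sub>o T) \<bullet> swp A (B \<otimes>\<^sub>o D) T) \<bullet> asc A (B \<otimes>\<^sub>o D) T \<bullet> (asc A B D \<boxtimes> ide T)
    = (asc B D (A \<otimes>\<^sub>o T) \<bullet> asc (B \<otimes>\<^sub>o D) A T) \<bullet> ((brd A (B \<otimes>\<^sub>o D) \<bullet> asc A B D) \<boxtimes> ide T)"
    using assms by (simp add: swp_def tten_tcmp)
  also have "\<dots> = (ide B \<boxtimes> asc D A T) \<bullet> asc B (D \<otimes>\<^sub>o A) T
      \<bullet> ((asc B D A \<bullet> brd A (B \<otimes>\<^sub>o D) \<bullet> asc A B D) \<boxtimes> ide T)"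
    using assms by (simp add: asc_pentagon tten_tcmp)
  also have "\<dots> = (ide B \<boxtimes> asc D A T) \<bullet> (ide B \<boxtimes> (brd A D \<boxtimes> ide T)) \<bullet> asc B (A \<otimes>\<^sub>o D) T
      \<bullet> (asc B A D \<boxtimes> ide T) \<bullet> ((brd A B \<boxtimes> ide D) \<boxtimes> ide T)"
    using assms by (simp add: brd_hexagon whisker nat_simps)
  also have "\<dots> = (ide B \<boxtimes> swp A D T) \<bullet> ((ide B \<boxtimes> asc A D T) \<bullet> asc B (A \<otimes>\<^sub>o D) T
      \<bullet> (asc B A D \<boxtimes> ide T)) \<bullet> ((brd A B \<boxtimes> ide D) \<boxtimes> ide T)"
    using assms by (simp add: swp_def tten_tcmp(2))
  also have "\<dots> = (ide B \<boxtimes> swp A D T) \<bullet> asc B A (D \<otimes>\<^sub>o T) \<bullet> (brd A B \<boxtimes> ide (D \<otimes>\<^sub>o T))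
      \<bullet> asc (A \<otimes>\<^sub>o B) D T"
    using assms by (simp add: nat_simps flip: asc_pentagon)
  also have "\<dots> = (ide B \<boxtimes> swp A D T) \<bullet> swp A B (D \<otimes>\<^sub>o T) \<bullet> asc A B (D \<otimes>\<^sub>o T) \<bullet> asc (A \<otimes>\<^sub>o B) D T"
    using assms by (simp add: swp_def)
  also have "\<dots> = ((ide B \<boxtimes> swp A D T) \<bullet> swp A B (D \<otimes>\<^sub>o T) \<bullet> (ide A \<boxtimes> asc B D T))
      \<bullet> asc A (B \<otimes>\<^sub>o D) T \<bullet> (asc A B D \<boxtimes> ide T)"
    using assms by (simp add: asc_pentagon)
  finally show "(asc B D (A \<otimes>\<^sub>o T) \<bullet> swp A (B \<otimes>\<^sub>o D) T) \<bullet> asc A (B \<otimes>\<^sub>o D) T \<bullet> (asc A B D \<boxtimes> ide T)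
    = ((ide B \<boxtimes> swp A D T) \<bullet> swp A B (D \<otimes>\<^sub>o T) \<bullet> (ide A \<boxtimes> asc B D T))
      \<bullet> asc A (B \<otimes>\<^sub>o D) T \<bullet> (asc A B D \<boxtimes> ide T)" .
qed (use assms in \<open>simp_all add: tten_tcmp(2)\<close>)

text \<open>Only one hexagon is an axiom. The other one, which moves a product past
  \<open>X\<close>, follows because the exchange in the opposite direction is inverse to it and is
  decomposed by \<open>swp_ten\<close>.\<close>

lemma swp_ten_left:
  assumes "A \<in> Obj M" "B \<in> Obj M" "X \<in> Obj M" "T \<in> Obj M"
  shows "(ide X \<boxtimes> asc A B T) \<bullet> swp (A \<otimes>\<^sub>o B) X T
    = swp A X (B \<otimes>\<^sub>o T) \<bullet> (ide A \<boxtimes> swp B X T) \<bullet> asc A B (X \<otimes>\<^sub>o T)"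
proof (rule tcmp_cancel_right[where i = "swp X (A \<otimes>\<^sub>o B) T" and r = "swp (A \<otimes>\<^sub>o B) X T"])
  have "swp A X (B \<otimes>\<^sub>o T) \<bullet> (ide A \<boxtimes> swp B X T) \<bullet> asc A B (X \<otimes>\<^sub>o T) \<bullet> swp X (A \<otimes>\<^sub>o B) T
     = (swp A X (B \<otimes>\<^sub>o T) \<bullet> swp X A (B \<otimes>\<^sub>o T)) \<bullet> (ide X \<boxtimes> asc A B T)"
    using assms by (simp add: swp_ten tten_tcmp(2))
  then show "((ide X \<boxtimes> asc A B T) \<bullet> swp (A \<otimes>\<^sub>o B) X T) \<bullet> swp X (A \<otimes>\<^sub>o B) T
    = (swp A X (B \<otimes>\<^sub>o T) \<bullet> (ide A \<boxtimes> swp B X T) \<bullet> asc A B (X \<otimes>\<^sub>o T)) \<bullet> swp X (A \<otimes>\<^sub>o B) T"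
    using assms by (simp del: tcmp_assoc) simp
qed (use assms in simp_all)

text \<open>The other hexagon without a tail, again obtained from the given one by cancelling
  inverse braidings.\<close>

lemma brd_ten_left:
  assumes "A \<in> Obj M" "B \<in> Obj M" "X \<in> Obj M"
  shows "swp A X B \<bullet> (ide A \<boxtimes> brd B X) \<bullet> asc A B X = brd (A \<otimes>\<^sub>o B) X"
proof (rule tcmp_cancel_right[where i = "brd X (A \<otimes>\<^sub>o B) \<bullet> asc X A B"
      and r = "csa X A B \<bullet> brd (A \<otimes>\<^sub>o B) X"])
  show "(swp A X B \<bullet> (ide A \<boxtimes> brd B X) \<bullet> asc A B X) \<bullet> brd X (A \<otimes>\<^sub>o B) \<bullet> asc X A B
    = brd (A \<otimes>\<^sub>o B) X \<bullet> brd X (A \<otimes>\<^sub>o B) \<bullet> asc X A B"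
    using assms by (simp add: brd_hexagon tten_tcmp swp_def)
qed (use assms in simp_all)

text \<open>An exchange of the first two factors does not see whether \<open>T\<close> belongs to
  its tail. The pentagon is used once on each side of the braiding.\<close>

lemma swp_ten_tail:
  assumes "A \<in> Obj M" "B \<in> Obj M" "D \<in> Obj M" "T \<in> Obj M"
  shows "(ide B \<boxtimes> asc A D T) \<bullet> asc B (A \<otimes>\<^sub>o D) T \<bullet> (swp A B D \<boxtimes> ide T)
    = swp A B (D \<otimes>\<^sub>o T) \<bullet> (ide A \<boxtimes> asc B D T) \<bullet> asc A (B \<otimes>\<^sub>o D) T"
proof -
  have "(ide B \<boxtimes> asc A D T) \<bullet> asc B (A \<otimes>\<^sub>o D) T \<bullet> (swp A B D \<boxtimes> ide T)
      = ((ide B \<boxtimes> asc A D T) \<bullet> asc B (A \<otimes>\<^sub>o D) T \<bullet> (asc B A D \<boxtimes> ide T))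
        \<bullet> ((brd A B \<boxtimes> ide D) \<boxtimes> ide T) \<bullet> (csa A B D \<boxtimes> ide T)"
    using assms by (simp add: swp_def whisker)
  also have "\<dots> = asc B A (D \<otimes>\<^sub>o T) \<bullet> asc (B \<otimes>\<^sub>o A) D T \<bullet> ((brd A B \<boxtimes> ide D) \<boxtimes> ide T) \<bullet> (csa A B D \<boxtimes> ide T)"
    using assms by (simp flip: asc_pentagon)
  also have "\<dots> = asc B A (D \<otimes>\<^sub>o T) \<bullet> (brd A B \<boxtimes> ide (D \<otimes>\<^sub>o T)) \<bullet> csa A B (D \<otimes>\<^sub>o T)
      \<bullet> (asc A B (D \<otimes>\<^sub>o T) \<bullet> asc (A \<otimes>\<^sub>o B) D T) \<bullet> (csa A B D \<boxtimes> ide T)"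
    using assms by (simp add: nat_simps)
  also have "\<dots> = swp A B (D \<otimes>\<^sub>o T) \<bullet> (ide A \<boxtimes> asc B D T) \<bullet> asc A (B \<otimes>\<^sub>o D) T"
    using assms by (simp add: asc_pentagon swp_def tten_tcmp)
  finally show ?thesis .
qed

text \<open>Cocommutativity of a tensor product of comonoids rests on this. In right-nested products
  it says that \<open>A \<otimes>\<^sub>o B\<close> passes \<open>D \<otimes>\<^sub>o E\<close> by
  letting \<open>B\<close> pass \<open>D\<close> and \<open>E\<close>, and then
  \<open>A\<close>.\<close>

lemma brd_ten:
  assumes "A \<in> Obj M" "B \<in> Obj M" "D \<in> Obj M" "E \<in> Obj M"
  shows "brd (A \<otimes>\<^sub>o B) (D \<otimes>\<^sub>o E) = mid D A E B \<bullet> (brd A D \<boxtimes> brd B E) \<bullet> mid A B D E"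
proof (rule tcmp_cancel_left[OF asc_csa(2)[of D E "A \<otimes>\<^sub>o B"]])
  have "asc D E (A \<otimes>\<^sub>o B) \<bullet> mid D A E B \<bullet> (brd A D \<boxtimes> brd B E) \<bullet> mid A B D E
     = (ide D \<boxtimes> swp A E B) \<bullet> asc D A (E \<otimes>\<^sub>o B) \<bullet> (brd A D \<boxtimes> brd B E) \<bullet> mid A B D E"
    using assms by (simp add: asc_mid[THEN tcmp_tail])
  also have "\<dots> = (ide D \<boxtimes> swp A E B) \<bullet> asc D A (E \<otimes>\<^sub>o B) \<bullet> (brd A D \<boxtimes> ide (E \<otimes>\<^sub>o B))
      \<bullet> (ide (A \<otimes>\<^sub>o D) \<boxtimes> brd B E) \<bullet> mid A B D E"
    using assms by (simp add: tten_tcmp)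
  also have "\<dots> = (ide D \<boxtimes> swp A E B) \<bullet> swp A D (E \<otimes>\<^sub>o B) \<bullet> (ide A \<boxtimes> (ide D \<boxtimes> brd B E))
      \<bullet> asc A D (B \<otimes>\<^sub>o E) \<bullet> mid A B D E"
    using assms by (simp add: swp_def nat_simps)
  also have "\<dots> = (ide D \<boxtimes> swp A E B) \<bullet> swp A D (E \<otimes>\<^sub>o B)
      \<bullet> (ide A \<boxtimes> ((ide D \<boxtimes> brd B E) \<bullet> swp B D E)) \<bullet> asc A B (D \<otimes>\<^sub>o E)"
    using assms by (simp add: asc_mid whisker)
  also have "(ide D \<boxtimes> brd B E) \<bullet> swp B D E = asc D E B \<bullet> brd B (D \<otimes>\<^sub>o E)"
    using assms brd_hexagon[of B D E, THEN tcmp_tail3, of "csa B D E"] by (simp add: swp_def)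
  also have "(ide D \<boxtimes> swp A E B) \<bullet> swp A D (E \<otimes>\<^sub>o B)
      \<bullet> (ide A \<boxtimes> (asc D E B \<bullet> brd B (D \<otimes>\<^sub>o E))) \<bullet> asc A B (D \<otimes>\<^sub>o E)
    = asc D E (A \<otimes>\<^sub>o B) \<bullet> swp A (D \<otimes>\<^sub>o E) B \<bullet> (ide A \<boxtimes> brd B (D \<otimes>\<^sub>o E)) \<bullet> asc A B (D \<otimes>\<^sub>o E)"
    using assms by (simp add: whisker swp_ten[THEN tcmp_tail])
  also have "\<dots> = asc D E (A \<otimes>\<^sub>o B) \<bullet> brd (A \<otimes>\<^sub>o B) (D \<otimes>\<^sub>o E)"
    using assms by (simp add: brd_ten_left)
  finally show "asc D E (A \<otimes>\<^sub>o B) \<bullet> brd (A \<otimes>\<^sub>o B) (D \<otimes>\<^sub>o E)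
    = asc D E (A \<otimes>\<^sub>o B) \<bullet> mid D A E B \<bullet> (brd A D \<boxtimes> brd B E) \<bullet> mid A B D E"
    by (rule sym)
qed (use assms in simp_all)

lemma mid_unit_unit:
  assumes "A \<in> Obj M" "B \<in> Obj M"
  shows "mid A \<one>\<^sub>o \<one>\<^sub>o B = ide ((A \<otimes>\<^sub>o \<one>\<^sub>o) \<otimes>\<^sub>o (\<one>\<^sub>o \<otimes>\<^sub>o B))"
  using assms by (simp add: mid_def swp_def brd_unit)

text \<open>What remains of the counit law of a tensor product once the counits are pulled through
  \<open>mid\<close>. It also makes \<open>lun\<close> a comonoid morphism.\<close>

lemma lun_mid:
  assumes "A \<in> Obj M" "B \<in> Obj M"
  shows "lun (A \<otimes>\<^sub>o B) \<bullet> (lun \<one>\<^sub>o \<boxtimes> ide (A \<otimes>\<^sub>o B)) \<bullet> mid \<one>\<^sub>o A \<one>\<^sub>o B = lun A \<boxtimes> lun B"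
proof -
  have 1: "lun \<one>\<^sub>o \<boxtimes> ide (A \<otimes>\<^sub>o B) = (ide \<one>\<^sub>o \<boxtimes> lun (A \<otimes>\<^sub>o B)) \<bullet> asc \<one>\<^sub>o \<one>\<^sub>o (A \<otimes>\<^sub>o B)"
    using assms by (simp add: asc_triangle lun_unit)
  \<comment> \<open>A unit standing between \<open>A\<close> and \<open>B\<close> may be absorbed
    into \<open>B\<close> or first be moved in front of \<open>A\<close>.\<close>
  have 2: "lun (A \<otimes>\<^sub>o B) \<bullet> swp A \<one>\<^sub>o B = ide A \<boxtimes> lun B"
    using assms by (simp add: swp_def lun_ten_asc[THEN tcmp_tail] tten_tcmp lun_brd
        flip: asc_triangle)
  have "lun (A \<otimes>\<^sub>o B) \<bullet> (lun \<one>\<^sub>o \<boxtimes> ide (A \<otimes>\<^sub>o B)) \<bullet> mid \<one>\<^sub>o A \<one>\<^sub>o B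
    = lun (A \<otimes>\<^sub>o B) \<bullet> (ide \<one>\<^sub>o \<boxtimes> (ide A \<boxtimes> lun B)) \<bullet> asc \<one>\<^sub>o A (\<one>\<^sub>o \<otimes>\<^sub>o B)"
    using assms by (simp add: 1 mid_def tten_tcmp 2)
  also have "\<dots> = (ide A \<boxtimes> lun B) \<bullet> (lun A \<boxtimes> ide (\<one>\<^sub>o \<otimes>\<^sub>o B))"
    using assms by (simp add: nat_simps lun_ten_asc)
  also have "\<dots> = lun A \<boxtimes> lun B"
    using assms by (simp add: tten_tcmp)
  finally show ?thesis .
qed

text \<open>Associativity of the interchange for the pairs (\<open>P\<close>, \<open>X\<close>),
  (\<open>Q\<close>, \<open>Y\<close>), (\<open>R\<close>, \<open>Z\<close>): the coherence behind
  coassociativity of tensor products and behind \<open>asc\<close> being a comonoid morphism. The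
  arrow \<open>?i\<close> brackets the target to the right, and both sides then become
  \<open>?c\<close>.\<close>

lemma asc_mid_mid:
  assumes "P \<in> Obj M" "Q \<in> Obj M" "R \<in> Obj M" "X \<in> Obj M" "Y \<in> Obj M" "Z \<in> Obj M"
  shows "asc (P \<otimes>\<^sub>o X) (Q \<otimes>\<^sub>o Y) (R \<otimes>\<^sub>o Z) \<bullet> (mid P Q X Y \<boxtimes> ide (R \<otimes>\<^sub>o Z))
      \<bullet> mid (P \<otimes>\<^sub>o Q) R (X \<otimes>\<^sub>o Y) Z
    = (ide (P \<otimes>\<^sub>o X) \<boxtimes> mid Q R Y Z) \<bullet> mid P (Q \<otimes>\<^sub>o R) X (Y \<otimes>\<^sub>o Z) \<bullet> (asc P Q R \<boxtimes> asc X Y Z)"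
    (is "?l = ?r")
proof (rule tcmp_cancel_left)
  let ?i = "(ide P \<boxtimes> (ide X \<boxtimes> asc Q Y (R \<otimes>\<^sub>o Z))) \<bullet> asc P X ((Q \<otimes>\<^sub>o Y) \<otimes>\<^sub>o (R \<otimes>\<^sub>o Z))"
  let ?j = "csa P X ((Q \<otimes>\<^sub>o Y) \<otimes>\<^sub>o (R \<otimes>\<^sub>o Z)) \<bullet> (ide P \<boxtimes> (ide X \<boxtimes> csa Q Y (R \<otimes>\<^sub>o Z)))"
  let ?s = "swp Q X (Y \<otimes>\<^sub>o (R \<otimes>\<^sub>o Z))"
  let ?m = "mid (P \<otimes>\<^sub>o Q) R (X \<otimes>\<^sub>o Y) Z"
  let ?t = "(ide X \<boxtimes> swp R Y Z) \<bullet> swp R X (Y \<otimes>\<^sub>o Z)"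
  \<comment> \<open>The common normal form: with everything right-nested, \<open>R\<close> passes
    \<open>X\<close>, then \<open>R\<close> passes \<open>Y\<close>, then \<open>Q\<close> passes
    \<open>X\<close>.\<close>
  let ?c = "(ide P \<boxtimes> (?s \<bullet> (ide Q \<boxtimes> ?t)))
      \<bullet> asc P Q (R \<otimes>\<^sub>o (X \<otimes>\<^sub>o (Y \<otimes>\<^sub>o Z))) \<bullet> asc (P \<otimes>\<^sub>o Q) R (X \<otimes>\<^sub>o (Y \<otimes>\<^sub>o Z))
      \<bullet> (ide ((P \<otimes>\<^sub>o Q) \<otimes>\<^sub>o R) \<boxtimes> asc X Y Z)"
  show "?j \<bullet> ?i = ide ((P \<otimes>\<^sub>o X) \<otimes>\<^sub>o ((Q \<otimes>\<^sub>o Y) \<otimes>\<^sub>o (R \<otimes>\<^sub>o Z)))"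
    using assms by (simp add: tten_tcmp)
  have "?i \<bullet> ?l = (ide P \<boxtimes> (ide X \<boxtimes> asc Q Y (R \<otimes>\<^sub>o Z))) \<bullet> (ide P \<boxtimes> asc X (Q \<otimes>\<^sub>o Y) (R \<otimes>\<^sub>o Z))
      \<bullet> asc P (X \<otimes>\<^sub>o (Q \<otimes>\<^sub>o Y)) (R \<otimes>\<^sub>o Z)
      \<bullet> ((asc P X (Q \<otimes>\<^sub>o Y) \<bullet> mid P Q X Y) \<boxtimes> ide (R \<otimes>\<^sub>o Z)) \<bullet> ?m"
    using assms by (simp add: asc_pentagon[THEN tcmp_tail] whisker)
  also have "\<dots> = (ide P \<boxtimes> ((ide X \<boxtimes> asc Q Y (R \<otimes>\<^sub>o Z)) \<bullet> asc X (Q \<otimes>\<^sub>o Y) (R \<otimes>\<^sub>o Z)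
        \<bullet> (swp Q X Y \<boxtimes> ide (R \<otimes>\<^sub>o Z))))
      \<bullet> asc P (Q \<otimes>\<^sub>o (X \<otimes>\<^sub>o Y)) (R \<otimes>\<^sub>o Z) \<bullet> (asc P Q (X \<otimes>\<^sub>o Y) \<boxtimes> ide (R \<otimes>\<^sub>o Z)) \<bullet> ?m"
    using assms by (simp add: asc_mid whisker nat_simps)
  also have "\<dots> = (ide P \<boxtimes> (?s \<bullet> (ide Q \<boxtimes> asc X Y (R \<otimes>\<^sub>o Z))))
      \<bullet> ((ide P \<boxtimes> asc Q (X \<otimes>\<^sub>o Y) (R \<otimes>\<^sub>o Z)) \<bullet> asc P (Q \<otimes>\<^sub>o (X \<otimes>\<^sub>o Y)) (R \<otimes>\<^sub>o Z)
        \<bullet> (asc P Q (X \<otimes>\<^sub>o Y) \<boxtimes> ide (R \<otimes>\<^sub>o Z))) \<bullet> ?m"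
    using assms by (simp add: swp_ten_tail) (simp add: whisker)
  also have "\<dots> = (ide P \<boxtimes> (?s \<bullet> (ide Q \<boxtimes> asc X Y (R \<otimes>\<^sub>o Z))))
      \<bullet> asc P Q ((X \<otimes>\<^sub>o Y) \<otimes>\<^sub>o (R \<otimes>\<^sub>o Z)) \<bullet> asc (P \<otimes>\<^sub>o Q) (X \<otimes>\<^sub>o Y) (R \<otimes>\<^sub>o Z) \<bullet> ?m"
    using assms by (simp flip: asc_pentagon)
  also have "\<dots> = (ide P \<boxtimes> (?s \<bullet> (ide Q \<boxtimes> (asc X Y (R \<otimes>\<^sub>o Z) \<bullet> swp R (X \<otimes>\<^sub>o Y) Z))))
      \<bullet> asc P Q (R \<otimes>\<^sub>o ((X \<otimes>\<^sub>o Y) \<otimes>\<^sub>o Z)) \<bullet> asc (P \<otimes>\<^sub>o Q) R ((X \<otimes>\<^sub>o Y) \<otimes>\<^sub>o Z)"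
    using assms by (simp add: asc_mid whisker nat_simps)
  also have "\<dots> = ?c"
    using assms by (simp add: swp_ten) (simp add: whisker nat_simps)
  finally have l: "?i \<bullet> ?l = ?c" .
  have split: "asc P Q R \<boxtimes> asc X Y Z
    = (asc P Q R \<boxtimes> ide (X \<otimes>\<^sub>o (Y \<otimes>\<^sub>o Z))) \<bullet> (ide ((P \<otimes>\<^sub>o Q) \<otimes>\<^sub>o R) \<boxtimes> asc X Y Z)"
    using assms by (simp add: tten_tcmp)
  have "?i \<bullet> ?r = (ide P \<boxtimes> (ide X \<boxtimes> asc Q Y (R \<otimes>\<^sub>o Z)))
      \<bullet> (ide P \<boxtimes> (ide X \<boxtimes> mid Q R Y Z)) \<bullet> (asc P X ((Q \<otimes>\<^sub>o R) \<otimes>\<^sub>o (Y \<otimes>\<^sub>o Z))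
      \<bullet> mid P (Q \<otimes>\<^sub>o R) X (Y \<otimes>\<^sub>o Z)) \<bullet> (asc P Q R \<boxtimes> asc X Y Z)"
    using assms by (simp add: nat_simps)
  also have "\<dots> = (ide P \<boxtimes> (ide X \<boxtimes> (asc Q Y (R \<otimes>\<^sub>o Z) \<bullet> mid Q R Y Z)))
      \<bullet> (ide P \<boxtimes> swp (Q \<otimes>\<^sub>o R) X (Y \<otimes>\<^sub>o Z)) \<bullet> asc P (Q \<otimes>\<^sub>o R) (X \<otimes>\<^sub>o (Y \<otimes>\<^sub>o Z))
      \<bullet> (asc P Q R \<boxtimes> asc X Y Z)"
    using assms by (simp add: asc_mid[of P "Q \<otimes>\<^sub>o R" X "Y \<otimes>\<^sub>o Z", THEN tcmp_tail] whisker)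
  also have "\<dots> = (ide P \<boxtimes> ((ide X \<boxtimes> (ide Q \<boxtimes> swp R Y Z))
        \<bullet> ((ide X \<boxtimes> asc Q R (Y \<otimes>\<^sub>o Z)) \<bullet> swp (Q \<otimes>\<^sub>o R) X (Y \<otimes>\<^sub>o Z))))
      \<bullet> asc P (Q \<otimes>\<^sub>o R) (X \<otimes>\<^sub>o (Y \<otimes>\<^sub>o Z)) \<bullet> (asc P Q R \<boxtimes> asc X Y Z)"
    using assms by (simp add: asc_mid whisker)
  also have "\<dots> = (ide P \<boxtimes> (((ide X \<boxtimes> (ide Q \<boxtimes> swp R Y Z)) \<bullet> swp Q X (R \<otimes>\<^sub>o (Y \<otimes>\<^sub>o Z)))
        \<bullet> (ide Q \<boxtimes> swp R X (Y \<otimes>\<^sub>o Z))))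
      \<bullet> ((ide P \<boxtimes> asc Q R (X \<otimes>\<^sub>o (Y \<otimes>\<^sub>o Z))) \<bullet> asc P (Q \<otimes>\<^sub>o R) (X \<otimes>\<^sub>o (Y \<otimes>\<^sub>o Z))
      \<bullet> (asc P Q R \<boxtimes> ide (X \<otimes>\<^sub>o (Y \<otimes>\<^sub>o Z)))) \<bullet> (ide ((P \<otimes>\<^sub>o Q) \<otimes>\<^sub>o R) \<boxtimes> asc X Y Z)"
    using assms by (simp add: swp_ten_left split) (simp add: whisker)
  \<comment> \<open>On this side \<open>Q\<close> passes \<open>X\<close> before \<open>R\<close>
    passes \<open>Y\<close>. These exchanges concern disjoint pairs of factors, so naturality of
    \<open>swp\<close> brings them into the order of \<open>?c\<close>.\<close>
  also have "\<dots> = (ide P \<boxtimes> ((?s \<bullet> (ide Q \<boxtimes> (ide X \<boxtimes> swp R Y Z)))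
        \<bullet> (ide Q \<boxtimes> swp R X (Y \<otimes>\<^sub>o Z))))
      \<bullet> asc P Q (R \<otimes>\<^sub>o (X \<otimes>\<^sub>o (Y \<otimes>\<^sub>o Z))) \<bullet> asc (P \<otimes>\<^sub>o Q) R (X \<otimes>\<^sub>o (Y \<otimes>\<^sub>o Z))
      \<bullet> (ide ((P \<otimes>\<^sub>o Q) \<otimes>\<^sub>o R) \<boxtimes> asc X Y Z)"
    using assms by (simp add: swp_nat flip: asc_pentagon)
  also have "\<dots> = ?c"
    using assms by (simp add: whisker)
  finally have r: "?i \<bullet> ?r = ?c" .
  show "?i \<bullet> ?l = ?i \<bullet> ?r"
    unfolding l r ..
qed (use assms in simp_all)

end

section \<open>Cocommutative comonoids\<close>

record ('o, 'm) comonoid =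
  ob :: 'o
  cm :: "('o, 'm) tarrow"
  cu :: "('o, 'm) tarrow"

context symmetric_monoidal_category
begin

text \<open>The right counit law is omitted, since it follows from the left one by cocommutativity.\<close>

definition coc :: "('o, 'm) comonoid \<Rightarrow> bool" where
  "coc X \<longleftrightarrow>
     ob X \<in> Obj M \<and>
     arr (cm X) \<and> dm (cm X) = ob X \<and> cd (cm X) = ob X \<otimes>\<^sub>o ob X \<and>
     arr (cu X) \<and> dm (cu X) = ob X \<and> cd (cu X) = \<one>\<^sub>o \<and>
     asc (ob X) (ob X) (ob X) \<bullet> (cm X \<boxtimes> ide (ob X)) \<bullet> cm X = (ide (ob X) \<boxtimes> cm X) \<bullet> cm X \<and>
     lun (ob X) \<bullet> (cu X \<boxtimes> ide (ob X)) \<bullet> cm X = ide (ob X) \<and>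
     brd (ob X) (ob X) \<bullet> cm X = cm X"

definition com_hom :: "('o, 'm) comonoid \<Rightarrow> ('o, 'm) comonoid \<Rightarrow> ('o, 'm) tarrow \<Rightarrow> bool" where
  "com_hom X Y f \<longleftrightarrow>
     arr f \<and> dm f = ob X \<and> cd f = ob Y \<and>
     cm Y \<bullet> f = (f \<boxtimes> f) \<bullet> cm X \<and> cu Y \<bullet> f = cu X"

definition ten_com :: "('o, 'm) comonoid \<Rightarrow> ('o, 'm) comonoid \<Rightarrow> ('o, 'm) comonoid"
    (infixl "\<boxtimes>\<^sub>c" 70) where
  "X \<boxtimes>\<^sub>c Y =
     \<lparr>ob = ob X \<otimes>\<^sub>o ob Y,
      cm = mid (ob X) (ob X) (ob Y) (ob Y) \<bullet> (cm X \<boxtimes> cm Y),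
      cu = lun \<one>\<^sub>o \<bullet> (cu X \<boxtimes> cu Y)\<rparr>"

definition unit_com :: "('o, 'm) comonoid" where
  "unit_com = \<lparr>ob = \<one>\<^sub>o, cm = nul \<one>\<^sub>o, cu = ide \<one>\<^sub>o\<rparr>"

lemma coc_simps [simp]:
  assumes "coc X"
  shows "ob X \<in> Obj M" "arr (cm X)" "dm (cm X) = ob X" "cd (cm X) = ob X \<otimes>\<^sub>o ob X"
    "arr (cu X)" "dm (cu X) = ob X" "cd (cu X) = \<one>\<^sub>o"
  using assms by (simp_all add: coc_def)

lemma coassoc: "coc X \<Longrightarrow>
    asc (ob X) (ob X) (ob X) \<bullet> (cm X \<boxtimes> ide (ob X)) \<bullet> cm X = (ide (ob X) \<boxtimes> cm X) \<bullet> cm X"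
  and counit_left: "coc X \<Longrightarrow> lun (ob X) \<bullet> (cu X \<boxtimes> ide (ob X)) \<bullet> cm X = ide (ob X)"
  and cocomm: "coc X \<Longrightarrow> brd (ob X) (ob X) \<bullet> cm X = cm X"
  unfolding coc_def by blast+

lemma cocI:
  assumes "ob X \<in> Obj M" "arr (cm X)" "dm (cm X) = ob X" "cd (cm X) = ob X \<otimes>\<^sub>o ob X"
    "arr (cu X)" "dm (cu X) = ob X" "cd (cu X) = \<one>\<^sub>o"
    "asc (ob X) (ob X) (ob X) \<bullet> (cm X \<boxtimes> ide (ob X)) \<bullet> cm X = (ide (ob X) \<boxtimes> cm X) \<bullet> cm X"
    "lun (ob X) \<bullet> (cu X \<boxtimes> ide (ob X)) \<bullet> cm X = ide (ob X)"
    "brd (ob X) (ob X) \<bullet> cm X = cm X"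
  shows "coc X"
  using assms unfolding coc_def by blast

lemma counit_right:
  assumes "coc X"
  shows "run (ob X) \<bullet> (ide (ob X) \<boxtimes> cu X) \<bullet> cm X = ide (ob X)"
proof -
  have "run (ob X) \<bullet> (ide (ob X) \<boxtimes> cu X) \<bullet> brd (ob X) (ob X) \<bullet> cm X
      = lun (ob X) \<bullet> brd (ob X) \<one>\<^sub>o \<bullet> brd \<one>\<^sub>o (ob X) \<bullet> (cu X \<boxtimes> ide (ob X)) \<bullet> cm X"
    using assms by (simp add: nat_simps flip: lun_brd)
  with assms show ?thesis
    by (simp add: counit_left cocomm)
qed

lemma com_homD:
  assumes "com_hom X Y f"
  shows "arr f" "dm f = ob X" "cd f = ob Y" "cm Y \<bullet> f = (f \<boxtimes> f) \<bullet> cm X" "cu Y \<bullet> f = cu X"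
  using assms by (simp_all add: com_hom_def)

lemma ob_ten_com [simp]: "ob (X \<boxtimes>\<^sub>c Y) = ob X \<otimes>\<^sub>o ob Y"
  and ob_unit_com [simp]: "ob unit_com = \<one>\<^sub>o"
  by (simp_all add: ten_com_def unit_com_def)

section \<open>Unit and tensor product of cocommutative comonoids\<close>

lemma coc_unit_com [simp]: "coc unit_com"
proof (rule cocI)
  have "ide \<one>\<^sub>o \<boxtimes> nul \<one>\<^sub>o = asc \<one>\<^sub>o \<one>\<^sub>o \<one>\<^sub>o \<bullet> (nul \<one>\<^sub>o \<boxtimes> ide \<one>\<^sub>o)"
    by (rule tcmp_cancel_left[where i = "ide \<one>\<^sub>o \<boxtimes> lun \<one>\<^sub>o" and r = "ide \<one>\<^sub>o \<boxtimes> nul \<one>\<^sub>o"])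
      (simp_all add: tten_tcmp asc_triangle[THEN tcmp_tail] flip: lun_unit)
  then show "asc (ob unit_com) (ob unit_com) (ob unit_com) \<bullet> (cm unit_com \<boxtimes> ide (ob unit_com)) \<bullet> cm unit_com
    = (ide (ob unit_com) \<boxtimes> cm unit_com) \<bullet> cm unit_com"
    by (simp add: unit_com_def)
qed (simp_all add: unit_com_def brd_unit)

text \<open>Facts 1 to 3 slide comultiplications and counits past \<open>mid\<close>. What is left
  is pure coherence (\<open>asc_mid_mid\<close>, \<open>lun_mid\<close>), followed by the laws of
  \<open>X\<close> and \<open>Y\<close> in separate tensor factors. For cocommutativity,
  \<open>brd_ten\<close> produces a copy of \<open>mid\<close> that cancels the one in the
  comultiplication.\<close>

lemma coc_ten_com [simp]:
  assumes X: "coc X" and Y: "coc Y"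
  shows "coc (X \<boxtimes>\<^sub>c Y)"
proof -
  let ?A = "ob X" and ?B = "ob Y"
  let ?AB = "?A \<otimes>\<^sub>o ?B"
  let ?d = "mid ?A ?A ?B ?B \<bullet> (cm X \<boxtimes> cm Y)"
  let ?e = "lun \<one>\<^sub>o \<bullet> (cu X \<boxtimes> cu Y)"
  have 1: "((cm X \<boxtimes> cm Y) \<boxtimes> ide ?AB) \<bullet> mid ?A ?A ?B ?B
      = mid (?A \<otimes>\<^sub>o ?A) ?A (?B \<otimes>\<^sub>o ?B) ?B \<bullet> ((cm X \<boxtimes> ide ?A) \<boxtimes> (cm Y \<boxtimes> ide ?B))"
    using X Y by (simp add: mid_nat)
  have 2: "(ide ?AB \<boxtimes> (cm X \<boxtimes> cm Y)) \<bullet> mid ?A ?A ?B ?B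
      = mid ?A (?A \<otimes>\<^sub>o ?A) ?B (?B \<otimes>\<^sub>o ?B) \<bullet> ((ide ?A \<boxtimes> cm X) \<boxtimes> (ide ?B \<boxtimes> cm Y))"
    using X Y by (simp add: mid_nat)
  have 3: "((cu X \<boxtimes> cu Y) \<boxtimes> ide ?AB) \<bullet> mid ?A ?A ?B ?B
      = mid \<one>\<^sub>o ?A \<one>\<^sub>o ?B \<bullet> ((cu X \<boxtimes> ide ?A) \<boxtimes> (cu Y \<boxtimes> ide ?B))"
    using X Y by (simp add: mid_nat)
  have "asc ?AB ?AB ?AB \<bullet> (?d \<boxtimes> ide ?AB) \<bullet> ?d
      = (asc ?AB ?AB ?AB \<bullet> (mid ?A ?A ?B ?B \<boxtimes> ide ?AB) \<bullet> mid (?A \<otimes>\<^sub>o ?A) ?A (?B \<otimes>\<^sub>o ?B) ?B)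
        \<bullet> ((cm X \<boxtimes> ide ?A) \<boxtimes> (cm Y \<boxtimes> ide ?B)) \<bullet> (cm X \<boxtimes> cm Y)"
    using X Y by (simp add: whisker 1[THEN tcmp_tail])
  also have "\<dots> = (ide ?AB \<boxtimes> mid ?A ?A ?B ?B) \<bullet> mid ?A (?A \<otimes>\<^sub>o ?A) ?B (?B \<otimes>\<^sub>o ?B)
        \<bullet> ((ide ?A \<boxtimes> cm X) \<boxtimes> (ide ?B \<boxtimes> cm Y)) \<bullet> (cm X \<boxtimes> cm Y)"
    using X Y by (simp add: asc_mid_mid) (simp add: tten_tcmp coassoc)
  also have "\<dots> = (ide ?AB \<boxtimes> ?d) \<bullet> ?d"
    using X Y by (simp add: whisker 2[THEN tcmp_tail])
  finally have coassoc: "asc ?AB ?AB ?AB \<bullet> (?d \<boxtimes> ide ?AB) \<bullet> ?d = (ide ?AB \<boxtimes> ?d) \<bullet> ?d" .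
  have "lun ?AB \<bullet> (?e \<boxtimes> ide ?AB) \<bullet> ?d
      = (lun ?AB \<bullet> (lun \<one>\<^sub>o \<boxtimes> ide ?AB) \<bullet> mid \<one>\<^sub>o ?A \<one>\<^sub>o ?B)
        \<bullet> ((cu X \<boxtimes> ide ?A) \<boxtimes> (cu Y \<boxtimes> ide ?B)) \<bullet> (cm X \<boxtimes> cm Y)"
    using X Y by (simp add: whisker 3[THEN tcmp_tail])
  also have "\<dots> = ide ?AB"
    using X Y by (simp add: lun_mid del: tcmp_assoc) (simp add: tten_tcmp counit_left)
  finally have counit: "lun ?AB \<bullet> (?e \<boxtimes> ide ?AB) \<bullet> ?d = ide ?AB" .
  have "brd ?AB ?AB \<bullet> ?d = ?d"
    using X Y by (simp add: brd_ten mid_mid[THEN tcmp_tail] tten_tcmp cocomm)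
  with coassoc counit X Y show ?thesis
    by (intro cocI) (simp_all add: ten_com_def)
qed

lemma com_hom_ide: "coc X \<Longrightarrow> com_hom X X (ide (ob X))"
  by (simp add: com_hom_def)

lemma com_hom_tcmp:
  assumes X: "coc X" and f: "com_hom X Y f" and g: "com_hom Y Z g"
  shows "com_hom X Z (g \<bullet> f)"
proof -
  have "cm Z \<bullet> g \<bullet> f = (g \<boxtimes> g) \<bullet> (f \<boxtimes> f) \<bullet> cm X"
    by (simp add: com_homD(4)[OF g, THEN tcmp_tail] com_homD(4)[OF f])
  moreover have "cu Z \<bullet> g \<bullet> f = cu X"
    by (simp add: com_homD(5)[OF g, THEN tcmp_tail] com_homD(5)[OF f])
  ultimately show ?thesis
    using com_homD(1-3)[OF f] com_homD(1-3)[OF g] by (simp add: com_hom_def tten_tcmp)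
qed

text \<open>Used to pass from a shear map to its inverse, the shear map of the antipode.\<close>

lemma com_hom_inverse:
  assumes X: "coc X" and Y: "coc Y" and f: "com_hom X Y f"
    and g: "arr g" "dm g = ob Y" "cd g = ob X"
    and gf: "g \<bullet> f = ide (ob X)" and fg: "f \<bullet> g = ide (ob Y)"
  shows "com_hom Y X g"
proof -
  have "cm X \<bullet> g = (g \<boxtimes> g) \<bullet> ((f \<boxtimes> f) \<bullet> cm X) \<bullet> g"
    using X Y g com_homD[OF f] gf by (simp add: tten_tcmp)
  also have "\<dots> = (g \<boxtimes> g) \<bullet> cm Y"
    using X Y g fg by (simp flip: com_homD(4)[OF f])
  finally have "cm X \<bullet> g = (g \<boxtimes> g) \<bullet> cm Y" .
  moreover have "cu X \<bullet> g = cu Y"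
    using X Y g fg by (simp flip: com_homD(5)[OF f])
  ultimately show ?thesis
    using g by (simp add: com_hom_def)
qed

lemma com_hom_tten:
  assumes "coc X" "coc X'" and f: "com_hom X Y f" and g: "com_hom X' Y' g"
    and "coc Y" "coc Y'"
  shows "com_hom (X \<boxtimes>\<^sub>c X') (Y \<boxtimes>\<^sub>c Y') (f \<boxtimes> g)"
proof -
  have "mid (ob Y) (ob Y) (ob Y') (ob Y') \<bullet> ((f \<boxtimes> f) \<boxtimes> (g \<boxtimes> g))
      = ((f \<boxtimes> g) \<boxtimes> (f \<boxtimes> g)) \<bullet> mid (ob X) (ob X) (ob X') (ob X')"
    using com_homD[OF f] com_homD[OF g] assms by (simp add: mid_nat)
  note mid = this[THEN tcmp_tail]
  have "cm (Y \<boxtimes>\<^sub>c Y') \<bullet> (f \<boxtimes> g)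
      = mid (ob Y) (ob Y) (ob Y') (ob Y') \<bullet> ((f \<boxtimes> f) \<boxtimes> (g \<boxtimes> g)) \<bullet> (cm X \<boxtimes> cm X')"
    using com_homD[OF f] com_homD[OF g] assms by (simp add: ten_com_def tten_tcmp)
  also have "\<dots> = ((f \<boxtimes> g) \<boxtimes> (f \<boxtimes> g)) \<bullet> cm (X \<boxtimes>\<^sub>c X')"
    by (simp add: mid ten_com_def)
  finally show ?thesis
    using com_homD[OF f] com_homD[OF g] assms by (simp add: com_hom_def) (simp add: ten_com_def tten_tcmp)
qed

section \<open>Structure maps as comonoid morphisms\<close>

lemma com_hom_cu:
  assumes X: "coc X"
  shows "com_hom X unit_com (cu X)"
    and lun_cu_cu: "lun \<one>\<^sub>o \<bullet> (cu X \<boxtimes> cu X) \<bullet> cm X = cu X"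
proof -
  have "(cu X \<boxtimes> cu X) = (ide \<one>\<^sub>o \<boxtimes> cu X) \<bullet> (cu X \<boxtimes> ide (ob X))"
    using X by (simp add: tten_tcmp)
  then show *: "lun \<one>\<^sub>o \<bullet> (cu X \<boxtimes> cu X) \<bullet> cm X = cu X"
    using X by (simp add: nat_simps counit_left)
  have "nul \<one>\<^sub>o \<bullet> cu X = (cu X \<boxtimes> cu X) \<bullet> cm X"
    by (subst *[symmetric]) (use X in simp)
  with X show "com_hom X unit_com (cu X)"
    by (simp add: com_hom_def unit_com_def)
qed

text \<open>The threefold comultiplication is symmetric in its first two factors: coassociativity
  brackets them together, and there cocommutativity applies.\<close>

lemma swp_cm:
  assumes X: "coc X"
  shows "swp (ob X) (ob X) (ob X) \<bullet> (ide (ob X) \<boxtimes> cm X) \<bullet> cm X = (ide (ob X) \<boxtimes> cm X) \<bullet> cm X"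
proof -
  have "(brd (ob X) (ob X) \<boxtimes> ide (ob X)) \<bullet> (cm X \<boxtimes> ide (ob X)) = cm X \<boxtimes> ide (ob X)"
    using X by (simp add: tten_tcmp cocomm)
  from this[THEN tcmp_tail] show ?thesis
    using X by (simp add: swp_def flip: coassoc)
qed

text \<open>Here cocommutativity is decisive: after rebracketing, \<open>mid\<close> exchanges the
  two inner factors of a fourfold comultiplication, which is invariant by \<open>swp_cm\<close>.
  This makes \<open>cm\<close> the diagonal for the products below.\<close>

lemma com_hom_cm:
  assumes X: "coc X"
  shows "com_hom X (X \<boxtimes>\<^sub>c X) (cm X)"
proof -
  let ?A = "ob X"
  have "asc ?A ?A (?A \<otimes>\<^sub>o ?A) \<bullet> (cm X \<boxtimes> cm X) \<bullet> cm X
      = asc ?A ?A (?A \<otimes>\<^sub>o ?A) \<bullet> (ide (?A \<otimes>\<^sub>o ?A) \<boxtimes> cm X) \<bullet> (cm X \<boxtimes> ide ?A) \<bullet> cm X"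
    using X by (simp add: tten_tcmp)
  also have "\<dots> = (ide ?A \<boxtimes> ((ide ?A \<boxtimes> cm X) \<bullet> cm X)) \<bullet> cm X"
    using X by (simp add: nat_simps coassoc whisker)
  finally have *: "asc ?A ?A (?A \<otimes>\<^sub>o ?A) \<bullet> (cm X \<boxtimes> cm X) \<bullet> cm X
    = (ide ?A \<boxtimes> ((ide ?A \<boxtimes> cm X) \<bullet> cm X)) \<bullet> cm X" .
  have "mid ?A ?A ?A ?A \<bullet> (cm X \<boxtimes> cm X) \<bullet> cm X = (cm X \<boxtimes> cm X) \<bullet> cm X"
  proof (rule tcmp_cancel_left[OF asc_csa(2)[of ?A ?A "?A \<otimes>\<^sub>o ?A"]])
    show "asc ?A ?A (?A \<otimes>\<^sub>o ?A) \<bullet> mid ?A ?A ?A ?A \<bullet> (cm X \<boxtimes> cm X) \<bullet> cm X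
      = asc ?A ?A (?A \<otimes>\<^sub>o ?A) \<bullet> (cm X \<boxtimes> cm X) \<bullet> cm X"
      using X by (simp add: asc_mid[THEN tcmp_tail] *) (simp add: tten_tcmp swp_cm)
  qed (use X in simp_all)
  with X show ?thesis
    by (simp add: com_hom_def ten_com_def lun_cu_cu)
qed

lemma com_hom_lun:
  assumes X: "coc X"
  shows "com_hom (unit_com \<boxtimes>\<^sub>c X) X (lun (ob X))"
proof -
  have "(lun (ob X) \<boxtimes> lun (ob X)) \<bullet> mid \<one>\<^sub>o \<one>\<^sub>o (ob X) (ob X)
      = lun (ob X \<otimes>\<^sub>o ob X) \<bullet> (lun \<one>\<^sub>o \<boxtimes> ide (ob X \<otimes>\<^sub>o ob X))"
    using X by (simp flip: lun_mid)
  from this[THEN tcmp_tail] show ?thesis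
    using X by (simp add: com_hom_def ten_com_def unit_com_def tten_tcmp nat_simps)
qed

lemma com_hom_brd:
  assumes "coc X" "coc Y"
  shows "com_hom (X \<boxtimes>\<^sub>c Y) (Y \<boxtimes>\<^sub>c X) (brd (ob X) (ob Y))"
  using assms brd_nat[of "cm X" "cm Y", THEN sym] brd_nat[of "cu X" "cu Y", THEN sym]
  by (simp add: com_hom_def ten_com_def brd_ten mid_mid[THEN tcmp_tail] brd_unit)

lemma com_hom_run:
  assumes "coc X"
  shows "com_hom (X \<boxtimes>\<^sub>c unit_com) X (run (ob X))"
  using com_hom_tcmp[OF _ com_hom_brd[of X unit_com] com_hom_lun[of X]] assms by (simp add: lun_brd)

text \<open>This is \<open>asc_mid_mid\<close> with every interchange moved to the opposite side,
  which works because the inverse of a \<open>mid\<close> is again a \<open>mid\<close>;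
  \<open>?w\<close> is the inverse inserted for that purpose.\<close>

lemma asc_asc_mid:
  assumes "P \<in> Obj M" "Q \<in> Obj M" "R \<in> Obj M" "X \<in> Obj M" "Y \<in> Obj M" "Z \<in> Obj M"
  shows "(asc P Q R \<boxtimes> asc X Y Z) \<bullet> mid (P \<otimes>\<^sub>o Q) (X \<otimes>\<^sub>o Y) R Z \<bullet> (mid P X Q Y \<boxtimes> ide (R \<otimes>\<^sub>o Z))
    = mid P X (Q \<otimes>\<^sub>o R) (Y \<otimes>\<^sub>o Z) \<bullet> (ide (P \<otimes>\<^sub>o X) \<boxtimes> mid Q Y R Z)
      \<bullet> asc (P \<otimes>\<^sub>o X) (Q \<otimes>\<^sub>o Y) (R \<otimes>\<^sub>o Z)" (is "?l = ?r")
proof -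
  let ?w = "mid (P \<otimes>\<^sub>o Q) (X \<otimes>\<^sub>o Y) R Z \<bullet> (mid P X Q Y \<boxtimes> ide (R \<otimes>\<^sub>o Z))"
  have "?r = mid P X (Q \<otimes>\<^sub>o R) (Y \<otimes>\<^sub>o Z) \<bullet> (ide (P \<otimes>\<^sub>o X) \<boxtimes> mid Q Y R Z)
    \<bullet> (asc (P \<otimes>\<^sub>o X) (Q \<otimes>\<^sub>o Y) (R \<otimes>\<^sub>o Z) \<bullet> (mid P Q X Y \<boxtimes> ide (R \<otimes>\<^sub>o Z))
      \<bullet> mid (P \<otimes>\<^sub>o Q) R (X \<otimes>\<^sub>o Y) Z) \<bullet> ?w"
    using assms by (simp add: mid_mid[THEN tcmp_tail] tten_tcmp)
  also have "\<dots> = ?l"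
    using assms by (simp add: asc_mid_mid) (simp add: tten_tcmp mid_mid[THEN tcmp_tail])
  finally show ?thesis ..
qed

lemma com_hom_asc:
  assumes X: "coc X" and Y: "coc Y" and Z: "coc Z"
  shows "com_hom ((X \<boxtimes>\<^sub>c Y) \<boxtimes>\<^sub>c Z) (X \<boxtimes>\<^sub>c (Y \<boxtimes>\<^sub>c Z)) (asc (ob X) (ob Y) (ob Z))"
proof -
  let ?A = "ob X" and ?B = "ob Y" and ?D = "ob Z"
  have "cm (X \<boxtimes>\<^sub>c (Y \<boxtimes>\<^sub>c Z)) \<bullet> asc ?A ?B ?D
      = mid ?A ?A (?B \<otimes>\<^sub>o ?D) (?B \<otimes>\<^sub>o ?D) \<bullet> (ide (?A \<otimes>\<^sub>o ?A) \<boxtimes> mid ?B ?B ?D ?D)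
        \<bullet> (cm X \<boxtimes> (cm Y \<boxtimes> cm Z)) \<bullet> asc ?A ?B ?D"
    using X Y Z by (simp add: ten_com_def tten_tcmp)
  also have "\<dots> = (mid ?A ?A (?B \<otimes>\<^sub>o ?D) (?B \<otimes>\<^sub>o ?D) \<bullet> (ide (?A \<otimes>\<^sub>o ?A) \<boxtimes> mid ?B ?B ?D ?D)
        \<bullet> asc (?A \<otimes>\<^sub>o ?A) (?B \<otimes>\<^sub>o ?B) (?D \<otimes>\<^sub>o ?D)) \<bullet> ((cm X \<boxtimes> cm Y) \<boxtimes> cm Z)"
    using X Y Z by (simp add: nat_simps)
  also have "\<dots> = (asc ?A ?B ?D \<boxtimes> asc ?A ?B ?D) \<bullet> cm ((X \<boxtimes>\<^sub>c Y) \<boxtimes>\<^sub>c Z)"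
    unfolding asc_asc_mid[OF coc_simps(1) coc_simps(1) coc_simps(1) coc_simps(1) coc_simps(1) coc_simps(1),
        OF X Y Z X Y Z, symmetric]
    using X Y Z by (simp add: ten_com_def) (simp add: tten_tcmp)
  finally have "cm (X \<boxtimes>\<^sub>c (Y \<boxtimes>\<^sub>c Z)) \<bullet> asc ?A ?B ?D
    = (asc ?A ?B ?D \<boxtimes> asc ?A ?B ?D) \<bullet> cm ((X \<boxtimes>\<^sub>c Y) \<boxtimes>\<^sub>c Z)" .
  moreover have "cu (X \<boxtimes>\<^sub>c (Y \<boxtimes>\<^sub>c Z)) \<bullet> asc ?A ?B ?D = cu ((X \<boxtimes>\<^sub>c Y) \<boxtimes>\<^sub>c Z)"
  proof -
    have "cu (X \<boxtimes>\<^sub>c (Y \<boxtimes>\<^sub>c Z)) \<bullet> asc ?A ?B ?D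
        = lun \<one>\<^sub>o \<bullet> (ide \<one>\<^sub>o \<boxtimes> lun \<one>\<^sub>o) \<bullet> (cu X \<boxtimes> (cu Y \<boxtimes> cu Z)) \<bullet> asc ?A ?B ?D"
      using X Y Z by (simp add: ten_com_def tten_tcmp)
    also have "\<dots> = lun \<one>\<^sub>o \<bullet> ((ide \<one>\<^sub>o \<boxtimes> lun \<one>\<^sub>o) \<bullet> asc \<one>\<^sub>o \<one>\<^sub>o \<one>\<^sub>o) \<bullet> ((cu X \<boxtimes> cu Y) \<boxtimes> cu Z)"
      using X Y Z asc_nat[of "cu X" "cu Y" "cu Z"] by simp
    also have "\<dots> = cu ((X \<boxtimes>\<^sub>c Y) \<boxtimes>\<^sub>c Z)"
      using X Y Z by (simp add: asc_triangle ten_com_def tten_tcmp flip: lun_unit)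
    finally show ?thesis .
  qed
  ultimately show ?thesis
    using X Y Z by (simp add: com_hom_def)
qed

section \<open>Tensor products as categorical products\<close>

definition fst_com :: "('o, 'm) comonoid \<Rightarrow> ('o, 'm) comonoid \<Rightarrow> ('o, 'm) tarrow" where
  "fst_com X Y = run (ob X) \<bullet> (ide (ob X) \<boxtimes> cu Y)"

definition snd_com :: "('o, 'm) comonoid \<Rightarrow> ('o, 'm) comonoid \<Rightarrow> ('o, 'm) tarrow" where
  "snd_com X Y = lun (ob Y) \<bullet> (cu X \<boxtimes> ide (ob Y))"

lemma com_hom_fst:
  assumes "coc X" "coc Y"
  shows "com_hom (X \<boxtimes>\<^sub>c Y) X (fst_com X Y)"
  unfolding fst_com_def
  by (rule com_hom_tcmp[OF _ com_hom_tten[where X = X and X' = Y and Y = X and Y' = unit_com]])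
    (use assms in \<open>simp_all add: com_hom_ide com_hom_cu com_hom_run\<close>)

lemma com_hom_snd:
  assumes "coc X" "coc Y"
  shows "com_hom (X \<boxtimes>\<^sub>c Y) Y (snd_com X Y)"
  unfolding snd_com_def
  by (rule com_hom_tcmp[OF _ com_hom_tten[where X = X and X' = Y and Y = unit_com and Y' = Y]])
    (use assms in \<open>simp_all add: com_hom_ide com_hom_cu com_hom_lun\<close>)

lemma com_hom_pair:
  assumes "coc Z" "coc X" "coc Y" "com_hom Z X f" "com_hom Z Y g"
  shows "com_hom Z (X \<boxtimes>\<^sub>c Y) ((f \<boxtimes> g) \<bullet> cm Z)"
  by (rule com_hom_tcmp[OF _ com_hom_cm com_hom_tten]) (use assms in simp_all)

lemma fst_pair:
  assumes "coc Z" "coc X" "coc Y" and f: "com_hom Z X f" and g: "com_hom Z Y g"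
  shows "fst_com X Y \<bullet> (f \<boxtimes> g) \<bullet> cm Z = f"
proof -
  have "fst_com X Y \<bullet> (f \<boxtimes> g) \<bullet> cm Z = run (ob X) \<bullet> (f \<boxtimes> ide \<one>\<^sub>o) \<bullet> (ide (ob Z) \<boxtimes> cu Z) \<bullet> cm Z"
    using assms com_homD[OF f] com_homD[OF g] by (simp add: fst_com_def tten_tcmp)
  also have "\<dots> = f"
    using assms com_homD[OF f] by (simp add: nat_simps counit_right)
  finally show ?thesis .
qed

lemma snd_pair:
  assumes "coc Z" "coc X" "coc Y" and f: "com_hom Z X f" and g: "com_hom Z Y g"
  shows "snd_com X Y \<bullet> (f \<boxtimes> g) \<bullet> cm Z = g"
proof -
  have "snd_com X Y \<bullet> (f \<boxtimes> g) \<bullet> cm Z = lun (ob Y) \<bullet> (ide \<one>\<^sub>o \<boxtimes> g) \<bullet> (cu Z \<boxtimes> ide (ob Z)) \<bullet> cm Z"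
    using assms com_homD[OF f] com_homD[OF g] by (simp add: snd_com_def tten_tcmp)
  also have "\<dots> = g"
    using assms com_homD[OF g] by (simp add: nat_simps counit_left)
  finally show ?thesis .
qed

text \<open>The projections discard \<open>Y\<close> in the first copy of the pair and
  \<open>X\<close> in the second. Pulled back through \<open>mid\<close>, which is an identity when
  its middle factors are units, this leaves one counit law for \<open>X\<close> and one for
  \<open>Y\<close>.\<close>

lemma pair_fst_snd:
  assumes X: "coc X" and Y: "coc Y"
  shows "(fst_com X Y \<boxtimes> snd_com X Y) \<bullet> cm (X \<boxtimes>\<^sub>c Y) = ide (ob X \<otimes>\<^sub>o ob Y)"
proof -
  let ?A = "ob X" and ?B = "ob Y"
  have "((ide ?A \<boxtimes> cu Y) \<boxtimes> (cu X \<boxtimes> ide ?B)) \<bullet> mid ?A ?A ?B ?B = (ide ?A \<boxtimes> cu X) \<boxtimes> (cu Y \<boxtimes> ide ?B)"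
    using X Y mid_nat[of "ide ?A" "cu X" "cu Y" "ide ?B" ?A "\<one>\<^sub>o" "\<one>\<^sub>o" ?B]
    by (simp add: mid_unit_unit)
  note mid = this[THEN tcmp_tail]
  have "(fst_com X Y \<boxtimes> snd_com X Y) \<bullet> cm (X \<boxtimes>\<^sub>c Y)
     = (run ?A \<boxtimes> lun ?B) \<bullet> ((ide ?A \<boxtimes> cu Y) \<boxtimes> (cu X \<boxtimes> ide ?B)) \<bullet> mid ?A ?A ?B ?B \<bullet> (cm X \<boxtimes> cm Y)"
    using X Y by (simp add: fst_com_def snd_com_def ten_com_def tten_tcmp)
  also have "\<dots> = ide (?A \<otimes>\<^sub>o ?B)"
    using X Y unfolding mid by (simp add: tten_tcmp counit_left counit_right)
  finally show ?thesis .
qed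

text \<open>Because \<open>h\<close> commutes with comultiplication, it can be moved to the right
  end, which leaves the case of the identity, \<open>pair_fst_snd\<close>.\<close>

lemma pair_unique:
  assumes Z: "coc Z" and X: "coc X" and Y: "coc Y" and h: "com_hom Z (X \<boxtimes>\<^sub>c Y) h"
  shows "((fst_com X Y \<bullet> h) \<boxtimes> (snd_com X Y \<bullet> h)) \<bullet> cm Z = h"
proof -
  have "((fst_com X Y \<bullet> h) \<boxtimes> (snd_com X Y \<bullet> h)) \<bullet> cm Z
      = (fst_com X Y \<boxtimes> snd_com X Y) \<bullet> (h \<boxtimes> h) \<bullet> cm Z"
    using com_homD[OF com_hom_fst[OF X Y]] com_homD[OF com_hom_snd[OF X Y]] com_homD[OF h]
    by (simp add: tten_tcmp)
  also have "\<dots> = ((fst_com X Y \<boxtimes> snd_com X Y) \<bullet> cm (X \<boxtimes>\<^sub>c Y)) \<bullet> h"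
    by (simp add: com_homD(4)[OF h])
  also have "\<dots> = h"
    unfolding pair_fst_snd[OF X Y] using com_homD[OF h] by simp
  finally show ?thesis .
qed

section \<open>Equalizers and monos among typed arrows\<close>

definition teq :: "('o, 'm) tarrow \<Rightarrow> ('o, 'm) tarrow \<Rightarrow> ('o, 'm) tarrow \<Rightarrow> bool" where
  "teq f g e \<longleftrightarrow> arr f \<and> arr g \<and> arr e \<and> dm g = dm f \<and> cd g = cd f \<and> cd e = dm f \<and>
     is_equalizer M (dm f) (cd f) (und f) (und g) (dm e) (und e)"

definition tmono :: "('o, 'm) tarrow \<Rightarrow> bool" where
  "tmono e \<longleftrightarrow> arr e \<and> (\<forall>k k'. arr k \<and> arr k' \<and> cd k = dm e \<and> cd k' = dm e \<and> e \<bullet> k = e \<bullet> k' \<longrightarrow> k = k')"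

lemma tmonoD: "\<lbrakk>tmono e; e \<bullet> k = e \<bullet> k'; arr k; arr k'; cd k = dm e; cd k' = dm e\<rbrakk> \<Longrightarrow> k = k'"
  unfolding tmono_def by blast

lemma tmono_tcmp:
  assumes e: "tmono e" and f: "tmono f" and ef: "dm e = cd f"
  shows "tmono (e \<bullet> f)"
  unfolding tmono_def
proof (intro conjI allI impI)
  have [simp]: "arr e" "arr f"
    using e f unfolding tmono_def by blast+
  show "arr (e \<bullet> f)"
    using ef by simp
  fix k k'
  assume *: "arr k \<and> arr k' \<and> cd k = dm (e \<bullet> f) \<and> cd k' = dm (e \<bullet> f) \<and> (e \<bullet> f) \<bullet> k = (e \<bullet> f) \<bullet> k'"
  then have "f \<bullet> k = f \<bullet> k'"
    by - (rule tmonoD[OF e], simp_all add: ef)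
  with * show "k = k'"
    by - (rule tmonoD[OF f], simp_all add: ef)
qed

lemma teqD:
  assumes "teq f g e"
  shows "arr f" "arr g" "arr e" "dm g = dm f" "cd g = cd f" "cd e = dm f" "f \<bullet> e = g \<bullet> e"
  using assms by (auto simp: teq_def is_equalizer_def intro!: arr_eqI)

lemma teq_factor:
  assumes "teq f g e" "arr h" "cd h = dm f" "f \<bullet> h = g \<bullet> h"
  obtains k where "arr k" "dm k = dm h" "cd k = dm e" "e \<bullet> k = h"
proof -
  note eq = teqD[OF assms(1)]
  have "und f \<cdot> und h = und g \<cdot> und h"
    using arg_cong[OF assms(4), of und] assms(2,3) eq by simp
  then obtain k where "k \<in> Hom M (dm h) (dm e)" "und e \<cdot> k = und h"
    using assms arr_und[OF assms(2)] unfolding teq_def is_equalizer_def by metis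
  then have "arr (Arrow (dm h) k (dm e))" "e \<bullet> Arrow (dm h) k (dm e) = h"
    using assms eq by (auto intro!: arr_eqI)
  then show thesis
    by (intro that[of "Arrow (dm h) k (dm e)"]) simp_all
qed

lemma teq_tmono:
  assumes "teq f g e"
  shows "tmono e"
  unfolding tmono_def
proof (intro conjI allI impI)
  fix k k'
  assume *: "arr k \<and> arr k' \<and> cd k = dm e \<and> cd k' = dm e \<and> e \<bullet> k = e \<bullet> k'"
  note eq = teqD[OF assms]
  from * have dm: "dm k = dm k'" and "und e \<cdot> und k = und e \<cdot> und k'"
    using eq(3) tcmp_simps by metis+
  moreover have "und k \<in> Hom M (dm k) (dm e)" "und k' \<in> Hom M (dm k) (dm e)"
    using * arr_und dm by metis+
  moreover have "und e \<cdot> und k \<in> Hom M (dm k) (dm f)"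
    using arr_und[of "e \<bullet> k"] *[THEN conjunct1] conjunct1[OF *[THEN conjunct2, THEN conjunct2]] eq by simp
  moreover have "und f \<cdot> und e \<cdot> und k = und g \<cdot> und e \<cdot> und k"
    using arg_cong[OF eq(7)[THEN tcmp_tail, of k], of und] *[THEN conjunct1]
      conjunct1[OF *[THEN conjunct2, THEN conjunct2]] eq by simp
  ultimately have "und k = und k'"
    using assms unfolding teq_def is_equalizer_def by metis
  with * dm show "k = k'"
    by (intro arr_eqI) simp_all
qed (use teqD[OF assms] in simp)

end

section \<open>Equalizers of cocommutative comonoids\<close>

locale tensor_preserves_equalizers = symmetric_monoidal_category M
  for M :: "('o, 'm, 'z) sm_category_scheme" (structure) +
  assumes has_equalizers: "has_equalizers M"
    and preserves_left: "X \<in> Obj M \<Longrightarrow>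
      preserves_equalizers M M (\<lambda>A. X \<otimes>\<^sub>o A) (\<lambda>f. idt M X \<otimes>\<^sub>m f)"
    and preserves_right: "X \<in> Obj M \<Longrightarrow>
      preserves_equalizers M M (\<lambda>A. A \<otimes>\<^sub>o X) (\<lambda>f. f \<otimes>\<^sub>m idt M X)"
begin

lemma teq_exists:
  assumes "arr f" "arr g" "dm g = dm f" "cd g = cd f"
  obtains e where "teq f g e"
proof -
  obtain E e where e: "is_equalizer M (dm f) (cd f) (und f) (und g) E e"
    using has_equalizers assms arr_und arr_Obj unfolding has_equalizers_def by metis
  then have "teq f g (Arrow E e (dm f))"
    using assms by (auto simp: teq_def is_equalizer_def)
  then show thesis
    by (rule that)
qed

lemma teq_left: "\<lbrakk>teq f g e; X \<in> Obj M\<rbrakk> \<Longrightarrow> teq (ide X \<boxtimes> f) (ide X \<boxtimes> g) (ide X \<boxtimes> e)"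
  using preserves_left unfolding teq_def preserves_equalizers_def by simp

lemma teq_right: "\<lbrakk>teq f g e; X \<in> Obj M\<rbrakk> \<Longrightarrow> teq (f \<boxtimes> ide X) (g \<boxtimes> ide X) (e \<boxtimes> ide X)"
  using preserves_right unfolding teq_def preserves_equalizers_def by simp

text \<open>The equalizer in \<open>M\<close> of \<open>x \<mapsto> f(x\<^sub>1) \<otimes> x\<^sub>2\<close> and \<open>x \<mapsto> g(x\<^sub>1) \<otimes> x\<^sub>2\<close>
  is a subcomonoid. That the comultiplication restricts to it is checked one tensor factor
  at a time.\<close>

lemma coc_equalizer:
  assumes X: "coc X" and Y: "coc Y" and f: "com_hom X Y f" and g: "com_hom X Y g"
  obtains Z e where "coc Z" "com_hom Z X e" "f \<bullet> e = g \<bullet> e" "tmono e"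
    "\<And>W h. \<lbrakk>coc W; com_hom W X h; f \<bullet> h = g \<bullet> h\<rbrakk> \<Longrightarrow> \<exists>k. com_hom W Z k \<and> e \<bullet> k = h"
proof -
  let ?A = "ob X" and ?B = "ob Y"
  define \<phi> where "\<phi> p = (p \<boxtimes> ide ?A) \<bullet> cm X" for p
  note fD = com_homD[OF f] and gD = com_homD[OF g]
  have \<phi>_simps [simp]: "arr (\<phi> p)" "dm (\<phi> p) = ?A" "cd (\<phi> p) = ?B \<otimes>\<^sub>o ?A" if "com_hom X Y p" for p
    using X com_homD[OF that] by (simp_all add: \<phi>_def)
  obtain e where e: "teq (\<phi> f) (\<phi> g) e"
    using teq_exists[of "\<phi> f" "\<phi> g"] f g by auto
  define E where "E = dm e"
  have [simp]: "arr e" "dm e = E" "cd e = ?A" "E \<in> Obj M"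
    using teqD(3,6)[OF e] f arr_Obj by (auto simp: E_def)
  have \<phi>e: "\<phi> f \<bullet> e = \<phi> g \<bullet> e"
    by (rule teqD(7)[OF e])
  \<comment> \<open>Facts 1 and 2: comultiplying and then applying \<phi> to either factor depends
    on \<open>p\<close> only through \<open>\<phi> p\<close>, so \<open>cm X \<bullet> e\<close>
    cannot tell \<open>f\<close> from \<open>g\<close> in either factor. Fact 1, for the second
    factor, uses cocommutativity through \<open>swp_cm\<close>; fact 2 uses coassociativity.\<close>
  have 1: "(ide ?A \<boxtimes> \<phi> p) \<bullet> cm X = swp ?B ?A ?A \<bullet> (ide ?B \<boxtimes> cm X) \<bullet> \<phi> p" if "com_hom X Y p" for p
  proof -
    note pD = com_homD[OF that]
    have "(ide ?A \<boxtimes> \<phi> p) \<bullet> cm X = (ide ?A \<boxtimes> (p \<boxtimes> ide ?A)) \<bullet> swp ?A ?A ?A \<bullet> (ide ?A \<boxtimes> cm X) \<bullet> cm X"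
      using X pD by (simp add: \<phi>_def whisker swp_cm)
    also have "\<dots> = swp ?B ?A ?A \<bullet> (p \<boxtimes> ide (?A \<otimes>\<^sub>o ?A)) \<bullet> (ide ?A \<boxtimes> cm X) \<bullet> cm X"
      using X Y pD by (simp add: swp_nat_ide[THEN tcmp_tail])
    also have "\<dots> = swp ?B ?A ?A \<bullet> (ide ?B \<boxtimes> cm X) \<bullet> \<phi> p"
      using X Y pD by (simp add: \<phi>_def tten_tcmp)
    finally show ?thesis .
  qed
  have 2: "(\<phi> p \<boxtimes> ide ?A) \<bullet> cm X = csa ?B ?A ?A \<bullet> (ide ?B \<boxtimes> cm X) \<bullet> \<phi> p" if "com_hom X Y p" for p
  proof -
    note pD = com_homD[OF that]
    have "(\<phi> p \<boxtimes> ide ?A) \<bullet> cm X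
        = ((p \<boxtimes> ide ?A) \<boxtimes> ide ?A) \<bullet> csa ?A ?A ?A \<bullet> asc ?A ?A ?A \<bullet> (cm X \<boxtimes> ide ?A) \<bullet> cm X"
      using X pD by (simp add: \<phi>_def whisker)
    also have "\<dots> = csa ?B ?A ?A \<bullet> (p \<boxtimes> ide (?A \<otimes>\<^sub>o ?A)) \<bullet> (ide ?A \<boxtimes> cm X) \<bullet> cm X"
      using X Y pD by (simp add: coassoc nat_simps del: inverse_tails)
    also have "\<dots> = csa ?B ?A ?A \<bullet> (ide ?B \<boxtimes> cm X) \<bullet> \<phi> p"
      using X Y pD by (simp add: \<phi>_def tten_tcmp)
    finally show ?thesis .
  qed
  have "(ide ?A \<boxtimes> \<phi> f) \<bullet> cm X \<bullet> e = (ide ?A \<boxtimes> \<phi> g) \<bullet> cm X \<bullet> e"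
    using f g by (simp add: 1[THEN tcmp_tail] \<phi>e)
  \<comment> \<open>First the second factor: \<open>ide ?A \<boxtimes> e\<close> is an equalizer, so
    \<open>cm X \<bullet> e\<close> factors through it.\<close>
  from teq_factor[OF teq_left[OF e] _ _ this] obtain \<delta> where \<delta> [simp]: "arr \<delta>" "dm \<delta> = E" "cd \<delta> = ?A \<otimes>\<^sub>o E"
    and e\<delta>: "(ide ?A \<boxtimes> e) \<bullet> \<delta> = cm X \<bullet> e"
    using X f by auto
  \<comment> \<open>To restrict the first factor too, \<delta> has to equalize the two versions of
    \<phi> there. This is tested after the mono
    \<open>ide (?B \<otimes>\<^sub>o ?A) \<boxtimes> e\<close>, where \<delta> turns back into
    \<open>cm X \<bullet> e\<close>.\<close>
  have 3: "(ide (?B \<otimes>\<^sub>o ?A) \<boxtimes> e) \<bullet> (\<phi> p \<boxtimes> ide E) \<bullet> \<delta> = csa ?B ?A ?A \<bullet> (ide ?B \<boxtimes> cm X) \<bullet> \<phi> p \<bullet> e"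
    if "com_hom X Y p" for p
  proof -
    have "(ide (?B \<otimes>\<^sub>o ?A) \<boxtimes> e) \<bullet> (\<phi> p \<boxtimes> ide E) \<bullet> \<delta> = (\<phi> p \<boxtimes> ide ?A) \<bullet> (ide ?A \<boxtimes> e) \<bullet> \<delta>"
      using X Y that by (simp add: tten_tcmp)
    then show ?thesis
      using that by (simp add: e\<delta> 2[THEN tcmp_tail])
  qed
  have "(\<phi> f \<boxtimes> ide E) \<bullet> \<delta> = (\<phi> g \<boxtimes> ide E) \<bullet> \<delta>"
    by (rule tmonoD[OF teq_tmono[OF teq_left[OF e, of "?B \<otimes>\<^sub>o ?A"]]])
      (use X Y f g in \<open>simp_all add: 3 \<phi>e\<close>)
  from teq_factor[OF teq_right[OF e] _ _ this] obtain d where d [simp]: "arr d" "dm d = E" "cd d = E \<otimes>\<^sub>o E" and ed: "(e \<boxtimes> ide E) \<bullet> d = \<delta>"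
    using X f by auto
  have eed: "(e \<boxtimes> e) \<bullet> d = cm X \<bullet> e"
  proof -
    have "(e \<boxtimes> e) \<bullet> d = (ide ?A \<boxtimes> e) \<bullet> (e \<boxtimes> ide E) \<bullet> d"
      using X by (simp add: tten_tcmp)
    then show ?thesis
      by (simp add: ed e\<delta>)
  qed
  have mono: "tmono e"
    by (rule teq_tmono[OF e])
  \<comment> \<open>Tensor products of copies of \<open>e\<close> are composites of one-sided
    tensors with \<open>e\<close>, each of which is an equalizer and hence monic.\<close>
  have mono2: "tmono (ide A \<boxtimes> (e \<boxtimes> e))" if "A \<in> Obj M" for A
  proof -
    have "tmono ((ide A \<boxtimes> (ide ?A \<boxtimes> e)) \<bullet> (ide A \<boxtimes> (e \<boxtimes> ide E)))"
      by (rule tmono_tcmp[OF teq_tmono[OF teq_left[OF teq_left[OF e]]]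
            teq_tmono[OF teq_left[OF teq_right[OF e]]]]) (use X that in simp_all)
    then show ?thesis
      using X that by (simp add: tten_tcmp)
  qed
  have mono2': "tmono (e \<boxtimes> e)"
  proof -
    have "tmono ((ide ?A \<boxtimes> e) \<bullet> (e \<boxtimes> ide E))"
      by (rule tmono_tcmp[OF teq_tmono[OF teq_left[OF e]] teq_tmono[OF teq_right[OF e]]])
        (use X in simp_all)
    then show ?thesis
      using X by (simp add: tten_tcmp)
  qed
  have mono3: "tmono (e \<boxtimes> (e \<boxtimes> e))"
  proof -
    have "tmono ((ide ?A \<boxtimes> (e \<boxtimes> e)) \<bullet> (e \<boxtimes> ide (E \<otimes>\<^sub>o E)))"
      by (rule tmono_tcmp[OF mono2 teq_tmono[OF teq_right[OF e]]]) (use X in simp_all)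
    then show ?thesis
      using X by (simp add: tten_tcmp)
  qed
  define Z where "Z = \<lparr>ob = E, cm = d, cu = cu X \<bullet> e\<rparr>"
  have Z [simp]: "coc Z"
  proof (rule cocI)
    have "(e \<boxtimes> (e \<boxtimes> e)) \<bullet> asc E E E \<bullet> (d \<boxtimes> ide E) \<bullet> d = asc ?A ?A ?A \<bullet> ((e \<boxtimes> e) \<boxtimes> e) \<bullet> (d \<boxtimes> ide E) \<bullet> d"
      using X by (simp add: nat_simps)
    also have "\<dots> = asc ?A ?A ?A \<bullet> (cm X \<boxtimes> ide ?A) \<bullet> (e \<boxtimes> e) \<bullet> d"
      using X by (simp add: tten_tcmp(2)) (simp add: eed)
    also have "\<dots> = (ide ?A \<boxtimes> cm X) \<bullet> cm X \<bullet> e"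
      using X by (simp add: eed coassoc[THEN tcmp_tail3])
    also have "\<dots> = (e \<boxtimes> (e \<boxtimes> e)) \<bullet> (ide E \<boxtimes> d) \<bullet> d"
      using X by (simp add: tten_tcmp(2) eed flip: eed)
    finally have "asc E E E \<bullet> (d \<boxtimes> ide E) \<bullet> d = (ide E \<boxtimes> d) \<bullet> d"
      by (rule tmonoD[OF mono3]) simp_all
    then show "asc (ob Z) (ob Z) (ob Z) \<bullet> (cm Z \<boxtimes> ide (ob Z)) \<bullet> cm Z = (ide (ob Z) \<boxtimes> cm Z) \<bullet> cm Z"
      by (simp add: Z_def)
    have "e \<bullet> lun E \<bullet> ((cu X \<bullet> e) \<boxtimes> ide E) \<bullet> d = lun ?A \<bullet> (ide \<one>\<^sub>o \<boxtimes> e) \<bullet> ((cu X \<bullet> e) \<boxtimes> ide E) \<bullet> d"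
      using X by (simp add: nat_simps)
    also have "\<dots> = lun ?A \<bullet> (cu X \<boxtimes> ide ?A) \<bullet> (e \<boxtimes> e) \<bullet> d"
      using X by (simp add: tten_tcmp(2))
    also have "\<dots> = e \<bullet> ide E"
      using X by (simp add: eed counit_left[THEN tcmp_tail3])
    finally have "lun E \<bullet> ((cu X \<bullet> e) \<boxtimes> ide E) \<bullet> d = ide E"
      by (rule tmonoD[OF mono]) (use X in simp_all)
    then show "lun (ob Z) \<bullet> (cu Z \<boxtimes> ide (ob Z)) \<bullet> cm Z = ide (ob Z)"
      by (simp add: Z_def)
    have "(e \<boxtimes> e) \<bullet> brd E E \<bullet> d = brd ?A ?A \<bullet> (e \<boxtimes> e) \<bullet> d"
      using X by (simp add: nat_simps)
    also have "\<dots> = (e \<boxtimes> e) \<bullet> d"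
      using X by (simp add: eed cocomm[THEN tcmp_tail])
    finally have "brd E E \<bullet> d = d"
      by (rule tmonoD[OF mono2']) (use X in simp_all)
    then show "brd (ob Z) (ob Z) \<bullet> cm Z = cm Z"
      by (simp add: Z_def)
  qed (use X in \<open>simp_all add: Z_def\<close>)
  have hom_e: "com_hom Z X e"
    by (simp add: com_hom_def Z_def eed)
  \<comment> \<open>The counit of \<open>X\<close> recovers \<open>p\<close> from
    \<open>\<phi> p\<close>, so \<open>e\<close> equalizes \<open>f\<close> and \<open>g\<close>
    themselves.\<close>
  have run_\<phi>: "run ?B \<bullet> (ide ?B \<boxtimes> cu X) \<bullet> \<phi> p = p" if "com_hom X Y p" for p
  proof -
    have "run ?B \<bullet> (ide ?B \<boxtimes> cu X) \<bullet> \<phi> p = run ?B \<bullet> (p \<boxtimes> ide \<one>\<^sub>o) \<bullet> (ide ?A \<boxtimes> cu X) \<bullet> cm X"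
      using X Y com_homD[OF that] by (simp add: \<phi>_def tten_tcmp)
    then show ?thesis
      using X Y com_homD[OF that] by (simp add: nat_simps counit_right)
  qed
  have fe: "f \<bullet> e = g \<bullet> e"
    using run_\<phi>[OF f, THEN tcmp_tail3, of e] run_\<phi>[OF g, THEN tcmp_tail3, of e] \<phi>e by simp
  show thesis
  proof (rule that[OF Z hom_e fe mono])
    fix W h
    assume W: "coc W" and h: "com_hom W X h" and fh: "f \<bullet> h = g \<bullet> h"
    note hD = com_homD[OF h]
    \<comment> \<open>Conversely, for a comonoid morphism \<open>h\<close> this composite involves
      \<open>p\<close> only as \<open>p \<bullet> h\<close>; hence \<open>h\<close> equalizes the
      two versions of \<phi> and factors through \<open>e\<close> in \<open>M\<close>.\<close>
    have "\<phi> p \<bullet> h = ((p \<bullet> h) \<boxtimes> h) \<bullet> cm W" if "com_hom X Y p" for p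
      using X Y W com_homD[OF that] hD by (simp add: \<phi>_def tten_tcmp)
    then have "\<phi> f \<bullet> h = \<phi> g \<bullet> h"
      using f g fh by simp
    from teq_factor[OF e _ _ this] obtain k where k: "arr k" "dm k = dm h" "cd k = E" "e \<bullet> k = h"
      using hD f by auto
    have "(e \<boxtimes> e) \<bullet> d \<bullet> k = (e \<boxtimes> e) \<bullet> (k \<boxtimes> k) \<bullet> cm W"
      using k hD W by (simp add: eed[THEN tcmp_tail] tten_tcmp(2))
    then have "d \<bullet> k = (k \<boxtimes> k) \<bullet> cm W"
      by (rule tmonoD[OF mono2']) (use k hD W in simp_all)
    then have "com_hom W Z k"
      using k hD by (simp add: com_hom_def Z_def)
    with k show "\<exists>k. com_hom W Z k \<and> e \<bullet> k = h"
      by blast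
  qed
qed

end

section \<open>Finite limits from products and equalizers\<close>

text \<open>\<open>K\<close> is a set of arrows stored with their indices, closed under nothing.
  Such a diagram can be built one arrow at a time, which a functor on a category does not
  allow.\<close>

definition is_family ::
  "('o, 'm, 'z) category_scheme \<Rightarrow> 'i set \<Rightarrow> ('i \<Rightarrow> 'o) \<Rightarrow> ('i \<times> 'm \<times> 'i) set \<Rightarrow> 'o \<Rightarrow> ('i \<Rightarrow> 'm) \<Rightarrow> bool"
  where
  "is_family C I F K X q \<longleftrightarrow>
     X \<in> Obj C \<and> (\<forall>i\<in>I. q i \<in> Hom C X (F i)) \<and> (\<forall>(i, f, j)\<in>K. f \<cdot>\<^bsub>C\<^esub> q i = q j)"

definition is_universal_family ::
  "('o, 'm, 'z) category_scheme \<Rightarrow> 'i set \<Rightarrow> ('i \<Rightarrow> 'o) \<Rightarrow> ('i \<times> 'm \<times> 'i) set \<Rightarrow> 'o \<Rightarrow> ('i \<Rightarrow> 'm) \<Rightarrow> bool"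
  where
  "is_universal_family C I F K L p \<longleftrightarrow>
     is_family C I F K L p \<and>
     (\<forall>X q. is_family C I F K X q \<longrightarrow> (\<exists>!h. h \<in> Hom C X L \<and> (\<forall>i\<in>I. p i \<cdot>\<^bsub>C\<^esub> h = q i)))"

context category
begin

definition is_product :: "'o \<Rightarrow> 'o \<Rightarrow> 'o \<Rightarrow> 'm \<Rightarrow> 'm \<Rightarrow> bool" where
  "is_product A B P p1 p2 \<longleftrightarrow> p1 \<in> Hom C P A \<and> p2 \<in> Hom C P B \<and>
     (\<forall>X f g. f \<in> Hom C X A \<and> g \<in> Hom C X B \<longrightarrow> (\<exists>!h. h \<in> Hom C X P \<and> p1 \<cdot> h = f \<and> p2 \<cdot> h = g))"

lemma universal_family_insert_object:
  assumes L: "is_universal_family C I F {} L p" and i: "i \<notin> I" and P: "is_product L (F i) P p1 p2"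
  shows "is_universal_family C (insert i I) F {} P (\<lambda>j. if j = i then p2 else p j \<cdot> p1)"
proof -
  let ?p = "\<lambda>j. if j = i then p2 else p j \<cdot> p1"
  have p: "\<And>j. j \<in> I \<Longrightarrow> p j \<in> Hom C L (F j)"
    and p1: "p1 \<in> Hom C P L" and p2: "p2 \<in> Hom C P (F i)"
    using L P by (auto simp: is_universal_family_def is_family_def is_product_def)
  have fam: "is_family C (insert i I) F {} P ?p"
    using p p1 p2 Hom_Obj cmp_Hom by (auto simp: is_family_def)
  have "\<exists>!h. h \<in> Hom C X P \<and> (\<forall>j\<in>insert i I. ?p j \<cdot> h = q j)"
    if q: "is_family C (insert i I) F {} X q" for X q
  proof -
    have "is_family C I F {} X q"
      using q by (auto simp: is_family_def)
    then obtain k where k: "k \<in> Hom C X L" "\<And>j. j \<in> I \<Longrightarrow> p j \<cdot> k = q j"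
      and k_unique: "\<And>k'. \<lbrakk>k' \<in> Hom C X L; \<And>j. j \<in> I \<Longrightarrow> p j \<cdot> k' = q j\<rbrakk> \<Longrightarrow> k' = k"
      using L unfolding is_universal_family_def by metis
    have "q i \<in> Hom C X (F i)"
      using q by (auto simp: is_family_def)
    then obtain h where h: "h \<in> Hom C X P" "p1 \<cdot> h = k" "p2 \<cdot> h = q i"
      and h_unique: "\<And>h'. \<lbrakk>h' \<in> Hom C X P; p1 \<cdot> h' = k; p2 \<cdot> h' = q i\<rbrakk> \<Longrightarrow> h' = h"
      using P k(1) unfolding is_product_def by metis
    have comp: "(p j \<cdot> p1) \<cdot> h' = p j \<cdot> (p1 \<cdot> h')" if "j \<in> I" "h' \<in> Hom C X P" for j h'
      using that p p1 by (intro cmp_assoc)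
    show ?thesis
    proof (rule ex1I)
      show "h \<in> Hom C X P \<and> (\<forall>j\<in>insert i I. ?p j \<cdot> h = q j)"
        using h k comp i by auto
      fix h'
      assume h': "h' \<in> Hom C X P \<and> (\<forall>j\<in>insert i I. ?p j \<cdot> h' = q j)"
      then have "p j \<cdot> (p1 \<cdot> h') = q j" if "j \<in> I" for j
        using that i comp by (metis insertI2)
      then have "p1 \<cdot> h' = k"
        using h' p1 by (intro k_unique) (auto intro: cmp_Hom)
      then show "h' = h"
        using h' by (intro h_unique) auto
    qed
  qed
  with fam show ?thesis
    by (simp add: is_universal_family_def)
qed

text \<open>A new arrow imposes the single equation \<open>f \<cdot> p i = p j\<close>, and the
  equalizer enforces exactly that.\<close>

lemma universal_family_insert_arrow:
  assumes L: "is_universal_family C I F K L p" and ij: "i \<in> I" "j \<in> I" and f: "f \<in> Hom C (F i) (F j)"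
    and K: "\<And>i' f' j'. (i', f', j') \<in> K \<Longrightarrow> i' \<in> I \<and> j' \<in> I \<and> f' \<in> Hom C (F i') (F j')"
    and E: "is_equalizer C L (F j) (f \<cdot> p i) (p j) E e"
  shows "is_universal_family C I F (insert (i, f, j) K) E (\<lambda>k. p k \<cdot> e)"
proof -
  have p: "\<And>j. j \<in> I \<Longrightarrow> p j \<in> Hom C L (F j)"
    and e: "e \<in> Hom C E L" and fe: "(f \<cdot> p i) \<cdot> e = p j \<cdot> e"
    using L E by (auto simp: is_universal_family_def is_family_def is_equalizer_def)
  have comp: "(p k \<cdot> e) \<cdot> h = p k \<cdot> (e \<cdot> h)" if "k \<in> I" "h \<in> Hom C X E" for k h X
    using cmp_assoc[OF that(2) e p[OF that(1)]] .
  have comp': "f' \<cdot> (p i' \<cdot> h) = (f' \<cdot> p i') \<cdot> h"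
    if "i' \<in> I" "f' \<in> Hom C (F i') (F j')" "h \<in> Hom C X L" for f' i' j' h X
    using cmp_assoc[OF that(3) p[OF that(1)] that(2)] by simp
  have K_p: "f' \<cdot> p i' = p j'" if "(i', f', j') \<in> K" for i' f' j'
    using L that by (auto simp: is_universal_family_def is_family_def)
  have fam: "is_family C I F (insert (i, f, j) K) E (\<lambda>k. p k \<cdot> e)"
    unfolding is_family_def
  proof (intro conjI ballI)
    show "E \<in> Obj C"
      using e Hom_Obj by blast
    show "p k \<cdot> e \<in> Hom C E (F k)" if "k \<in> I" for k
      using e p[OF that] by (rule cmp_Hom)
    show "case t of (i', f', j') \<Rightarrow> f' \<cdot> p i' \<cdot> e = p j' \<cdot> e" if "t \<in> insert (i, f, j) K" for t
      using that K comp'[OF _ _ e] K_p f ij fe by auto metis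
  qed
  have "\<exists>!h. h \<in> Hom C X E \<and> (\<forall>k\<in>I. (p k \<cdot> e) \<cdot> h = q k)"
    if q: "is_family C I F (insert (i, f, j) K) X q" for X q
  proof -
    have "is_family C I F K X q"
      using q by (auto simp: is_family_def)
    then obtain k where k: "k \<in> Hom C X L" "\<And>j. j \<in> I \<Longrightarrow> p j \<cdot> k = q j"
      and k_unique: "\<And>k'. \<lbrakk>k' \<in> Hom C X L; \<And>j. j \<in> I \<Longrightarrow> p j \<cdot> k' = q j\<rbrakk> \<Longrightarrow> k' = k"
      using L unfolding is_universal_family_def by metis
    have "(f \<cdot> p i) \<cdot> k = p j \<cdot> k"
      using q ij k(2) comp'[OF ij(1) f k(1)] by (auto simp: is_family_def)
    then obtain h where h: "h \<in> Hom C X E" "e \<cdot> h = k"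
      and h_unique: "\<And>h'. \<lbrakk>h' \<in> Hom C X E; e \<cdot> h' = k\<rbrakk> \<Longrightarrow> h' = h"
      using E k(1) unfolding is_equalizer_def by metis
    show ?thesis
    proof (rule ex1I)
      show "h \<in> Hom C X E \<and> (\<forall>k\<in>I. (p k \<cdot> e) \<cdot> h = q k)"
        using h k comp by auto
      fix h'
      assume h': "h' \<in> Hom C X E \<and> (\<forall>k\<in>I. (p k \<cdot> e) \<cdot> h' = q k)"
      then have "e \<cdot> h' = k"
        using e comp by (intro k_unique) (auto intro: cmp_Hom)
      then show "h' = h"
        using h' by (intro h_unique) auto
    qed
  qed
  with fam show ?thesis
    by (simp add: is_universal_family_def)
qed

text \<open>The inner induction on \<open>I\<close>, with no arrows, forms the product of all
  objects starting from the terminal one; the outer induction on \<open>K\<close> then imposes the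
  arrows one by one.\<close>

lemma universal_family_exists:
  assumes terminal: "T \<in> Obj C" "\<And>X. X \<in> Obj C \<Longrightarrow> \<exists>!h. h \<in> Hom C X T"
    and products: "\<And>A B. \<lbrakk>A \<in> Obj C; B \<in> Obj C\<rbrakk> \<Longrightarrow> \<exists>P p1 p2. is_product A B P p1 p2"
    and equalizers: "has_equalizers C"
    and "finite I" "\<And>i. i \<in> I \<Longrightarrow> F i \<in> Obj C"
    and "finite K" "\<And>i f j. (i, f, j) \<in> K \<Longrightarrow> i \<in> I \<and> j \<in> I \<and> f \<in> Hom C (F i) (F j)"
  shows "\<exists>L p. is_universal_family C I F K L p"
  using assms(7,8)
proof (induction K rule: finite_induct)
  case empty
  show ?case
    using assms(5,6)
  proof (induction I rule: finite_induct)
    case empty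
    show ?case
      using terminal by (auto simp: is_universal_family_def is_family_def)
  next
    case (insert i I)
    then obtain L p where L: "is_universal_family C I F {} L p"
      by auto
    then have "L \<in> Obj C"
      by (simp add: is_universal_family_def is_family_def)
    with insert.prems obtain P p1 p2 where "is_product L (F i) P p1 p2"
      using products by blast
    from universal_family_insert_object[OF L insert.hyps(2) this] show ?case
      by blast
  qed
next
  case (insert t K)
  obtain i f j where t: "t = (i, f, j)"
    by (metis prod_cases3)
  obtain L p where L: "is_universal_family C I F K L p"
    using insert by blast
  have ij: "i \<in> I" "j \<in> I" and f: "f \<in> Hom C (F i) (F j)"
    using insert.prems[of i f j] t by auto
  have p: "p k \<in> Hom C L (F k)" if "k \<in> I" for k
    using L that by (auto simp: is_universal_family_def is_family_def)
  have "f \<cdot> p i \<in> Hom C L (F j)"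
    using p[OF ij(1)] f by (rule cmp_Hom)
  then obtain E e where E: "is_equalizer C L (F j) (f \<cdot> p i) (p j) E e"
    using equalizers p[OF ij(2)] Hom_Obj unfolding has_equalizers_def by metis
  have "i' \<in> I \<and> j' \<in> I \<and> f' \<in> Hom C (F i') (F j')" if "(i', f', j') \<in> K" for i' f' j'
    using that insert.prems by blast
  from universal_family_insert_arrow[OF L ij f this E] show ?case
    unfolding t by blast
qed

end

section \<open>The category of cocommutative comonoids\<close>

context symmetric_monoidal_category
begin

definition coc_category :: "(('o, 'm) comonoid, ('o, 'm) tarrow) category" where
  "coc_category =
     \<lparr>Obj = {X. coc X}, Hom = (\<lambda>X Y. {f. coc X \<and> coc Y \<and> com_hom X Y f}),
      cmp = (\<bullet>), idt = (\<lambda>X. ide (ob X))\<rparr>"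

lemma coc_category_simps [simp]:
  "Obj coc_category = {X. coc X}" "Hom coc_category X Y = {f. coc X \<and> coc Y \<and> com_hom X Y f}"
  "cmp coc_category = (\<bullet>)" "idt coc_category X = ide (ob X)"
  by (simp_all add: coc_category_def)

lemma category_coc_category: "category coc_category"
  by unfold_locales (auto intro: com_hom_ide com_hom_tcmp, auto simp: com_hom_def)

lemma coc_category_terminal:
  assumes X: "coc X"
  shows "\<exists>!h. h \<in> Hom coc_category X unit_com"
proof (rule ex1I)
  show "cu X \<in> Hom coc_category X unit_com"
    using X com_hom_cu by simp
  fix h
  assume "h \<in> Hom coc_category X unit_com"
  then show "h = cu X"
    using com_homD[of X unit_com h] by (simp add: unit_com_def)
qed

lemma coc_category_product:
  assumes X: "coc X" and Y: "coc Y"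
  shows "category.is_product coc_category X Y (X \<boxtimes>\<^sub>c Y) (fst_com X Y) (snd_com X Y)"
  unfolding category.is_product_def[OF category_coc_category]
proof (intro conjI allI impI)
  fix Z f g
  assume "f \<in> Hom coc_category Z X \<and> g \<in> Hom coc_category Z Y"
  then have Z: "coc Z" and f: "com_hom Z X f" and g: "com_hom Z Y g"
    by simp_all
  show "\<exists>!h. h \<in> Hom coc_category Z (X \<boxtimes>\<^sub>c Y)
      \<and> fst_com X Y \<cdot>\<^bsub>coc_category\<^esub> h = f \<and> snd_com X Y \<cdot>\<^bsub>coc_category\<^esub> h = g"
  proof (rule ex1I[where a = "(f \<boxtimes> g) \<bullet> cm Z"])
    fix h
    assume "h \<in> Hom coc_category Z (X \<boxtimes>\<^sub>c Y)
      \<and> fst_com X Y \<cdot>\<^bsub>coc_category\<^esub> h = f \<and> snd_com X Y \<cdot>\<^bsub>coc_category\<^esub> h = g"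
    then show "h = (f \<boxtimes> g) \<bullet> cm Z"
      using pair_unique[OF Z X Y, of h] by simp
  qed (use X Y Z f g in \<open>simp add: com_hom_pair fst_pair snd_pair\<close>)
qed (use X Y in \<open>simp_all add: com_hom_fst com_hom_snd\<close>)

end

lemma (in tensor_preserves_equalizers) coc_category_equalizers: "has_equalizers coc_category"
  unfolding has_equalizers_def
proof (intro ballI)
  fix X Y f g
  assume "f \<in> Hom coc_category X Y" "g \<in> Hom coc_category X Y"
  then have *: "coc X" "coc Y" "com_hom X Y f" "com_hom X Y g"
    by simp_all
  obtain Z e where Z: "coc Z" "com_hom Z X e" "f \<bullet> e = g \<bullet> e" "tmono e"
    and univ: "\<And>W h. \<lbrakk>coc W; com_hom W X h; f \<bullet> h = g \<bullet> h\<rbrakk> \<Longrightarrow> \<exists>k. com_hom W Z k \<and> e \<bullet> k = h"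
    by (rule coc_equalizer[OF *]) (rule that)
  have "is_equalizer coc_category X Y f g Z e"
    unfolding is_equalizer_def
  proof (intro conjI allI impI)
    fix W h
    assume "h \<in> Hom coc_category W X \<and> f \<cdot>\<^bsub>coc_category\<^esub> h = g \<cdot>\<^bsub>coc_category\<^esub> h"
    then have W: "coc W" "com_hom W X h" "f \<bullet> h = g \<bullet> h"
      by simp_all
    then obtain k where k: "com_hom W Z k" "e \<bullet> k = h"
      using univ by blast
    show "\<exists>!k. k \<in> Hom coc_category W Z \<and> e \<cdot>\<^bsub>coc_category\<^esub> k = h"
    proof (rule ex1I)
      show "k \<in> Hom coc_category W Z \<and> e \<cdot>\<^bsub>coc_category\<^esub> k = h"
        using k W Z by simp
      fix k'
      assume "k' \<in> Hom coc_category W Z \<and> e \<cdot>\<^bsub>coc_category\<^esub> k' = h"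
      then have "com_hom W Z k'" "e \<bullet> k' = e \<bullet> k"
        using k by simp_all
      then show "k' = k"
        using tmonoD[OF Z(4)] com_homD[OF k(1)] com_homD[of W Z k'] com_homD[OF Z(2)] by metis
    qed
  qed (use * Z in simp_all)
  then show "\<exists>E e. is_equalizer coc_category X Y f g E e"
    by blast
qed

section \<open>Hopf monoids\<close>

context symmetric_monoidal_category
begin

text \<open>An internal group of cocommutative comonoids, except that \<open>S\<close> is only an
  arrow of \<open>M\<close>, as in the definition of a Hopf monoid; \<open>com_hom_antipode\<close>
  supplies the rest.\<close>

definition hopf_com ::
  "('o, 'm) comonoid \<Rightarrow> ('o, 'm) tarrow \<Rightarrow> ('o, 'm) tarrow \<Rightarrow> ('o, 'm) tarrow \<Rightarrow> bool" where
  "hopf_com X m u S \<longleftrightarrow>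
     coc X \<and> com_hom (X \<boxtimes>\<^sub>c X) X m \<and> com_hom unit_com X u \<and>
     arr S \<and> dm S = ob X \<and> cd S = ob X \<and>
     m \<bullet> (m \<boxtimes> ide (ob X)) = m \<bullet> (ide (ob X) \<boxtimes> m) \<bullet> asc (ob X) (ob X) (ob X) \<and>
     m \<bullet> (u \<boxtimes> ide (ob X)) = lun (ob X) \<and>
     m \<bullet> (ide (ob X) \<boxtimes> u) = run (ob X) \<and>
     m \<bullet> (S \<boxtimes> ide (ob X)) \<bullet> cm X = u \<bullet> cu X \<and>
     m \<bullet> (ide (ob X) \<boxtimes> S) \<bullet> cm X = u \<bullet> cu X"

lemma hopf_comD:
  assumes "hopf_com X m u S"
  shows "coc X" "com_hom (X \<boxtimes>\<^sub>c X) X m" "com_hom unit_com X u"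
    "arr m" "dm m = ob X \<otimes>\<^sub>o ob X" "cd m = ob X" "arr u" "dm u = \<one>\<^sub>o" "cd u = ob X"
    "arr S" "dm S = ob X" "cd S = ob X"
    "m \<bullet> (m \<boxtimes> ide (ob X)) = m \<bullet> (ide (ob X) \<boxtimes> m) \<bullet> asc (ob X) (ob X) (ob X)"
    "m \<bullet> (u \<boxtimes> ide (ob X)) = lun (ob X)"
    "m \<bullet> (ide (ob X) \<boxtimes> u) = run (ob X)"
    "m \<bullet> (S \<boxtimes> ide (ob X)) \<bullet> cm X = u \<bullet> cu X"
    "m \<bullet> (ide (ob X) \<boxtimes> S) \<bullet> cm X = u \<bullet> cu X"
  using assms com_homD[of "X \<boxtimes>\<^sub>c X" X m] com_homD[of unit_com X u] unfolding hopf_com_def by auto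

text \<open>The shear map \<open>x \<otimes> y \<mapsto> x\<^sub>1 \<otimes> h(x\<^sub>2) y\<close>. For \<open>h = id\<close> it is a comonoid morphism, with
  inverse the shear map of the antipode; this is why the antipode is a comonoid morphism.\<close>

definition shear :: "('o, 'm) comonoid \<Rightarrow> ('o, 'm) tarrow \<Rightarrow> ('o, 'm) tarrow \<Rightarrow> ('o, 'm) tarrow" where
  "shear X m h =
     (ide (ob X) \<boxtimes> (m \<bullet> (h \<boxtimes> ide (ob X)))) \<bullet> asc (ob X) (ob X) (ob X) \<bullet> (cm X \<boxtimes> ide (ob X))"

text \<open>Coassociativity with a further factor \<open>T\<close> carried along behind; composing
  two shear maps leads to the case where \<open>T\<close> is the carrier.\<close>

lemma coassoc_tail:
  assumes X: "coc X" and T: "T \<in> Obj M"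
  shows "asc (ob X) (ob X) (ob X \<otimes>\<^sub>o T) \<bullet> (cm X \<boxtimes> ide (ob X \<otimes>\<^sub>o T)) \<bullet> asc (ob X) (ob X) T \<bullet> (cm X \<boxtimes> ide T)
    = (ide (ob X) \<boxtimes> (asc (ob X) (ob X) T \<bullet> (cm X \<boxtimes> ide T))) \<bullet> asc (ob X) (ob X) T \<bullet> (cm X \<boxtimes> ide T)"
proof -
  let ?A = "ob X"
  have "asc ?A ?A (?A \<otimes>\<^sub>o T) \<bullet> (cm X \<boxtimes> ide (?A \<otimes>\<^sub>o T)) \<bullet> asc ?A ?A T \<bullet> (cm X \<boxtimes> ide T)
      = (asc ?A ?A (?A \<otimes>\<^sub>o T) \<bullet> asc (?A \<otimes>\<^sub>o ?A) ?A T) \<bullet> (((cm X \<boxtimes> ide ?A) \<bullet> cm X) \<boxtimes> ide T)"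
    using X T by (simp add: whisker nat_simps)
  also have "\<dots> = (ide ?A \<boxtimes> asc ?A ?A T) \<bullet> asc ?A (?A \<otimes>\<^sub>o ?A) T
      \<bullet> ((asc ?A ?A ?A \<bullet> (cm X \<boxtimes> ide ?A) \<bullet> cm X) \<boxtimes> ide T)"
    using X T by (simp add: asc_pentagon whisker)
  also have "\<dots> = (ide ?A \<boxtimes> (asc ?A ?A T \<bullet> (cm X \<boxtimes> ide T))) \<bullet> asc ?A ?A T \<bullet> (cm X \<boxtimes> ide T)"
    using X T by (simp add: coassoc) (simp add: whisker nat_simps)
  finally show ?thesis .
qed

context
  fixes X m u S
  assumes H: "hopf_com X m u S"
begin

lemmas hopf = hopf_comD[OF H]

lemma shear_simps:
  assumes "arr h" "dm h = ob X" "cd h = ob X"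
  shows "arr (shear X m h)" "dm (shear X m h) = ob X \<otimes>\<^sub>o ob X" "cd (shear X m h) = ob X \<otimes>\<^sub>o ob X"
  using assms hopf by (simp_all add: shear_def)

text \<open>In elements, x \<otimes> y goes to x1 \<otimes> k(x2) y and then to x1 \<otimes> h(x2)
  k(x3) y. Composing shear maps is thus convolution of \<open>h\<close> and
  \<open>k\<close>.\<close>

lemma shear_shear:
  assumes h: "arr h" "dm h = ob X" "cd h = ob X" and k: "arr k" "dm k = ob X" "cd k = ob X"
  shows "shear X m h \<bullet> shear X m k = shear X m (m \<bullet> (h \<boxtimes> k) \<bullet> cm X)"
proof -
  let ?A = "ob X"
  \<comment> \<open>\<open>w l\<close> is x \<otimes> y \<mapsto> l(x) y.\<close>
  define w where "w l = m \<bullet> (l \<boxtimes> ide ?A)" for l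
  have [simp]: "coc X" "arr m" "dm m = ?A \<otimes>\<^sub>o ?A" "cd m = ?A"
    using hopf by simp_all
  have w: "arr (w l)" "dm (w l) = ?A \<otimes>\<^sub>o ?A" "cd (w l) = ?A" if "arr l" "dm l = ?A" "cd l = ?A" for l
    using that by (simp_all add: w_def)
  have "shear X m h \<bullet> shear X m k
      = (ide ?A \<boxtimes> w h) \<bullet> asc ?A ?A ?A \<bullet> (ide (?A \<otimes>\<^sub>o ?A) \<boxtimes> w k) \<bullet> (cm X \<boxtimes> ide (?A \<otimes>\<^sub>o ?A))
        \<bullet> asc ?A ?A ?A \<bullet> (cm X \<boxtimes> ide ?A)"
    using w[OF h] w[OF k] unfolding shear_def w_def[symmetric] by (simp add: tten_tcmp)
  also have "\<dots> = (ide ?A \<boxtimes> (w h \<bullet> (ide ?A \<boxtimes> w k))) \<bullet> asc ?A ?A (?A \<otimes>\<^sub>o ?A)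
        \<bullet> (cm X \<boxtimes> ide (?A \<otimes>\<^sub>o ?A)) \<bullet> asc ?A ?A ?A \<bullet> (cm X \<boxtimes> ide ?A)"
    using w[OF h] w[OF k] by (simp add: nat_simps whisker)
  also have "\<dots> = (ide ?A \<boxtimes> (w h \<bullet> (ide ?A \<boxtimes> w k) \<bullet> asc ?A ?A ?A \<bullet> (cm X \<boxtimes> ide ?A)))
        \<bullet> asc ?A ?A ?A \<bullet> (cm X \<boxtimes> ide ?A)"
    using w[OF h] w[OF k] by (simp add: coassoc_tail whisker)
  also have "w h \<bullet> (ide ?A \<boxtimes> w k) \<bullet> asc ?A ?A ?A \<bullet> (cm X \<boxtimes> ide ?A)
      = m \<bullet> (ide ?A \<boxtimes> m) \<bullet> (h \<boxtimes> (k \<boxtimes> ide ?A)) \<bullet> asc ?A ?A ?A \<bullet> (cm X \<boxtimes> ide ?A)"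
    using h k by (simp add: w_def tten_tcmp(2))
  also have "\<dots> = (m \<bullet> (ide ?A \<boxtimes> m) \<bullet> asc ?A ?A ?A) \<bullet> ((h \<boxtimes> k) \<boxtimes> ide ?A) \<bullet> (cm X \<boxtimes> ide ?A)"
    using h k by (simp add: asc_nat[THEN tcmp_tail])
  also have "\<dots> = m \<bullet> ((m \<bullet> (h \<boxtimes> k) \<bullet> cm X) \<boxtimes> ide ?A)"
    unfolding hopf(13)[symmetric] using h k by (simp add: tten_tcmp)
  finally show ?thesis
    by (simp add: shear_def)
qed

text \<open>\<open>u \<bullet> cu X\<close> is the unit for convolution.\<close>

lemma shear_unit: "shear X m (u \<bullet> cu X) = ide (ob X \<otimes>\<^sub>o ob X)"
proof -
  let ?A = "ob X"
  have [simp]: "coc X" "arr m" "dm m = ?A \<otimes>\<^sub>o ?A" "cd m = ?A" "arr u" "dm u = \<one>\<^sub>o" "cd u = ?A"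
    using hopf by simp_all
  have "m \<bullet> ((u \<bullet> cu X) \<boxtimes> ide ?A) = lun ?A \<bullet> (cu X \<boxtimes> ide ?A)"
    by (simp add: whisker hopf(14)[THEN tcmp_tail])
  then have "shear X m (u \<bullet> cu X)
      = ((ide ?A \<boxtimes> lun ?A) \<bullet> asc ?A \<one>\<^sub>o ?A) \<bullet> (((ide ?A \<boxtimes> cu X) \<bullet> cm X) \<boxtimes> ide ?A)"
    by (simp add: shear_def whisker nat_simps)
  also have "\<dots> = ide (?A \<otimes>\<^sub>o ?A)"
    by (simp add: asc_triangle tten_tcmp counit_right)
  finally show ?thesis .
qed

text \<open>The antipode axioms say that \<open>S\<close> and the identity are inverse to each other
  under convolution.\<close>

lemma shear_antipode:
  "shear X m S \<bullet> shear X m (ide (ob X)) = ide (ob X \<otimes>\<^sub>o ob X)"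
  "shear X m (ide (ob X)) \<bullet> shear X m S = ide (ob X \<otimes>\<^sub>o ob X)"
  using hopf by (simp_all add: shear_shear shear_unit)

lemma com_hom_shear: "com_hom (X \<boxtimes>\<^sub>c X) (X \<boxtimes>\<^sub>c X) (shear X m (ide (ob X)))"
proof -
  have X: "coc X" and m: "com_hom (X \<boxtimes>\<^sub>c X) X m"
    using hopf by simp_all
  have "com_hom (X \<boxtimes>\<^sub>c X) ((X \<boxtimes>\<^sub>c X) \<boxtimes>\<^sub>c X) (cm X \<boxtimes> ide (ob X))"
    by (intro com_hom_tten com_hom_cm com_hom_ide) (use X in simp_all)
  moreover have "com_hom (X \<boxtimes>\<^sub>c (X \<boxtimes>\<^sub>c X)) (X \<boxtimes>\<^sub>c X) (ide (ob X) \<boxtimes> m)"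
    by (intro com_hom_tten com_hom_ide m) (use X in simp_all)
  ultimately have "com_hom (X \<boxtimes>\<^sub>c X) (X \<boxtimes>\<^sub>c X)
      ((ide (ob X) \<boxtimes> m) \<bullet> asc (ob X) (ob X) (ob X) \<bullet> (cm X \<boxtimes> ide (ob X)))"
    using com_hom_tcmp com_hom_asc[OF X X X] X by (meson coc_ten_com)
  then show ?thesis
    using hopf by (simp add: shear_def)
qed

lemma com_hom_shear_antipode: "com_hom (X \<boxtimes>\<^sub>c X) (X \<boxtimes>\<^sub>c X) (shear X m S)"
  by (rule com_hom_inverse[OF _ _ com_hom_shear])
    (use hopf shear_antipode in \<open>simp_all add: shear_simps\<close>)

text \<open>The shear map of the identity sends x1 \<otimes> S(x2) to x1 \<otimes> x2 S(x3) = x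
  \<otimes> 1, and its inverse brings this back. The point is that the right side is composed of
  arrows already known to be comonoid morphisms.\<close>

lemma pair_antipode:
  "(ide (ob X) \<boxtimes> S) \<bullet> cm X = shear X m S \<bullet> (ide (ob X) \<boxtimes> (u \<bullet> cu X)) \<bullet> cm X"
proof -
  let ?A = "ob X"
  have [simp]: "coc X" "arr m" "dm m = ?A \<otimes>\<^sub>o ?A" "cd m = ?A" "arr S" "dm S = ?A" "cd S = ?A"
    using hopf by simp_all
  have "shear X m (ide ?A) \<bullet> (ide ?A \<boxtimes> S) \<bullet> cm X
      = (ide ?A \<boxtimes> m) \<bullet> asc ?A ?A ?A \<bullet> (ide (?A \<otimes>\<^sub>o ?A) \<boxtimes> S) \<bullet> (cm X \<boxtimes> ide ?A) \<bullet> cm X"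
    by (simp add: shear_def tten_tcmp(2))
  also have "\<dots> = (ide ?A \<boxtimes> (m \<bullet> (ide ?A \<boxtimes> S) \<bullet> cm X)) \<bullet> cm X"
    by (simp add: nat_simps coassoc whisker)
  finally have "shear X m S \<bullet> shear X m (ide ?A) \<bullet> (ide ?A \<boxtimes> S) \<bullet> cm X
      = shear X m S \<bullet> (ide ?A \<boxtimes> (u \<bullet> cu X)) \<bullet> cm X"
    by (simp add: hopf(17))
  then show ?thesis
    by (simp add: shear_antipode(1)[THEN tcmp_tail])
qed

lemma com_hom_unit_counit: "coc W \<Longrightarrow> com_hom W X (u \<bullet> cu W)"
  by (rule com_hom_tcmp[OF _ com_hom_cu(1)]) (use hopf in simp_all)

text \<open>\<open>S\<close> is the second component of x \<mapsto> x1 \<otimes> S(x2), a comonoid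
  morphism by \<open>pair_antipode\<close>.\<close>

lemma com_hom_antipode: "com_hom X X S"
proof -
  have X: "coc X"
    using hopf by simp
  have "com_hom X (X \<boxtimes>\<^sub>c X) ((ide (ob X) \<boxtimes> S) \<bullet> cm X)"
    unfolding pair_antipode
    by (rule com_hom_tcmp[OF X com_hom_pair com_hom_shear_antipode])
      (use X in \<open>simp_all add: com_hom_ide com_hom_unit_counit\<close>)
  from com_hom_tcmp[OF X this com_hom_snd]
  have "com_hom X X (snd_com X X \<bullet> (ide (ob X) \<boxtimes> S) \<bullet> cm X)"
    using X by simp
  \<comment> \<open>The rule \<open>snd_pair\<close> would presuppose that \<open>S\<close> is a
    comonoid morphism, so the projection is computed directly.\<close>
  also have "snd_com X X \<bullet> (ide (ob X) \<boxtimes> S) \<bullet> cm X = lun (ob X) \<bullet> (ide \<one>\<^sub>o \<boxtimes> S) \<bullet> (cu X \<boxtimes> ide (ob X)) \<bullet> cm X"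
    using X hopf by (simp add: snd_com_def tten_tcmp)
  also have "\<dots> = S"
    using X hopf by (simp add: nat_simps counit_left)
  finally show ?thesis .
qed

end

text \<open>\<open>t \<boxtimes> t\<close> commutes with the shear maps of the identities, hence
  with their inverses. At x \<otimes> 1 this gives t(x1) \<otimes> S'(t(x2)) = t(x1) \<otimes>
  t(S(x2)), and the second projection yields the claim.\<close>

lemma antipode_natural:
  assumes H: "hopf_com X m u S" and H': "hopf_com X' m' u' S'" and t: "com_hom X X' t"
    and tm: "t \<bullet> m = m' \<bullet> (t \<boxtimes> t)" and tu: "t \<bullet> u = u'"
  shows "t \<bullet> S = S' \<bullet> t"
proof -
  let ?A = "ob X" and ?B = "ob X'"
  note h = hopf_comD[OF H] and h' = hopf_comD[OF H'] and tD = com_homD[OF t]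
  have "shear X' m' (ide ?B) \<bullet> (t \<boxtimes> t)
      = (ide ?B \<boxtimes> m') \<bullet> asc ?B ?B ?B \<bullet> ((t \<boxtimes> t) \<boxtimes> t) \<bullet> (cm X \<boxtimes> ide ?A)"
    using h h' tD by (simp add: shear_def tten_tcmp)
  also have "\<dots> = (t \<boxtimes> t) \<bullet> shear X m (ide ?A)"
    using h h' tD tm by (simp add: shear_def nat_simps tten_tcmp(2))
  finally have shear: "shear X' m' (ide ?B) \<bullet> (t \<boxtimes> t) = (t \<boxtimes> t) \<bullet> shear X m (ide ?A)" .
  have pair: "com_hom X (X' \<boxtimes>\<^sub>c X') ((f \<boxtimes> g) \<bullet> cm X)" if "com_hom X X' f" "com_hom X X' g" for f g
    using com_hom_pair that h(1) h'(1) by blast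
  have "(t \<boxtimes> (S' \<bullet> t)) \<bullet> cm X = (ide ?B \<boxtimes> S') \<bullet> cm X' \<bullet> t"
    using h h' tD by (simp add: tten_tcmp(2))
  also have "\<dots> = shear X' m' S' \<bullet> (ide ?B \<boxtimes> (u' \<bullet> cu X')) \<bullet> cm X' \<bullet> t"
    using pair_antipode[OF H', THEN tcmp_tail] by simp
  also have "\<dots> = shear X' m' S' \<bullet> (t \<boxtimes> t) \<bullet> (ide ?A \<boxtimes> (u \<bullet> cu X)) \<bullet> cm X"
    using h h' tD by (simp add: tten_tcmp(2) tu[THEN tcmp_tail])
  also have "(ide ?A \<boxtimes> (u \<bullet> cu X)) \<bullet> cm X = shear X m (ide ?A) \<bullet> (ide ?A \<boxtimes> S) \<bullet> cm X"
    unfolding pair_antipode[OF H] using h shear_antipode(2)[OF H, THEN tcmp_tail]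
    by simp
  also have "shear X' m' S' \<bullet> (t \<boxtimes> t) \<bullet> shear X m (ide ?A) \<bullet> (ide ?A \<boxtimes> S) \<bullet> cm X
      = (t \<boxtimes> (t \<bullet> S)) \<bullet> cm X"
    using h h' tD shear_antipode(1)[OF H', THEN tcmp_tail]
    by (simp add: shear[symmetric, THEN tcmp_tail]) (simp add: tten_tcmp)
  finally have *: "(t \<boxtimes> (S' \<bullet> t)) \<bullet> cm X = (t \<boxtimes> (t \<bullet> S)) \<bullet> cm X" .
  have "com_hom X X' (S' \<bullet> t)" "com_hom X X' (t \<bullet> S)"
    using com_hom_tcmp[OF h(1) t com_hom_antipode[OF H']]
      com_hom_tcmp[OF h(1) com_hom_antipode[OF H] t] by simp_all
  then show ?thesis
    using snd_pair[OF h(1) h'(1) h'(1) t] * by metis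
qed

section \<open>Hopf monoids as typed data\<close>

definition com_of :: "('o, 'm) hopf \<Rightarrow> ('o, 'm) comonoid" where
  "com_of A = \<lparr>ob = car A, cm = Arrow (car A) (comult A) (car A \<otimes>\<^sub>o car A),
     cu = Arrow (car A) (counit A) \<one>\<^sub>o\<rparr>"

definition mult_of :: "('o, 'm) hopf \<Rightarrow> ('o, 'm) tarrow" where
  "mult_of A = Arrow (car A \<otimes>\<^sub>o car A) (mult A) (car A)"

definition unt_of :: "('o, 'm) hopf \<Rightarrow> ('o, 'm) tarrow" where
  "unt_of A = Arrow \<one>\<^sub>o (unt A) (car A)"

definition antipode_of :: "('o, 'm) hopf \<Rightarrow> ('o, 'm) tarrow" where
  "antipode_of A = Arrow (car A) (antipode A) (car A)"

lemma tarrow_eq_iff: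
  assumes "arr t" "arr s" "dm t = dm s" "cd t = cd s"
  shows "t = s \<longleftrightarrow> und t = und s"
  using assms arr_eqI by blast

lemma und_simps:
  "und (asc A B D) = assc M A B D" "und (csa A B D) = asscinv M A B D" "und (brd A B) = braid M A B"
  "und (lun A) = lunit M A" "und (run A) = runit M A"
  by (simp_all add: asc_def csa_def brd_def lun_def run_def)

lemma und_mid:
  assumes "A \<in> Obj M" "B \<in> Obj M" "D \<in> Obj M" "E \<in> Obj M"
  shows "und (mid A B D E) = middle_swap M A B D E"
  using assms by (simp add: mid_def swp_def und_simps middle_swap_def)

lemma hopf_com_of:
  "is_hopf_monoid M A \<and> is_cocommutative M A
    \<longleftrightarrow> hopf_com (com_of A) (mult_of A) (unt_of A) (antipode_of A)" (is "?l \<longleftrightarrow> ?r")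
\<comment> \<open>If some arrow has the wrong type, both sides fail. Otherwise an equation of typed
  arrows is equivalent to that of the underlying arrows, and the axioms can be compared one by
  one.\<close>
proof (cases "car A \<in> Obj M \<and> mult A \<in> Hom M (car A \<otimes>\<^sub>o car A) (car A) \<and> unt A \<in> Hom M \<one>\<^sub>o (car A)
    \<and> comult A \<in> Hom M (car A) (car A \<otimes>\<^sub>o car A) \<and> counit A \<in> Hom M (car A) \<one>\<^sub>o
    \<and> antipode A \<in> Hom M (car A) (car A)")
  case False
  moreover have False if ?l
    using that False
    by (auto simp: is_hopf_monoid_def is_bimonoid_def is_monoid_def is_comonoid_def)
  moreover have False if ?r
    using hopf_comD(4,7,10)[OF that] coc_simps[OF hopf_comD(1)[OF that]] False
    by (auto simp: com_of_def mult_of_def unt_of_def antipode_of_def)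
  ultimately show ?thesis
    by blast
next
  case True
  define X m u S where "X = com_of A" and "m = mult_of A" and "u = unt_of A" and "S = antipode_of A"
  have ob [simp]: "ob X = car A" and [simp]: "car A \<in> Obj M"
    using True by (simp_all add: X_def com_of_def)
  have [simp]: "arr (cm X)" "dm (cm X) = car A" "cd (cm X) = car A \<otimes>\<^sub>o car A"
    "arr (cu X)" "dm (cu X) = car A" "cd (cu X) = \<one>\<^sub>o"
    "arr m" "dm m = car A \<otimes>\<^sub>o car A" "cd m = car A"
    "arr u" "dm u = \<one>\<^sub>o" "cd u = car A" "arr S" "dm S = car A" "cd S = car A"
    using True by (simp_all add: X_def m_def u_def S_def com_of_def mult_of_def unt_of_def antipode_of_def)
  have und [simp]: "und (cm X) = comult A" "und (cu X) = counit A" "und m = mult A" "und u = unt A"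
    "und S = antipode A"
    by (simp_all add: X_def m_def u_def S_def com_of_def mult_of_def unt_of_def antipode_of_def)
  have coc: "coc X \<longleftrightarrow> is_comonoid M (car A) (comult A) (counit A) \<and> is_cocommutative M A"
  proof
    assume X: "coc X"
    have "und (asc (car A) (car A) (car A) \<bullet> (cm X \<boxtimes> ide (car A)) \<bullet> cm X)
        = und ((ide (car A) \<boxtimes> cm X) \<bullet> cm X)"
      "und (lun (car A) \<bullet> (cu X \<boxtimes> ide (car A)) \<bullet> cm X) = und (ide (car A))"
      "und (run (car A) \<bullet> (ide (car A) \<boxtimes> cu X) \<bullet> cm X) = und (ide (car A))"
      "und (brd (car A) (car A) \<bullet> cm X) = und (cm X)"
      using coassoc[OF X] counit_left[OF X] counit_right[OF X] cocomm[OF X] by simp_all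
    then show "is_comonoid M (car A) (comult A) (counit A) \<and> is_cocommutative M A"
      using True by (simp add: is_comonoid_def is_cocommutative_def und_simps)
  next
    assume "is_comonoid M (car A) (comult A) (counit A) \<and> is_cocommutative M A"
    then have "asc (ob X) (ob X) (ob X) \<bullet> (cm X \<boxtimes> ide (ob X)) \<bullet> cm X = (ide (ob X) \<boxtimes> cm X) \<bullet> cm X"
      "lun (ob X) \<bullet> (cu X \<boxtimes> ide (ob X)) \<bullet> cm X = ide (ob X)"
      "brd (ob X) (ob X) \<bullet> cm X = cm X"
      by (simp_all add: is_comonoid_def is_cocommutative_def tarrow_eq_iff und_simps)
    then show "coc X"
      by (intro cocI) simp_all
  qed
  have mult: "com_hom (X \<boxtimes>\<^sub>c X) X m \<longleftrightarrow>
      comult A \<cdot> mult A = (mult A \<otimes>\<^sub>m mult A) \<cdot> middle_swap M (car A) (car A) (car A) (car A)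
        \<cdot> (comult A \<otimes>\<^sub>m comult A) \<and>
      lunit M \<one>\<^sub>o \<cdot> (counit A \<otimes>\<^sub>m counit A) = counit A \<cdot> mult A"
    by (auto simp: com_hom_def ten_com_def tarrow_eq_iff und_simps und_mid)
  \<comment> \<open>\<open>unit_com\<close> comultiplies by the inverse of
    \<open>lun \<one>\<^sub>o\<close>, whereas the bimonoid axiom has
    \<open>lun \<one>\<^sub>o\<close> itself on the other side.\<close>
  have "cm X \<bullet> u = (u \<boxtimes> u) \<bullet> nul \<one>\<^sub>o \<longleftrightarrow> cm X \<bullet> u \<bullet> lun \<one>\<^sub>o = u \<boxtimes> u"
  proof
    assume "cm X \<bullet> u \<bullet> lun \<one>\<^sub>o = u \<boxtimes> u"
    then have "(u \<boxtimes> u) \<bullet> nul \<one>\<^sub>o = (cm X \<bullet> u \<bullet> lun \<one>\<^sub>o) \<bullet> nul \<one>\<^sub>o"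
      by simp
    then show "cm X \<bullet> u = (u \<boxtimes> u) \<bullet> nul \<one>\<^sub>o"
      by simp
  next
    assume "cm X \<bullet> u = (u \<boxtimes> u) \<bullet> nul \<one>\<^sub>o"
    from this[THEN tcmp_tail] show "cm X \<bullet> u \<bullet> lun \<one>\<^sub>o = u \<boxtimes> u"
      by simp
  qed
  then have unt: "com_hom unit_com X u \<longleftrightarrow>
      comult A \<cdot> unt A \<cdot> lunit M \<one>\<^sub>o = unt A \<otimes>\<^sub>m unt A \<and> counit A \<cdot> unt A = idt M \<one>\<^sub>o"
    by (simp add: com_hom_def unit_com_def tarrow_eq_iff[of _ "u \<boxtimes> u"] tarrow_eq_iff[of _ "ide \<one>\<^sub>o"] und_simps)
  have rest: "m \<bullet> (m \<boxtimes> ide (ob X)) = m \<bullet> (ide (ob X) \<boxtimes> m) \<bullet> asc (ob X) (ob X) (ob X) \<longleftrightarrow>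
      mult A \<cdot> (mult A \<otimes>\<^sub>m idt M (car A)) = mult A \<cdot> (idt M (car A) \<otimes>\<^sub>m mult A) \<cdot> assc M (car A) (car A) (car A)"
    "m \<bullet> (u \<boxtimes> ide (ob X)) = lun (ob X) \<longleftrightarrow> mult A \<cdot> (unt A \<otimes>\<^sub>m idt M (car A)) = lunit M (car A)"
    "m \<bullet> (ide (ob X) \<boxtimes> u) = run (ob X) \<longleftrightarrow> mult A \<cdot> (idt M (car A) \<otimes>\<^sub>m unt A) = runit M (car A)"
    "m \<bullet> (S \<boxtimes> ide (ob X)) \<bullet> cm X = u \<bullet> cu X \<longleftrightarrow>
      mult A \<cdot> (antipode A \<otimes>\<^sub>m idt M (car A)) \<cdot> comult A = unt A \<cdot> counit A"
    "m \<bullet> (ide (ob X) \<boxtimes> S) \<bullet> cm X = u \<bullet> cu X \<longleftrightarrow>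
      mult A \<cdot> (idt M (car A) \<otimes>\<^sub>m antipode A) \<cdot> comult A = unt A \<cdot> counit A"
    by (simp_all add: tarrow_eq_iff und_simps)
  have "hopf_com X m u S \<longleftrightarrow> ?l"
    using True unfolding hopf_com_def coc mult unt rest
    by (auto simp: is_hopf_monoid_def is_bimonoid_def is_monoid_def)
  then show ?thesis
    by (simp add: X_def m_def u_def S_def)
qed

lemma hopf_morphism_iff:
  assumes "hopf_com (com_of A) (mult_of A) (unt_of A) (antipode_of A)"
    and "hopf_com (com_of B) (mult_of B) (unt_of B) (antipode_of B)"
  shows "is_hopf_morphism M A B f \<longleftrightarrow>
    com_hom (com_of A) (com_of B) (Arrow (car A) f (car B)) \<and>
    Arrow (car A) f (car B) \<bullet> mult_of A
      = mult_of B \<bullet> (Arrow (car A) f (car B) \<boxtimes> Arrow (car A) f (car B)) \<and>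
    Arrow (car A) f (car B) \<bullet> unt_of A = unt_of B" (is "_ \<longleftrightarrow> ?r")
proof (cases "f \<in> Hom M (car A) (car B)")
  case True
  note A = hopf_comD[OF assms(1)] and B = hopf_comD[OF assms(2)]
  have ob [simp]: "ob (com_of A) = car A" "ob (com_of B) = car B"
    by (simp_all add: com_of_def)
  have und [simp]: "und (cm (com_of A)) = comult A" "und (cu (com_of A)) = counit A"
    "und (mult_of A) = mult A" "und (unt_of A) = unt A"
    "und (cm (com_of B)) = comult B" "und (cu (com_of B)) = counit B"
    "und (mult_of B) = mult B" "und (unt_of B) = unt B"
    by (simp_all add: com_of_def mult_of_def unt_of_def)
  show ?thesis
    using True A(1,4-12) B(1,4-12) coc_simps[OF A(1)] coc_simps[OF B(1)]
    by (auto simp: is_hopf_morphism_def com_hom_def tarrow_eq_iff)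
next
  case False
  then show ?thesis
    by (auto simp: is_hopf_morphism_def com_hom_def)
qed

end

text \<open>The composites \<open>p i \<bullet> h\<close> are themselves a family, and both
  \<open>h\<close> and \<open>h'\<close> lift it.\<close>

lemma (in symmetric_monoidal_category) universal_family_jointly_monic:
  assumes univ: "is_universal_family coc_category I F K L p" and F: "\<And>i. i \<in> I \<Longrightarrow> coc (F i)"
    and W: "coc W" "com_hom W L h" "com_hom W L h'" and eq: "\<And>i. i \<in> I \<Longrightarrow> p i \<bullet> h = p i \<bullet> h'"
  shows "h = h'"
proof -
  have L: "coc L" and p: "\<And>i. i \<in> I \<Longrightarrow> com_hom L (F i) (p i)"
    and K_p: "\<And>i t j. (i, t, j) \<in> K \<Longrightarrow> t \<bullet> p i = p j"
    using univ by (auto simp: is_universal_family_def is_family_def)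
  have "t \<bullet> p i \<bullet> h = p j \<bullet> h" if "(i, t, j) \<in> K" for i t j
    using K_p[OF that, THEN tcmp_tail] .
  then have "is_family coc_category I F K W (\<lambda>i. p i \<bullet> h)"
    using W F com_hom_tcmp[OF W(1,2) p] by (auto simp: is_family_def)
  then have "\<exists>!k. k \<in> Hom coc_category W L \<and> (\<forall>i\<in>I. p i \<bullet> k = p i \<bullet> h)"
    using univ unfolding is_universal_family_def by simp
  moreover have "h \<in> Hom coc_category W L \<and> (\<forall>i\<in>I. p i \<bullet> h = p i \<bullet> h)"
    "h' \<in> Hom coc_category W L \<and> (\<forall>i\<in>I. p i \<bullet> h' = p i \<bullet> h)"
    using W L by (simp, simp add: eq)
  ultimately show ?thesis
    by blast
qed

section \<open>Hopf structure on a limit of comonoids\<close>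

context tensor_preserves_equalizers
begin

lemma hopf_limit_exists:
  assumes "finite I" "finite K"
    and hopf: "\<And>i. i \<in> I \<Longrightarrow> hopf_com (F i) (mu i) (un i) (an i)"
    and K: "\<And>i t j. (i, t, j) \<in> K \<Longrightarrow> i \<in> I \<and> j \<in> I \<and> com_hom (F i) (F j) t \<and>
      t \<bullet> mu i = mu j \<bullet> (t \<boxtimes> t) \<and> t \<bullet> un i = un j"
  obtains L p m u S where "is_universal_family coc_category I F K L p" "hopf_com L m u S"
    "\<And>i. i \<in> I \<Longrightarrow> p i \<bullet> m = mu i \<bullet> (p i \<boxtimes> p i)" "\<And>i. i \<in> I \<Longrightarrow> p i \<bullet> u = un i"
proof -
  note FD = hopf_comD[OF hopf]
  have "\<exists>L p. is_universal_family coc_category I F K L p"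
  proof (rule category.universal_family_exists[OF category_coc_category])
    show "unit_com \<in> Obj coc_category" "has_equalizers coc_category"
      by (simp_all add: coc_category_equalizers)
    show "\<exists>P p1 p2. category.is_product coc_category X Y P p1 p2"
      if "X \<in> Obj coc_category" "Y \<in> Obj coc_category" for X Y
      by (intro exI, rule coc_category_product) (use that in simp_all)
  qed (use assms K FD(1) coc_category_terminal in \<open>auto simp del: coc_category_simps(2), auto\<close>)
  then obtain L p where univ: "is_universal_family coc_category I F K L p"
    by blast
  then have L: "coc L" and p: "\<And>i. i \<in> I \<Longrightarrow> com_hom L (F i) (p i)"
    and K_p: "\<And>i t j. (i, t, j) \<in> K \<Longrightarrow> t \<bullet> p i = p j"
    by (auto simp: is_universal_family_def is_family_def)
  have lift: "\<exists>h. com_hom W L h \<and> (\<forall>i\<in>I. p i \<bullet> h = q i)"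
    if "coc W" "\<And>i. i \<in> I \<Longrightarrow> com_hom W (F i) (q i)" "\<And>i t j. (i, t, j) \<in> K \<Longrightarrow> t \<bullet> q i = q j" for W q
  proof -
    have "is_family coc_category I F K W q"
      using that FD(1) by (auto simp: is_family_def)
    with univ have "\<exists>!h. h \<in> Hom coc_category W L \<and> (\<forall>i\<in>I. p i \<cdot>\<^bsub>coc_category\<^esub> h = q i)"
      unfolding is_universal_family_def by blast
    then show ?thesis
      by (auto dest: ex1_implies_ex)
  qed
  note jointly_monic = universal_family_jointly_monic[OF univ FD(1)]
  let ?A = "ob L"
  have t_tten: "(t \<boxtimes> t) \<bullet> (p i \<boxtimes> p i) = p j \<boxtimes> p j" if "(i, t, j) \<in> K" for i t j
    using K[OF that] com_homD[of "F i" "F j" t] com_homD[OF p[of i]] K_p[OF that]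
    by (simp add: tten_tcmp)
  \<comment> \<open>These will be the components of \<open>m\<close>. They are compatible with the
    arrows in \<open>K\<close> because those are multiplicative.\<close>
  have "com_hom (L \<boxtimes>\<^sub>c L) (F i) (mu i \<bullet> (p i \<boxtimes> p i))" if "i \<in> I" for i
    by (rule com_hom_tcmp[OF _ com_hom_tten FD(2)]) (use that L p FD(1) in simp_all)
  moreover have "t \<bullet> mu i \<bullet> (p i \<boxtimes> p i) = mu j \<bullet> (p j \<boxtimes> p j)" if "(i, t, j) \<in> K" for i t j
    using K[OF that] t_tten[OF that] by (metis tcmp_assoc)
  ultimately obtain m where m: "com_hom (L \<boxtimes>\<^sub>c L) L m"
    and p_m: "\<And>i. i \<in> I \<Longrightarrow> p i \<bullet> m = mu i \<bullet> (p i \<boxtimes> p i)"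
    using lift[of "L \<boxtimes>\<^sub>c L" "\<lambda>i. mu i \<bullet> (p i \<boxtimes> p i)"] L by auto
  obtain u where u: "com_hom unit_com L u" and p_u: "\<And>i. i \<in> I \<Longrightarrow> p i \<bullet> u = un i"
    using lift[of unit_com un] FD(3) K by auto
  \<comment> \<open>For the antipode both conditions go back to the shear map: \<open>an i\<close>
    is a comonoid morphism, and compatibility with \<open>K\<close> is
    \<open>antipode_natural\<close>.\<close>
  have "com_hom L (F i) (an i \<bullet> p i)" if "i \<in> I" for i
    using com_hom_tcmp[OF L p com_hom_antipode[OF hopf]] that by simp
  moreover have "t \<bullet> an i \<bullet> p i = an j \<bullet> p j" if "(i, t, j) \<in> K" for i t j
  proof -
    have "t \<bullet> an i = an j \<bullet> t"
      using K[OF that] antipode_natural[OF hopf hopf] by blast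
    then show ?thesis
      using K_p[OF that] by (metis tcmp_assoc)
  qed
  ultimately obtain S where S: "com_hom L L S" and p_S: "\<And>i. i \<in> I \<Longrightarrow> p i \<bullet> S = an i \<bullet> p i"
    using lift[of L "\<lambda>i. an i \<bullet> p i"] L by auto
  note mD = com_homD[OF m, simplified] and uD = com_homD[OF u, simplified] and SD = com_homD[OF S]
  note Lm = com_hom_tcmp[OF _ _ m] and Ltt = com_hom_tten[OF _ _ _ _ L L]
  have pD: "arr (p i)" "dm (p i) = ?A" "cd (p i) = ob (F i)" if "i \<in> I" for i
    using com_homD[OF p[OF that]] by simp_all
  have p_tten: "(p i \<boxtimes> p i) \<bullet> (f \<boxtimes> g) = (p i \<bullet> f) \<boxtimes> (p i \<bullet> g)"
    if "i \<in> I" "arr f" "arr g" "cd f = ?A" "cd g = ?A" for i f g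
    using that pD by (simp add: tten_tcmp)
  have cu: "com_hom L L (u \<bullet> cu L)"
    by (rule com_hom_tcmp[OF L com_hom_cu(1)[OF L] u])
  have p_cu: "p i \<bullet> u \<bullet> cu L = un i \<bullet> cu (F i) \<bullet> p i" if "i \<in> I" for i
    using p_u[OF that, THEN tcmp_tail] com_homD(5)[OF p[OF that]] by simp
  \<comment> \<open>From here on each axiom is tested after the projections, where it becomes the
    axiom of \<open>F i\<close>. Joint monicity asks each time that both sides be comonoid
    morphisms.\<close>
  have "m \<bullet> (m \<boxtimes> ide ?A) = m \<bullet> (ide ?A \<boxtimes> m) \<bullet> asc ?A ?A ?A"
  proof (rule jointly_monic, assumption)
    show "coc ((L \<boxtimes>\<^sub>c L) \<boxtimes>\<^sub>c L)"
      using L by simp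
    show "com_hom ((L \<boxtimes>\<^sub>c L) \<boxtimes>\<^sub>c L) L (m \<bullet> (m \<boxtimes> ide ?A))"
      by (intro Lm Ltt m com_hom_ide) (use L in simp_all)
    show "com_hom ((L \<boxtimes>\<^sub>c L) \<boxtimes>\<^sub>c L) L (m \<bullet> (ide ?A \<boxtimes> m) \<bullet> asc ?A ?A ?A)"
      by (intro Lm com_hom_tcmp[OF _ com_hom_asc[OF L L L]] Ltt m com_hom_ide) (use L in simp_all)
    fix i assume i: "i \<in> I"
    have "p i \<bullet> m \<bullet> (m \<boxtimes> ide ?A) = mu i \<bullet> ((mu i \<bullet> (p i \<boxtimes> p i)) \<boxtimes> (p i \<bullet> ide ?A))"
      using i mD L p_m[OF i] by (simp add: p_m[OF i, THEN tcmp_tail] p_tten)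
    also have "\<dots> = (mu i \<bullet> (mu i \<boxtimes> ide (ob (F i)))) \<bullet> ((p i \<boxtimes> p i) \<boxtimes> p i)"
      using pD[OF i] FD(1,4-12)[OF i] L by (simp add: tten_tcmp)
    also have "\<dots> = mu i \<bullet> (ide (ob (F i)) \<boxtimes> mu i) \<bullet> (p i \<boxtimes> (p i \<boxtimes> p i)) \<bullet> asc ?A ?A ?A"
      unfolding FD(13)[OF i] using pD[OF i] FD(1)[OF i] L by (simp add: nat_simps)
    also have "\<dots> = mu i \<bullet> ((p i \<bullet> ide ?A) \<boxtimes> (mu i \<bullet> (p i \<boxtimes> p i))) \<bullet> asc ?A ?A ?A"
      using pD[OF i] FD(1,4-12)[OF i] L by (simp add: tten_tcmp(2))
    also have "\<dots> = p i \<bullet> m \<bullet> (ide ?A \<boxtimes> m) \<bullet> asc ?A ?A ?A"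
      using i mD L p_m[OF i] by (simp add: p_m[OF i, THEN tcmp_tail] p_tten[THEN tcmp_tail])
    finally show "p i \<bullet> m \<bullet> (m \<boxtimes> ide ?A) = p i \<bullet> m \<bullet> (ide ?A \<boxtimes> m) \<bullet> asc ?A ?A ?A" .
  qed
  moreover have "m \<bullet> (u \<boxtimes> ide ?A) = lun ?A"
  proof (rule jointly_monic, assumption)
    show "coc (unit_com \<boxtimes>\<^sub>c L)" "com_hom (unit_com \<boxtimes>\<^sub>c L) L (lun ?A)"
      using L com_hom_lun by simp_all
    show "com_hom (unit_com \<boxtimes>\<^sub>c L) L (m \<bullet> (u \<boxtimes> ide ?A))"
      by (intro Lm Ltt u com_hom_ide) (use L in simp_all)
    fix i assume i: "i \<in> I"
    have "p i \<bullet> m \<bullet> (u \<boxtimes> ide ?A) = (mu i \<bullet> (un i \<boxtimes> ide (ob (F i)))) \<bullet> (ide \<one>\<^sub>o \<boxtimes> p i)"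
      using uD L pD[OF i] FD(1,4-12)[OF i] by (simp add: p_m[OF i, THEN tcmp_tail] tten_tcmp p_u[OF i])
    then show "p i \<bullet> m \<bullet> (u \<boxtimes> ide ?A) = p i \<bullet> lun ?A"
      unfolding FD(14)[OF i] using pD[OF i] by (simp add: nat_simps)
  qed
  moreover have "m \<bullet> (ide ?A \<boxtimes> u) = run ?A"
  proof (rule jointly_monic, assumption)
    show "coc (L \<boxtimes>\<^sub>c unit_com)" "com_hom (L \<boxtimes>\<^sub>c unit_com) L (run ?A)"
      using L com_hom_run by simp_all
    show "com_hom (L \<boxtimes>\<^sub>c unit_com) L (m \<bullet> (ide ?A \<boxtimes> u))"
      by (intro Lm Ltt u com_hom_ide) (use L in simp_all)
    fix i assume i: "i \<in> I"
    have "p i \<bullet> m \<bullet> (ide ?A \<boxtimes> u) = (mu i \<bullet> (ide (ob (F i)) \<boxtimes> un i)) \<bullet> (p i \<boxtimes> ide \<one>\<^sub>o)"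
      using uD L pD[OF i] FD(1,4-12)[OF i] by (simp add: p_m[OF i, THEN tcmp_tail] tten_tcmp p_u[OF i])
    then show "p i \<bullet> m \<bullet> (ide ?A \<boxtimes> u) = p i \<bullet> run ?A"
      unfolding FD(15)[OF i] using pD[OF i] by (simp add: nat_simps)
  qed
  moreover have "m \<bullet> (S \<boxtimes> ide ?A) \<bullet> cm L = u \<bullet> cu L"
  proof (rule jointly_monic[OF _ L _ cu], assumption)
    show "com_hom L L (m \<bullet> (S \<boxtimes> ide ?A) \<bullet> cm L)"
      by (intro Lm com_hom_pair com_hom_ide S) (use L in simp_all)
    fix i assume i: "i \<in> I"
    have "p i \<bullet> m \<bullet> (S \<boxtimes> ide ?A) \<bullet> cm L
        = (mu i \<bullet> (an i \<boxtimes> ide (ob (F i))) \<bullet> cm (F i)) \<bullet> p i"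
      using SD L pD[OF i] FD(1,4-12)[OF i] com_homD(4)[OF p[OF i]]
      by (simp add: p_m[OF i, THEN tcmp_tail] tten_tcmp(2) p_S[OF i])
    then show "p i \<bullet> m \<bullet> (S \<boxtimes> ide ?A) \<bullet> cm L = p i \<bullet> u \<bullet> cu L"
      unfolding FD(16)[OF i] using p_cu[OF i] by simp
  qed
  moreover have "m \<bullet> (ide ?A \<boxtimes> S) \<bullet> cm L = u \<bullet> cu L"
  proof (rule jointly_monic[OF _ L _ cu], assumption)
    show "com_hom L L (m \<bullet> (ide ?A \<boxtimes> S) \<bullet> cm L)"
      by (intro Lm com_hom_pair com_hom_ide S) (use L in simp_all)
    fix i assume i: "i \<in> I"
    have "p i \<bullet> m \<bullet> (ide ?A \<boxtimes> S) \<bullet> cm L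
        = (mu i \<bullet> (ide (ob (F i)) \<boxtimes> an i) \<bullet> cm (F i)) \<bullet> p i"
      using SD L pD[OF i] FD(1,4-12)[OF i] com_homD(4)[OF p[OF i]]
      by (simp add: p_m[OF i, THEN tcmp_tail] tten_tcmp(2) p_S[OF i])
    then show "p i \<bullet> m \<bullet> (ide ?A \<boxtimes> S) \<bullet> cm L = p i \<bullet> u \<bullet> cu L"
      unfolding FD(17)[OF i] using p_cu[OF i] by simp
  qed
  ultimately have "hopf_com L m u S"
    using L m u SD by (simp add: hopf_com_def)
  from univ this p_m p_u show thesis
    by (rule that)
qed

end

section \<open>The category of cocommutative Hopf monoids and its limits\<close>

context symmetric_monoidal_category
begin

lemma Hopf_coc_simps:
  "A \<in> Obj (Hopf_coc M) \<longleftrightarrow> hopf_com (com_of A) (mult_of A) (unt_of A) (antipode_of A)"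
  "f \<in> Hom (Hopf_coc M) A B \<longleftrightarrow> A \<in> Obj (Hopf_coc M) \<and> B \<in> Obj (Hopf_coc M) \<and> is_hopf_morphism M A B f"
  "cmp (Hopf_coc M) = cmp M" "idt (Hopf_coc M) A = idt M (car A)"
  by (auto simp: Hopf_coc_def simp flip: hopf_com_of)

lemma category_Hopf_coc: "category (Hopf_coc M)"
proof
  fix f A B
  assume f: "f \<in> Hom (Hopf_coc M) A B"
  then show "A \<in> Obj (Hopf_coc M) \<and> B \<in> Obj (Hopf_coc M)"
    by (simp add: Hopf_coc_simps(2))
  from f have "f \<in> Hom M (car A) (car B)"
    by (simp add: Hopf_coc_simps(2) is_hopf_morphism_def)
  then show "idt (Hopf_coc M) B \<cdot>\<^bsub>Hopf_coc M\<^esub> f = f" "f \<cdot>\<^bsub>Hopf_coc M\<^esub> idt (Hopf_coc M) A = f"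
    by (simp_all add: Hopf_coc_simps(3,4) cmp_idt_left cmp_idt_right)
next
  fix A
  assume A: "A \<in> Obj (Hopf_coc M)"
  have ide: "Arrow (car A) (idt M (car A)) (car A) = ide (ob (com_of A))"
    by (simp add: ide_def com_of_def)
  have "is_hopf_morphism M A A (idt M (car A))"
    using A unfolding Hopf_coc_simps(1)
    by (subst hopf_morphism_iff; (simp only: ide)?) (use hopf_comD in \<open>simp_all add: com_hom_ide\<close>)
  with A show "idt (Hopf_coc M) A \<in> Hom (Hopf_coc M) A A"
    by (simp add: Hopf_coc_simps(2,4))
next
  fix f g A B D
  assume f: "f \<in> Hom (Hopf_coc M) A B" and g: "g \<in> Hom (Hopf_coc M) B D"
  then have A: "A \<in> Obj (Hopf_coc M)" and B: "B \<in> Obj (Hopf_coc M)" and D: "D \<in> Obj (Hopf_coc M)"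
    and fg: "is_hopf_morphism M A B f" "is_hopf_morphism M B D g"
    by (simp_all add: Hopf_coc_simps(2))
  let ?f = "Arrow (car A) f (car B)" and ?g = "Arrow (car B) g (car D)"
  note A' = A[unfolded Hopf_coc_simps] and B' = B[unfolded Hopf_coc_simps] and D' = D[unfolded Hopf_coc_simps]
  have gf: "Arrow (car A) (g \<cdot> f) (car D) = ?g \<bullet> ?f"
    using fg by (intro arr_eqI) (auto simp: is_hopf_morphism_def intro: cmp_Hom)
  note f' = fg(1)[unfolded hopf_morphism_iff[OF A' B']] and g' = fg(2)[unfolded hopf_morphism_iff[OF B' D']]
  have hom: "arr ?f" "arr ?g"
    using fg by (simp_all add: is_hopf_morphism_def)
  have "(?g \<bullet> ?f) \<bullet> mult_of A = (?g \<bullet> mult_of B) \<bullet> (?f \<boxtimes> ?f)"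
    using f' by simp
  also have "\<dots> = mult_of D \<bullet> ((?g \<bullet> ?f) \<boxtimes> (?g \<bullet> ?f))"
    using g' hom by (simp add: tten_tcmp)
  finally have mult: "(?g \<bullet> ?f) \<bullet> mult_of A = mult_of D \<bullet> ((?g \<bullet> ?f) \<boxtimes> (?g \<bullet> ?f))" .
  have "is_hopf_morphism M A D (g \<cdot> f)"
    unfolding hopf_morphism_iff[OF A' D'] gf
    using f' g' mult com_hom_tcmp[OF hopf_comD(1)[OF A']] by auto
  with A D show "g \<cdot>\<^bsub>Hopf_coc M\<^esub> f \<in> Hom (Hopf_coc M) A D"
    by (simp add: Hopf_coc_simps)
next
  fix f g h A B D E
  assume "f \<in> Hom (Hopf_coc M) A B" "g \<in> Hom (Hopf_coc M) B D" "h \<in> Hom (Hopf_coc M) D E"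
  then have "f \<in> Hom M (car A) (car B)" "g \<in> Hom M (car B) (car D)" "h \<in> Hom M (car D) (car E)"
    by (simp_all add: Hopf_coc_simps(2) is_hopf_morphism_def)
  then show "(h \<cdot>\<^bsub>Hopf_coc M\<^esub> g) \<cdot>\<^bsub>Hopf_coc M\<^esub> f = h \<cdot>\<^bsub>Hopf_coc M\<^esub> g \<cdot>\<^bsub>Hopf_coc M\<^esub> f"
    unfolding Hopf_coc_simps(3) by (rule cmp_assoc)
qed

end

context tensor_preserves_equalizers
begin

text \<open>A cone over the functor amounts to a family for the set \<open>K\<close> of its typed
  arrows, consisting of Hopf morphisms. So the comonoid limit with its induced Hopf structure is
  universal once the lift of such a cone is seen to be a Hopf morphism.\<close>

lemma Hopf_coc_limit:
  assumes J: "finite_category J" and F: "cat_functor J (Hopf_coc M) Fo Fm"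
  shows "\<exists>L p. is_limit J (Hopf_coc M) Fo Fm L p"
proof -
  interpret F: cat_functor J "Hopf_coc M" Fo Fm
    by (rule F)
  let ?F = "\<lambda>i. com_of (Fo i)"
  \<comment> \<open>Hom-sets may overlap in \<open>J\<close> as well as in \<open>M\<close>, so
    indices and objects are recorded together with each arrow.\<close>
  let ?t = "\<lambda>(i, j, x). (i, Arrow (car (Fo i)) (Fm x) (car (Fo j)), j)"
  define K where "K = ?t ` (SIGMA i:Obj J. SIGMA j:Obj J. Hom J i j)"
  have K_iff: "(i, t, j) \<in> K \<longleftrightarrow> (\<exists>x\<in>Hom J i j. t = Arrow (car (Fo i)) (Fm x) (car (Fo j)))" for i t j
    using F.dom.Hom_Obj by (force simp: K_def)
  have obj: "hopf_com (com_of (Fo i)) (mult_of (Fo i)) (unt_of (Fo i)) (antipode_of (Fo i))"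
    if "i \<in> Obj J" for i
    using F.map_Obj[OF that] by (simp add: Hopf_coc_simps)
  have fin: "finite (Obj J)" "finite K"
    using J by (auto simp: finite_category_def K_def intro!: finite_SigmaI)
  have K: "i \<in> Obj J \<and> j \<in> Obj J \<and> com_hom (com_of (Fo i)) (com_of (Fo j)) t \<and>
      t \<bullet> mult_of (Fo i) = mult_of (Fo j) \<bullet> (t \<boxtimes> t) \<and> t \<bullet> unt_of (Fo i) = unt_of (Fo j)"
    if t: "(i, t, j) \<in> K" for i t j
  proof -
    obtain x where x: "x \<in> Hom J i j" and t: "t = Arrow (car (Fo i)) (Fm x) (car (Fo j))"
      using t K_iff[of i t j] by auto
    have ij: "i \<in> Obj J" "j \<in> Obj J"
      using F.dom.Hom_Obj[OF x] by simp_all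
    have "is_hopf_morphism M (Fo i) (Fo j) (Fm x)"
      using F.map_Hom[OF x] by (simp add: Hopf_coc_simps(2))
    with ij t show ?thesis
      by (simp add: hopf_morphism_iff[OF obj[OF ij(1)] obj[OF ij(2)]])
  qed
  obtain X p m u S where univ: "is_universal_family coc_category (Obj J) ?F K X p"
    and X: "hopf_com X m u S"
    and p_m: "\<And>i. i \<in> Obj J \<Longrightarrow> p i \<bullet> m = mult_of (Fo i) \<bullet> (p i \<boxtimes> p i)"
    and p_u: "\<And>i. i \<in> Obj J \<Longrightarrow> p i \<bullet> u = unt_of (Fo i)"
    by (rule hopf_limit_exists[OF fin obj K], assumption, assumption, rule that)
  note jointly_monic = universal_family_jointly_monic[OF univ hopf_comD(1)[OF obj]]
  note XD = hopf_comD[OF X]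
  define L where "L = \<lparr>car = ob X, mult = und m, unt = und u, comult = und (cm X), counit = und (cu X),
    antipode = und S\<rparr>"
  have arrow: "Arrow A (und t) B = t" if "arr t" "dm t = A" "cd t = B" for A B t
    using that by (cases t) auto
  have L_of: "com_of L = X" "mult_of L = m" "unt_of L = u" "antipode_of L = S" "car L = ob X"
    using XD by (simp_all add: L_def com_of_def mult_of_def unt_of_def antipode_of_def arrow)
  have L: "L \<in> Obj (Hopf_coc M)"
    using X by (simp add: Hopf_coc_simps(1) L_of)
  have p: "com_hom X (com_of (Fo i)) (p i)" if "i \<in> Obj J" for i
    using univ that by (auto simp: is_universal_family_def is_family_def)
  have K_p: "t \<bullet> p i = p j" if "(i, t, j) \<in> K" for i t j
    using univ that by (auto simp: is_universal_family_def is_family_def)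
  have car [simp]: "ob (com_of A) = car A" for A
    by (simp add: com_of_def)
  note pD = com_homD[OF p, simplified]
  have p_arrow: "Arrow (ob X) (und (p i)) (car (Fo i)) = p i" if "i \<in> Obj J" for i
    using pD[OF that] by (simp add: arrow)
  have "is_limit J (Hopf_coc M) Fo Fm L (\<lambda>i. und (p i))"
    unfolding is_limit_def
  proof (intro conjI allI impI)
    show "is_cone J (Hopf_coc M) Fo Fm L (\<lambda>i. und (p i))"
      unfolding is_cone_def
    proof (intro conjI ballI)
      show "und (p i) \<in> Hom (Hopf_coc M) L (Fo i)" if i: "i \<in> Obj J" for i
        using L F.map_Obj[OF i] hopf_morphism_iff[of L "Fo i" "und (p i)"] X obj[OF i] p[OF i] p_m[OF i] p_u[OF i]
        by (simp add: Hopf_coc_simps(1,2) L_of p_arrow[OF i])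
      show "Fm x \<cdot>\<^bsub>Hopf_coc M\<^esub> und (p i) = und (p j)"
        if ij: "i \<in> Obj J" "j \<in> Obj J" and x: "x \<in> Hom J i j" for i j x
      proof -
        let ?x = "Arrow (car (Fo i)) (Fm x) (car (Fo j))"
        have "arr ?x"
          using F.map_Hom[OF x] by (simp add: Hopf_coc_simps(2) is_hopf_morphism_def)
        then have "und (?x \<bullet> p i) = Fm x \<cdot> und (p i)"
          using pD[OF ij(1)] by simp
        moreover have "?x \<bullet> p i = p j"
          using K_p[of i ?x j] K_iff[of i ?x j] x by auto
        ultimately show ?thesis
          by (simp add: Hopf_coc_simps(3))
      qed
    qed (rule L)
  next
    fix Y q
    assume cone: "is_cone J (Hopf_coc M) Fo Fm Y q"
    then have Y: "Y \<in> Obj (Hopf_coc M)"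
      and q: "\<And>i. i \<in> Obj J \<Longrightarrow> is_hopf_morphism M Y (Fo i) (q i)"
      and q_nat: "\<And>i j x. x \<in> Hom J i j \<Longrightarrow> Fm x \<cdot> q i = q j"
      using F.dom.Hom_Obj by (auto simp: is_cone_def Hopf_coc_simps(2,3))
    note Y' = Y[unfolded Hopf_coc_simps(1)]
    note YD = hopf_comD[OF Y', simplified]
    let ?q = "\<lambda>i. Arrow (car Y) (q i) (car (Fo i))"
    have q': "com_hom (com_of Y) (com_of (Fo i)) (?q i) \<and>
        ?q i \<bullet> mult_of Y = mult_of (Fo i) \<bullet> (?q i \<boxtimes> ?q i) \<and> ?q i \<bullet> unt_of Y = unt_of (Fo i)"
      if "i \<in> Obj J" for i
      using q[OF that] hopf_morphism_iff[OF Y' obj[OF that]] by simp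
    have q'_arr: "arr (?q i)" if "i \<in> Obj J" for i
      using q[OF that] by (simp add: is_hopf_morphism_def)
    have "is_family coc_category (Obj J) ?F K (com_of Y) ?q"
      unfolding is_family_def
    proof (intro conjI ballI)
      show "case k of (i, t, j) \<Rightarrow> t \<cdot>\<^bsub>coc_category\<^esub> ?q i = ?q j" if K: "k \<in> K" for k
      proof -
        obtain i t j where k: "k = (i, t, j)"
          by (metis prod_cases3)
        obtain x where x: "x \<in> Hom J i j" and t: "t = Arrow (car (Fo i)) (Fm x) (car (Fo j))"
          using K K_iff[of i t j] k by auto
        have "arr t"
          using F.map_Hom[OF x] t by (simp add: Hopf_coc_simps(2) is_hopf_morphism_def)
        then have "t \<bullet> ?q i = ?q j"
          using t q_nat[OF x] q'_arr F.dom.Hom_Obj[OF x] by (intro arr_eqI) auto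
        then show ?thesis
          using k by simp
      qed
    qed (use YD q' hopf_comD(1)[OF obj] in auto)
    then have "\<exists>!h. h \<in> Hom coc_category (com_of Y) X \<and> (\<forall>i\<in>Obj J. p i \<cdot>\<^bsub>coc_category\<^esub> h = ?q i)"
      using univ unfolding is_universal_family_def by blast
    then obtain h where h: "com_hom (com_of Y) X h" and p_h: "\<And>i. i \<in> Obj J \<Longrightarrow> p i \<bullet> h = ?q i"
      by (auto dest: ex1_implies_ex)
    note hD = com_homD[OF h, simplified]
    have h_arrow: "Arrow (car Y) (und h) (car L) = h"
      using hD L_of(5) by (simp add: arrow)
    \<comment> \<open>So far the lift \<open>h\<close> is only a comonoid morphism. Compatibility
      with multiplication and unit is tested after the projections, where it follows from that of
      \<open>?q i\<close> and \<open>p i\<close>.\<close>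
    have "h \<bullet> mult_of Y = m \<bullet> (h \<boxtimes> h)"
    proof (rule jointly_monic, assumption)
      show "coc (com_of Y \<boxtimes>\<^sub>c com_of Y)" "com_hom (com_of Y \<boxtimes>\<^sub>c com_of Y) X (h \<bullet> mult_of Y)"
        using YD com_hom_tcmp[OF _ YD(2) h] by simp_all
      show "com_hom (com_of Y \<boxtimes>\<^sub>c com_of Y) X (m \<bullet> (h \<boxtimes> h))"
        by (rule com_hom_tcmp[OF _ com_hom_tten XD(2)]) (use XD YD h in simp_all)
      fix i assume i: "i \<in> Obj J"
      have "p i \<bullet> h \<bullet> mult_of Y = mult_of (Fo i) \<bullet> (?q i \<boxtimes> ?q i)"
        using p_h[OF i, THEN tcmp_tail] q'[OF i] by simp
      also have "\<dots> = p i \<bullet> m \<bullet> (h \<boxtimes> h)"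
        using p_m[OF i, THEN tcmp_tail] pD[OF i] hD by (simp add: tten_tcmp p_h[OF i])
      finally show "p i \<bullet> h \<bullet> mult_of Y = p i \<bullet> m \<bullet> (h \<boxtimes> h)" .
    qed
    moreover have "h \<bullet> unt_of Y = u"
    proof (rule jointly_monic[OF _ coc_unit_com com_hom_tcmp[OF coc_unit_com YD(3) h] XD(3)], assumption)
      fix i assume i: "i \<in> Obj J"
      show "p i \<bullet> h \<bullet> unt_of Y = p i \<bullet> u"
        using p_h[OF i, THEN tcmp_tail] q'[OF i] p_u[OF i] by simp
    qed
    ultimately have h_hopf: "is_hopf_morphism M Y L (und h)"
      using hopf_morphism_iff[OF Y', of L] X h by (simp add: L_of(1-4) h_arrow)
    show "\<exists>!k. k \<in> Hom (Hopf_coc M) Y L \<and> (\<forall>i\<in>Obj J. und (p i) \<cdot>\<^bsub>Hopf_coc M\<^esub> k = q i)"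
    proof (rule ex1I)
      have "und (p i) \<cdot> und h = q i" if i: "i \<in> Obj J" for i
        using arg_cong[OF p_h[OF i], of und] pD[OF i] hD by simp
      then show "und h \<in> Hom (Hopf_coc M) Y L \<and> (\<forall>i\<in>Obj J. und (p i) \<cdot>\<^bsub>Hopf_coc M\<^esub> und h = q i)"
        using Y L h_hopf by (simp add: Hopf_coc_simps(2,3))
      fix k
      assume k: "k \<in> Hom (Hopf_coc M) Y L \<and> (\<forall>i\<in>Obj J. und (p i) \<cdot>\<^bsub>Hopf_coc M\<^esub> k = q i)"
      let ?k = "Arrow (car Y) k (car L)"
      have "is_hopf_morphism M Y L k"
        using k by (simp add: Hopf_coc_simps(2))
      then have k_hom: "com_hom (com_of Y) X ?k"
        using hopf_morphism_iff[OF Y', of L] X by (simp add: L_of(1-4))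
      have "?k = h"
      proof (rule jointly_monic[OF _ YD(1) k_hom h], assumption)
        fix i assume i: "i \<in> Obj J"
        have "p i \<bullet> ?k = ?q i"
          using k i pD[OF i] com_homD[OF k_hom] q'_arr[OF i] L_of(5)
          by (intro arr_eqI) (simp_all add: Hopf_coc_simps(3))
        then show "p i \<bullet> ?k = p i \<bullet> h"
          using p_h[OF i] by simp
      qed
      then show "k = und h"
        by auto
    qed
  qed
  then show ?thesis
    by blast
qed

lemma finitely_complete_Hopf_coc: "finitely_complete (Hopf_coc M)"
  unfolding finitely_complete_def using category_Hopf_coc Hopf_coc_limit by blast

end

section \<open>Exact functors preserve equalizers\<close>

context category
begin

lemma equalizer_is_mono:
  assumes E: "is_equalizer C A B f g E e"
  shows "is_mono C E A e"
  unfolding is_mono_def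
proof (intro conjI allI ballI impI)
  have e: "e \<in> Hom C E A" and f: "f \<in> Hom C A B" and g: "g \<in> Hom C A B" and fe: "f \<cdot> e = g \<cdot> e"
    using E by (simp_all add: is_equalizer_def)
  show "e \<in> Hom C E A"
    by (rule e)
  fix X k k'
  assume k: "k \<in> Hom C X E" "k' \<in> Hom C X E" and eq: "e \<cdot> k = e \<cdot> k'"
  have "f \<cdot> (e \<cdot> k) = g \<cdot> (e \<cdot> k)"
    using fe cmp_assoc[OF k(1) e f] cmp_assoc[OF k(1) e g] by simp
  moreover have "e \<cdot> k \<in> Hom C X A"
    using k(1) e by (rule cmp_Hom)
  ultimately have "\<exists>!l. l \<in> Hom C X E \<and> e \<cdot> l = e \<cdot> k"
    using E unfolding is_equalizer_def by blast
  with k eq show "k = k'"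
    by metis
qed

lemma coequalizer_is_epi:
  assumes Q: "is_coequalizer C A B f g Q q"
  shows "is_epi C B Q q"
  unfolding is_epi_def
proof (intro conjI allI ballI impI)
  have q: "q \<in> Hom C B Q" and f: "f \<in> Hom C A B" and g: "g \<in> Hom C A B" and qf: "q \<cdot> f = q \<cdot> g"
    using Q by (simp_all add: is_coequalizer_def)
  show "q \<in> Hom C B Q"
    by (rule q)
  fix X k k'
  assume k: "k \<in> Hom C Q X" "k' \<in> Hom C Q X" and eq: "k \<cdot> q = k' \<cdot> q"
  have "(k \<cdot> q) \<cdot> f = (k \<cdot> q) \<cdot> g"
    using qf cmp_assoc[OF f q k(1)] cmp_assoc[OF g q k(1)] by simp
  moreover have "k \<cdot> q \<in> Hom C B X"
    using q k(1) by (rule cmp_Hom)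
  ultimately have "\<exists>!l. l \<in> Hom C Q X \<and> l \<cdot> q = k \<cdot> q"
    using Q unfolding is_coequalizer_def by blast
  with k eq show "k = k'"
    by metis
qed

end

section \<open>Differences and kernels in preadditive categories\<close>

context preadditive_category
begin

abbreviation zero :: "'o \<Rightarrow> 'o \<Rightarrow> 'm" where
  "zero A B \<equiv> \<one>\<^bsub>H A B\<^esub>"

definition diff :: "'o \<Rightarrow> 'o \<Rightarrow> 'm \<Rightarrow> 'm \<Rightarrow> 'm" where
  "diff A B f g = f \<otimes>\<^bsub>H A B\<^esub> inv\<^bsub>H A B\<^esub> g"

lemma hom_group: "\<lbrakk>A \<in> Obj C; B \<in> Obj C\<rbrakk> \<Longrightarrow> group (H A B)"
  using hom_comm_group comm_group_def by blast

lemma zero_Hom: "\<lbrakk>A \<in> Obj C; B \<in> Obj C\<rbrakk> \<Longrightarrow> zero A B \<in> Hom C A B"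
  using group.is_monoid[OF hom_group, THEN monoid.one_closed] hom_carrier by blast

lemma diff_Hom:
  assumes "f \<in> Hom C A B" "g \<in> Hom C A B"
  shows "diff A B f g \<in> Hom C A B"
proof -
  have AB: "A \<in> Obj C" "B \<in> Obj C"
    using assms Hom_Obj by auto
  interpret G: group "H A B"
    by (rule hom_group[OF AB])
  show ?thesis
    using assms hom_carrier[OF AB] G.m_closed G.inv_closed by (auto simp: diff_def)
qed

lemma diff_zero_iff:
  assumes "f \<in> Hom C A B" "g \<in> Hom C A B"
  shows "diff A B f g = zero A B \<longleftrightarrow> f = g"
proof -
  have AB: "A \<in> Obj C" "B \<in> Obj C"
    using assms Hom_Obj by auto
  interpret G: group "H A B"
    by (rule hom_group[OF AB])
  have "f \<in> carrier (H A B)" "g \<in> carrier (H A B)"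
    using assms hom_carrier[OF AB] by auto
  then show ?thesis
    unfolding diff_def using G.inv_equality[of f "inv\<^bsub>H A B\<^esub> g"] G.inv_inv G.r_inv by auto
qed

lemma additive_diff:
  assumes \<phi>: "\<phi> \<in> hom (H A B) (H A' B')" and A': "A' \<in> Obj C" "B' \<in> Obj C"
    and f: "f \<in> Hom C A B" and g: "g \<in> Hom C A B"
  shows "\<phi> (diff A B f g) = diff A' B' (\<phi> f) (\<phi> g)"
proof -
  have AB: "A \<in> Obj C" "B \<in> Obj C"
    using f Hom_Obj by auto
  interpret G: group_hom "H A B" "H A' B'" \<phi>
    using hom_group[OF AB] hom_group[OF A'] \<phi> by (simp add: group_hom_def group_hom_axioms_def)
  have "f \<in> carrier (H A B)" "g \<in> carrier (H A B)"
    using f g hom_carrier[OF AB] by auto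
  then show ?thesis
    by (simp add: diff_def)
qed

lemma additive_zero:
  assumes "\<phi> \<in> hom (H A B) (H A' B')" "A \<in> Obj C" "B \<in> Obj C" "A' \<in> Obj C" "B' \<in> Obj C"
  shows "\<phi> (zero A B) = zero A' B'"
  using assms by (intro hom_one[OF assms(1)] hom_group)

lemma cmp_zero:
  assumes "g \<in> Hom C B D" "A \<in> Obj C"
  shows "g \<cdot> zero A B = zero A D"
  using additive_zero[OF cmp_additive_right[OF assms(2,1)]] assms Hom_Obj by blast

lemma zero_cmp:
  assumes "f \<in> Hom C A B" "D \<in> Obj C"
  shows "zero B D \<cdot> f = zero A D"
  using additive_zero[OF cmp_additive_left[OF assms(2,1)]] assms Hom_Obj by blast

lemma diff_cmp:
  assumes "f \<in> Hom C A B" "g \<in> Hom C A B" "h \<in> Hom C X A"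
  shows "diff A B f g \<cdot> h = diff X B (f \<cdot> h) (g \<cdot> h)"
  using additive_diff[OF cmp_additive_left[of B h X A]] assms Hom_Obj by blast

lemma cmp_diff:
  assumes "f \<in> Hom C A B" "g \<in> Hom C A B" "h \<in> Hom C B X"
  shows "h \<cdot> diff A B f g = diff A X (h \<cdot> f) (h \<cdot> g)"
  using additive_diff[OF cmp_additive_right[of A h B X]] assms Hom_Obj by blast

text \<open>The definition compares \<open>f \<cdot> h\<close> with a composite of the zero arrow
  from \<open>A\<close>; here that composite is absorbed into the zero arrow from
  \<open>X\<close>.\<close>

lemma is_kernel_iff:
  "is_kernel C H A B f K k \<longleftrightarrow>
     f \<in> Hom C A B \<and> k \<in> Hom C K A \<and> f \<cdot> k = zero K B \<and>
     (\<forall>X h. h \<in> Hom C X A \<and> f \<cdot> h = zero X B \<longrightarrow> (\<exists>!l. l \<in> Hom C X K \<and> k \<cdot> l = h))"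
proof (cases "f \<in> Hom C A B")
  case True
  then have zero: "zero A B \<in> Hom C A B" and "B \<in> Obj C"
    using zero_Hom Hom_Obj by blast+
  then have *: "h \<in> Hom C X A \<and> f \<cdot> h = zero A B \<cdot> h \<longleftrightarrow> h \<in> Hom C X A \<and> f \<cdot> h = zero X B" for h X
    using zero_cmp by auto
  show ?thesis
    unfolding is_kernel_def is_equalizer_def * using True zero *[of k K] by blast
qed (simp add: is_kernel_def is_equalizer_def)

lemma is_cokernel_iff:
  "is_cokernel C H A B f Q q \<longleftrightarrow>
     f \<in> Hom C A B \<and> q \<in> Hom C B Q \<and> q \<cdot> f = zero A Q \<and>
     (\<forall>X h. h \<in> Hom C B X \<and> h \<cdot> f = zero A X \<longrightarrow> (\<exists>!l. l \<in> Hom C Q X \<and> l \<cdot> q = h))"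
proof (cases "f \<in> Hom C A B")
  case True
  then have zero: "zero A B \<in> Hom C A B" and "A \<in> Obj C"
    using zero_Hom Hom_Obj by blast+
  then have *: "h \<in> Hom C B X \<and> h \<cdot> f = h \<cdot> zero A B \<longleftrightarrow> h \<in> Hom C B X \<and> h \<cdot> f = zero A X" for h X
    using cmp_zero by auto
  show ?thesis
    unfolding is_cokernel_def is_coequalizer_def * using True zero *[of q Q] by blast
qed (simp add: is_cokernel_def is_coequalizer_def)

lemma is_equalizer_iff_kernel:
  assumes "f \<in> Hom C A B" "g \<in> Hom C A B"
  shows "is_equalizer C A B f g E e \<longleftrightarrow> is_kernel C H A B (diff A B f g) E e"
proof -
  have "diff A B f g \<cdot> h = zero X B \<longleftrightarrow> f \<cdot> h = g \<cdot> h" if h: "h \<in> Hom C X A" for X h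
    unfolding diff_cmp[OF assms h] using h assms by (intro diff_zero_iff) (auto intro: cmp_Hom)
  then have *: "h \<in> Hom C X A \<and> diff A B f g \<cdot> h = zero X B \<longleftrightarrow> h \<in> Hom C X A \<and> f \<cdot> h = g \<cdot> h" for X h
    by blast
  show ?thesis
    unfolding is_kernel_iff is_equalizer_def * using assms diff_Hom[OF assms] *[of e E] by blast
qed

lemma mono_if_zero:
  assumes f: "f \<in> Hom C A B"
    and zero: "\<And>X t. \<lbrakk>t \<in> Hom C X A; f \<cdot> t = zero X B\<rbrakk> \<Longrightarrow> t = zero X A"
  shows "is_mono C A B f"
  unfolding is_mono_def
proof (intro conjI allI ballI impI)
  fix X g h
  assume gh: "g \<in> Hom C X A" "h \<in> Hom C X A" "f \<cdot> g = f \<cdot> h"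
  have "f \<cdot> diff X A g h = diff X B (f \<cdot> g) (f \<cdot> h)"
    using gh f by (intro cmp_diff)
  also have "\<dots> = zero X B"
    using gh f diff_zero_iff[of "f \<cdot> g" X B "f \<cdot> h"] cmp_Hom by metis
  finally have "diff X A g h = zero X A"
    using gh diff_Hom by (intro zero)
  then show "g = h"
    using gh diff_zero_iff by blast
qed (rule f)

text \<open>Since \<open>v\<close> is monic, \<open>v \<cdot> q\<close> and \<open>q\<close> kill
  the same arrows.\<close>

lemma kernel_mono_cmp:
  assumes K: "is_kernel C H A Q q E e" and v: "is_mono C Q B v"
  shows "is_kernel C H A B (v \<cdot> q) E e"
proof -
  have q: "q \<in> Hom C A Q" and v': "v \<in> Hom C Q B"
    using K v by (simp_all add: is_kernel_iff is_mono_def)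
  have "(v \<cdot> q) \<cdot> h = zero X B \<longleftrightarrow> q \<cdot> h = zero X Q" if h: "h \<in> Hom C X A" for X h
  proof -
    have X: "X \<in> Obj C" "Q \<in> Obj C"
      using h v' Hom_Obj by auto
    have "(v \<cdot> q) \<cdot> h = zero X B \<longleftrightarrow> v \<cdot> (q \<cdot> h) = v \<cdot> zero X Q"
      using cmp_assoc[OF h q v'] cmp_zero[OF v' X(1)] by simp
    also have "\<dots> \<longleftrightarrow> q \<cdot> h = zero X Q"
      using v zero_Hom[OF X] cmp_Hom[OF h q] unfolding is_mono_def by metis
    finally show ?thesis .
  qed
  then have *: "h \<in> Hom C X A \<and> (v \<cdot> q) \<cdot> h = zero X B \<longleftrightarrow> h \<in> Hom C X A \<and> q \<cdot> h = zero X Q" for X h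
    by blast
  have e: "e \<in> Hom C E A" "q \<cdot> e = zero E Q"
    and univ: "\<forall>X h. h \<in> Hom C X A \<and> q \<cdot> h = zero X Q \<longrightarrow> (\<exists>!l. l \<in> Hom C X E \<and> e \<cdot> l = h)"
    using K by (simp_all add: is_kernel_iff)
  show ?thesis
    unfolding is_kernel_iff *
  proof (intro conjI)
    show "v \<cdot> q \<in> Hom C A B"
      using q v' by (rule cmp_Hom)
    show "(v \<cdot> q) \<cdot> e = zero E B"
      using e *[of e E] by simp
  qed (rule e univ)+
qed

end

section \<open>Monos and coimages in abelian categories\<close>

context abelian_category
begin

lemma has_equalizers: "has_equalizers C"
  unfolding has_equalizers_def using is_equalizer_iff_kernel kernels diff_Hom by metis

text \<open>\<open>e\<close> is the kernel of some \<open>g\<close>, and \<open>g\<close> factors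
  through the cokernel \<open>q\<close> of \<open>e\<close>. So whatever \<open>q\<close> kills is
  killed by \<open>g\<close> and hence factors through \<open>e\<close>.\<close>

lemma mono_short_exact:
  assumes e: "is_mono C E A e" and q: "is_cokernel C H E A e Q q"
  shows "is_short_exact C H E A Q e q"
proof -
  obtain D g where g: "is_kernel C H A D g E e"
    using mono_is_kernel[OF e] by blast
  have hom: "g \<in> Hom C A D" "q \<in> Hom C A Q" "e \<in> Hom C E A"
    using g q by (simp_all add: is_kernel_iff is_cokernel_iff)
  obtain g' where g': "g' \<in> Hom C Q D" "g' \<cdot> q = g"
    using g q unfolding is_kernel_iff is_cokernel_iff by metis
  have "g \<cdot> h = zero X D" if h: "h \<in> Hom C X A" "q \<cdot> h = zero X Q" for X h
    using cmp_assoc[OF h(1) hom(2) g'(1)] g' h cmp_zero[OF g'(1)] Hom_Obj[OF h(1)] by simp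
  then have "is_kernel C H A Q q E e"
    using g q unfolding is_kernel_iff is_cokernel_iff by metis
  with q show ?thesis
    by (simp add: is_short_exact_def)
qed

text \<open>Any \<open>t\<close> killed by \<open>v\<close> is shown to be zero by means of its cokernel \<open>p\<close>: since \<open>p q\<close> is
  the cokernel of some \<open>h\<close> and \<open>w h = 0\<close>, also \<open>q h = 0\<close>, so that \<open>p\<close> is split mono.\<close>

lemma coimage_mono:
  assumes e: "is_kernel C H A B w E e" and q: "is_cokernel C H E A e Q q"
  obtains v where "w = v \<cdot> q" "is_mono C Q B v"
proof -
  have hom: "w \<in> Hom C A B" "e \<in> Hom C E A" "q \<in> Hom C A Q"
    using e q by (simp_all add: is_kernel_iff is_cokernel_iff)
  obtain v where v: "v \<in> Hom C Q B" "v \<cdot> q = w"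
    using e q unfolding is_kernel_iff is_cokernel_iff by metis
  have q_epi: "is_epi C A Q q"
    using q coequalizer_is_epi unfolding is_cokernel_def by blast
  have "t = zero X Q" if t: "t \<in> Hom C X Q" "v \<cdot> t = zero X B" for X t
  proof -
    have obj: "X \<in> Obj C" "Q \<in> Obj C"
      using Hom_Obj[OF t(1)] by simp_all
    obtain R p where p: "is_cokernel C H X Q t R p"
      using cokernels[OF t(1)] by blast
    have p_hom: "p \<in> Hom C Q R" "p \<cdot> t = zero X R"
      using p by (simp_all add: is_cokernel_iff)
    obtain w' where w': "w' \<in> Hom C R B" "w' \<cdot> p = v"
      using p t v(1) unfolding is_cokernel_iff by metis
    have p_epi: "is_epi C Q R p"
      using p coequalizer_is_epi unfolding is_cokernel_def by blast
    have pq: "p \<cdot> q \<in> Hom C A R"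
      using hom(3) p_hom(1) by (rule cmp_Hom)
    have "is_epi C A R (p \<cdot> q)"
      unfolding is_epi_def
    proof (intro conjI allI ballI impI)
      fix Y g h
      assume gh: "g \<in> Hom C R Y" "h \<in> Hom C R Y" "g \<cdot> (p \<cdot> q) = h \<cdot> (p \<cdot> q)"
      then have "(g \<cdot> p) \<cdot> q = (h \<cdot> p) \<cdot> q"
        using cmp_assoc[OF hom(3) p_hom(1)] by simp
      then have "g \<cdot> p = h \<cdot> p"
        using q_epi cmp_Hom[OF p_hom(1)] gh unfolding is_epi_def by blast
      then show "g = h"
        using p_epi gh unfolding is_epi_def by blast
    qed (rule pq)
    then obtain D h where h: "is_cokernel C H D A h R (p \<cdot> q)"
      using epi_is_cokernel by blast
    have h_hom: "h \<in> Hom C D A" "(p \<cdot> q) \<cdot> h = zero D R"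
      using h by (simp_all add: is_cokernel_iff)
    have D: "D \<in> Obj C"
      using Hom_Obj[OF h_hom(1)] by simp
    have "w = w' \<cdot> (p \<cdot> q)"
      using cmp_assoc[OF hom(3) p_hom(1) w'(1)] v w' by simp
    then have "w \<cdot> h = zero D B"
      using cmp_assoc[OF h_hom(1) pq w'(1)] h_hom(2) cmp_zero[OF w'(1) D] by simp
    then obtain k where k: "k \<in> Hom C D E" "e \<cdot> k = h"
      using e h_hom(1) unfolding is_kernel_iff by metis
    have "q \<cdot> h = (q \<cdot> e) \<cdot> k"
      using cmp_assoc[OF k(1) hom(2,3)] k(2) by simp
    also have "\<dots> = zero D Q"
      using q zero_cmp[OF k(1) obj(2)] by (simp add: is_cokernel_iff)
    finally obtain s where s: "s \<in> Hom C R Q" "s \<cdot> (p \<cdot> q) = q"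
      using h hom(3) unfolding is_cokernel_iff by metis
    have "(s \<cdot> p) \<cdot> q = idt C Q \<cdot> q"
      using cmp_assoc[OF hom(3) p_hom(1) s(1)] s(2) cmp_idt_left[OF hom(3)] by simp
    then have "s \<cdot> p = idt C Q"
      using q_epi cmp_Hom[OF p_hom(1) s(1)] idt_Hom[OF obj(2)] unfolding is_epi_def by blast
    then have "t = s \<cdot> (p \<cdot> t)"
      using cmp_assoc[OF t(1) p_hom(1) s(1)] cmp_idt_left[OF t(1)] by simp
    then show ?thesis
      using p_hom(2) cmp_zero[OF s(1) obj(1)] by simp
  qed
  then have "is_mono C Q B v"
    by (rule mono_if_zero[OF v(1)])
  with v(2) show thesis
    by (intro that) simp_all
qed

text \<open>\<open>is_exact\<close> speaks of short exact sequences only, and two are used: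
  \<open>E\<close>, \<open>A\<close>, \<open>Q\<close>, by which \<open>Fm e\<close> is a kernel of
  \<open>Fm q\<close>, and \<open>Q\<close>, \<open>B\<close>, \<open>Z\<close>, by which
  \<open>Fm v\<close> is monic. Additivity identifies the image of the difference with the
  difference of the images.\<close>

lemma exact_preserves_equalizers:
  assumes F: "cat_functor C C Fo Fm" and add: "is_additive C H Fo Fm" and ex: "is_exact C H Fo Fm"
  shows "preserves_equalizers C C Fo Fm"
  unfolding preserves_equalizers_def
proof (intro allI impI)
  interpret F: cat_functor C C Fo Fm
    by (rule F)
  fix A B f g E e
  assume eq: "is_equalizer C A B f g E e"
  then have f: "f \<in> Hom C A B" and g: "g \<in> Hom C A B" and e: "e \<in> Hom C E A"
    by (simp_all add: is_equalizer_def)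
  have AB: "A \<in> Obj C" "B \<in> Obj C"
    using Hom_Obj[OF f] by simp_all
  let ?w = "diff A B f g"
  have ker: "is_kernel C H A B ?w E e"
    using eq is_equalizer_iff_kernel[OF f g] by simp
  obtain Q q where q: "is_cokernel C H E A e Q q"
    using cokernels[OF e] by blast
  obtain v where v: "?w = v \<cdot> q" "is_mono C Q B v"
    by (rule coimage_mono[OF ker q])
  have hom: "q \<in> Hom C A Q" "v \<in> Hom C Q B"
    using q v by (simp_all add: is_cokernel_iff is_mono_def)
  obtain Z c where c: "is_cokernel C H Q B v Z c"
    using cokernels[OF hom(2)] by blast
  have "is_kernel C H (Fo A) (Fo Q) (Fm q) (Fo E) (Fm e)"
    using ex mono_short_exact[OF equalizer_is_mono[OF eq] q] by (auto simp: is_exact_def is_short_exact_def)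
  moreover have "is_mono C (Fo Q) (Fo B) (Fm v)"
    using ex mono_short_exact[OF v(2) c] equalizer_is_mono
    unfolding is_exact_def is_short_exact_def is_kernel_def by blast
  ultimately have "is_kernel C H (Fo A) (Fo B) (Fm v \<cdot> Fm q) (Fo E) (Fm e)"
    by (rule kernel_mono_cmp)
  also have "Fm v \<cdot> Fm q = Fm ?w"
    using F.map_cmp[OF hom] v(1) by simp
  also have "Fm ?w = diff (Fo A) (Fo B) (Fm f) (Fm g)"
    using add AB f g F.map_Obj by (intro additive_diff) (auto simp: is_additive_def)
  finally show "is_equalizer C (Fo A) (Fo B) (Fm f) (Fm g) (Fo E) (Fm e)"
    using is_equalizer_iff_kernel[OF F.map_Hom[OF f] F.map_Hom[OF g]] by simp
qed

end

section \<open>Tensor functors in the abelian case\<close>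

context symmetric_monoidal_category
begin

lemma cat_functor_ten_left:
  assumes X: "X \<in> Obj M"
  shows "cat_functor M M (\<lambda>A. X \<otimes>\<^sub>o A) (\<lambda>f. idt M X \<otimes>\<^sub>m f)"
proof unfold_locales
  fix u v i j k
  assume "u \<in> Hom M i j" "v \<in> Hom M j k"
  then show "idt M X \<otimes>\<^sub>m (v \<cdot> u) = (idt M X \<otimes>\<^sub>m v) \<cdot> (idt M X \<otimes>\<^sub>m u)"
    using ten_cmp[of "idt M X" X X "idt M X" X u i j v k] idt_Hom[OF X] cmp_idt_left[OF idt_Hom[OF X]] by simp
qed (use X in \<open>auto intro: ten_Hom idt_Hom simp: ten_idt\<close>)

lemma cat_functor_ten_right:
  assumes X: "X \<in> Obj M"
  shows "cat_functor M M (\<lambda>A. A \<otimes>\<^sub>o X) (\<lambda>f. f \<otimes>\<^sub>m idt M X)"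
proof unfold_locales
  fix u v i j k
  assume "u \<in> Hom M i j" "v \<in> Hom M j k"
  then show "(v \<cdot> u) \<otimes>\<^sub>m idt M X = (v \<otimes>\<^sub>m idt M X) \<cdot> (u \<otimes>\<^sub>m idt M X)"
    using ten_cmp[of u i j v k "idt M X" X X "idt M X" X] idt_Hom[OF X] cmp_idt_left[OF idt_Hom[OF X]] by simp
qed (use X in \<open>auto intro: ten_Hom idt_Hom simp: ten_idt\<close>)

end

lemma abelian_tensor_preserves_equalizers:
  assumes "abelian_symmetric_monoidal_category M"
  shows "tensor_preserves_equalizers M"
proof -
  interpret symmetric_monoidal_category M
    using assms by (simp add: abelian_symmetric_monoidal_category_def)
  obtain H where H: "abelian_category M H"
    and exact: "\<And>X. X \<in> Obj M \<Longrightarrow>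
      is_additive M H (\<lambda>A. X \<otimes>\<^sub>o\<^bsub>M\<^esub> A) (\<lambda>f. idt M X \<otimes>\<^sub>m\<^bsub>M\<^esub> f) \<and>
      is_exact M H (\<lambda>A. X \<otimes>\<^sub>o\<^bsub>M\<^esub> A) (\<lambda>f. idt M X \<otimes>\<^sub>m\<^bsub>M\<^esub> f) \<and>
      is_additive M H (\<lambda>A. A \<otimes>\<^sub>o\<^bsub>M\<^esub> X) (\<lambda>f. f \<otimes>\<^sub>m\<^bsub>M\<^esub> idt M X) \<and>
      is_exact M H (\<lambda>A. A \<otimes>\<^sub>o\<^bsub>M\<^esub> X) (\<lambda>f. f \<otimes>\<^sub>m\<^bsub>M\<^esub> idt M X)"
    using assms unfolding abelian_symmetric_monoidal_category_def by blast
  interpret A: abelian_category M H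
    by (rule H)
  show ?thesis
    by unfold_locales
      (use exact A.has_equalizers A.exact_preserves_equalizers cat_functor_ten_left cat_functor_ten_right
        in blast)+
qed

theorem proposition3p7:
  fixes M :: "('o, 'm) sm_category"
  shows "(symmetric_monoidal_category M \<and> has_equalizers M \<and>
          (\<forall>X\<in>Obj M.
             preserves_equalizers M M (\<lambda>A. X \<otimes>\<^sub>o\<^bsub>M\<^esub> A) (\<lambda>f. idt M X \<otimes>\<^sub>m\<^bsub>M\<^esub> f) \<and>
             preserves_equalizers M M (\<lambda>A. A \<otimes>\<^sub>o\<^bsub>M\<^esub> X) (\<lambda>f. f \<otimes>\<^sub>m\<^bsub>M\<^esub> idt M X))
          \<longrightarrow> finitely_complete (Hopf_coc M)) \<and>
         (abelian_symmetric_monoidal_category M \<longrightarrow> finitely_complete (Hopf_coc M))"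
  using tensor_preserves_equalizers.finitely_complete_Hopf_coc abelian_tensor_preserves_equalizers
  by (auto simp: tensor_preserves_equalizers_def tensor_preserves_equalizers_axioms_def)

end
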